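(* Let $d\ge 1$ be an integer and let $1\le p<\infty$. Let $\{E_L\}_{L\ge 1}$ be a sequence of measurable subsets of the unit sphere $\mathbb{S}^d\subset\mathbb{R}^{d+1}$. The following are equivalent: (i) there is a constant $C_p>0$, independent of $L$, such that for every integer $L\ge 1$ and every polynomial $Q_L$ in $d+1$ variables of degree at most $L$, $$\int_{\mathbb{S}^d}|Q_L|^p\,d\sigma\le C_p\int_{E_L}|Q_L|^p\,d\sigma;$$ (ii) $$\inf\{\,h_z(E_L): L\ge 1 \text{ an integer},\ z\in\mathbb{R}^{d+1},\ |z|<1,\ 1-|z|=1/L\,\}>0.$$
   Context: $\sigma$ is the surface measure on $\mathbb{S}^d$. Polynomials have complex coefficients. For a measurable set $F\subset\mathbb{S}^d$ and $z\in\mathbb{R}^{d+1}$ with $|z|<1$, $h_z(F)$ is the value at $z$ of the harmonic extension of the characteristic function $\chi_F$ to the unit ball (harmonic measure), i.e. $$h_z(F)=\frac{1}{\sigma(\mathbb{S}^d)}\int_F\frac{1-|z|^2}{|z-u|^{d+1}}\,d\sigma(u).$$ *)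

theory Defs
  imports "HOL-Analysis.Analysis"
begin

text \<open>
  The surface measure on the unit sphere, given by integration in polar coordinates: a Borel
  set A of unit vectors has as measure the dimension of the ambient space times the volume of
  the cone \<open>{r u | 0 < r < 1, u \<in> A}\<close>, see \<open>emeasure_sphere_measure\<close>. Like Lebesgue measure it is
  completed, so that its measurable sets need not be Borel. Its space is the sphere.
\<close>

definition sphere_borel_measure :: "(real ^ 'n) measure" where
  "sphere_borel_measure =
     scale_measure (of_nat CARD('n))
       (distr (restrict_space lborel (ball 0 1 - {0})) (restrict_space borel (sphere 0 1)) sgn)"

definition sphere_measure :: "(real ^ 'n) measure" where
  "sphere_measure = completion sphere_borel_measure"

lemma space_sphere_measure: "space (sphere_measure :: (real ^ 'n) measure) = sphere 0 1"
  by (simp add: sphere_measure_def sphere_borel_measure_def space_scale_measure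
      space_restrict_space)

lemma sgn_measurable_sphere:
  "sgn \<in> restrict_space lborel (ball 0 1 - {0 :: real ^ 'n})
           \<rightarrow>\<^sub>M restrict_space borel (sphere 0 1)"
proof (rule measurable_restrict_space2)
  have "(sgn :: real ^ 'n \<Rightarrow> _) = (\<lambda>x. inverse (norm x) *\<^sub>R x)"
    by (simp add: fun_eq_iff sgn_div_norm)
  then have "(sgn :: real ^ 'n \<Rightarrow> _) \<in> borel_measurable borel"
    by simp
  then show "sgn \<in> borel_measurable (restrict_space lborel (ball 0 1 - {0 :: real ^ 'n}))"
    by (intro measurable_restrict_space1) simp
qed (auto simp: space_restrict_space norm_sgn)

lemma emeasure_sphere_measure:
  fixes A :: "(real ^ 'n) set"
  assumes "A \<in> sets borel" and "A \<subseteq> sphere 0 1"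
  shows "emeasure sphere_measure A =
           of_nat CARD('n) * emeasure lborel {x. 0 < norm x \<and> norm x < 1 \<and> sgn x \<in> A}"
proof -
  have A: "A \<in> sets (restrict_space borel (sphere 0 1))"
    using assms by (auto simp: sets_restrict_space_iff)
  have eq: "sgn -` A \<inter> (ball 0 1 - {0}) = {x. 0 < norm x \<and> norm x < 1 \<and> sgn x \<in> A}"
    by auto
  have "emeasure (sphere_measure :: (real ^ 'n) measure) A = emeasure sphere_borel_measure A"
    unfolding sphere_measure_def using A by (simp add: sphere_borel_measure_def)
  also have "\<dots> = of_nat CARD('n) *
      emeasure (restrict_space lborel (ball 0 1 - {0})) (sgn -` A \<inter> (ball 0 1 - {0}))"
    using A by (simp add: sphere_borel_measure_def emeasure_distr[OF sgn_measurable_sphere]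
        space_restrict_space)
  also have "\<dots> = of_nat CARD('n) * emeasure lborel (sgn -` A \<inter> (ball 0 1 - {0}))"
    by (subst emeasure_restrict_space) auto
  finally show ?thesis
    by (simp only: eq)
qed

text \<open>
  Polynomials with complex coefficients in the variables indexed by \<open>'n\<close> and of total degree at
  most L, as functions on real space; \<open>\<alpha>\<close> ranges over the multi-indices of order at most L.
\<close>

definition polynomials_upto :: "nat \<Rightarrow> (real ^ 'n \<Rightarrow> complex) set" where
  "polynomials_upto L =
     {Q. \<exists>c :: ('n \<Rightarrow> nat) \<Rightarrow> complex.
           Q = (\<lambda>x. \<Sum>\<alpha> | (\<Sum>i\<in>UNIV. \<alpha> i) \<le> L. c \<alpha> * complex_of_real (\<Prod>i\<in>UNIV. (x $ i) ^ \<alpha> i))}"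

lemma finite_multi_indices: "finite {\<alpha> :: 'n::finite \<Rightarrow> nat. (\<Sum>i\<in>UNIV. \<alpha> i) \<le> L}"
proof (rule finite_subset)
  show "{\<alpha> :: 'n \<Rightarrow> nat. (\<Sum>i\<in>UNIV. \<alpha> i) \<le> L} \<subseteq> UNIV \<rightarrow>\<^sub>E {..L}"
  proof
    fix \<alpha> :: "'n \<Rightarrow> nat"
    assume "\<alpha> \<in> {\<alpha>. (\<Sum>i\<in>UNIV. \<alpha> i) \<le> L}"
    then have "\<alpha> i \<le> L" for i
      using member_le_sum[of i UNIV \<alpha>] by simp
    then show "\<alpha> \<in> UNIV \<rightarrow>\<^sub>E {..L}"
      by (simp add: PiE_UNIV_domain)
  qed
  show "finite ((UNIV :: 'n set) \<rightarrow>\<^sub>E {..L})"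
    by (intro finite_PiE) auto
qed

definition harmonic_measure :: "real ^ 'n \<Rightarrow> (real ^ 'n) set \<Rightarrow> real" where
  "harmonic_measure z F =
     1 / measure sphere_measure (sphere 0 1 :: (real ^ 'n) set) *
     (LINT u:F|sphere_measure. (1 - (norm z)\<^sup>2) / norm (z - u) ^ CARD('n))"

end

theory Submission
  imports Defs "HOL-Probability.Probability_Measure" "HOL-Complex_Analysis.Complex_Analysis"
    "HOL-Computational_Algebra.Fundamental_Theorem_Algebra"
begin

text \<open>
  On a circle: for a trigonometric polynomial T of degree at most L and \<open>r = L/(L+1)\<close>, reflecting the zeros
  of the associated algebraic polynomial into the exterior of the disc shows that \<open>|T(0)|\<^sup>q\<close> is at most a
  constant to the power q times the mean of \<open>|T|\<^sup>q\<close> against the Poisson kernel of the disc at r, for every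
  \<open>q > 0\<close>. Letting q be small yields, for every \<open>\<epsilon> > 0\<close>, that \<open>k(A) |T(0)|\<^sup>p\<close> is at most
  \<open>K \<integral>\<^sub>A k |T|\<^sup>p + \<epsilon> \<integral> k |T|\<^sup>p\<close>, where k is that kernel and K depends only on p and \<open>\<epsilon>\<close>.

  On the sphere: this is averaged over the great circles through a point u. In polar coordinates about u the
  averaged kernel is \<open>k(\<theta>) / sin\<^sup>d\<^sup>-\<^sup>1 \<theta>\<close>, which dominates the Poisson kernel of the ball at
  \<open>z = (1 - 1/L) u\<close>; hence (ii) bounds the left-hand side from below. Integrating over u (the averaged kernel
  is symmetric and has bounded mass) and absorbing the \<open>\<epsilon>\<close>-term gives (i).

  Conversely, a power of a Fejer kernel of degree about L with peak at \<open>z/|z|\<close> is bounded by \<open>L\<^sup>-\<^sup>d\<close> times the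
  Poisson kernel at z, while its integral over the sphere is at least a multiple of \<open>L\<^sup>-\<^sup>d\<close>; testing (i)
  on it gives (ii).
\<close>

subsection \<open>Poisson means of polynomials on the unit circle\<close>

text \<open>The mean inequality for a single exponent cannot suffice: T could owe its mean to the
  complement of A. Small exponents exclude this. By Hoelder, if A has measure at least a, the
  complement contributes at most the factor (1 - a)^(1 - s) to the mean of order s, and for small s
  this lies below a^s, which tends to 1. Arbitrarily small exponents are available on a circle
  because a polynomial in one variable splits into linear factors whose zeros can be moved; this is
  what forces the cut into great circles. The radius L/(L+1) keeps r^L above 1/e and, unlike 1 -
  1/L, is positive at L = 1. Averaging over the great circles through u calls for a measure on the
  directions orthogonal to u. Lebesgue measure on a hollow cylinder with axis u serves: its point x
  stands for the circle through u and the direction of the component of x orthogonal to u. The error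
  term involves the integral over whole circles, which |Q(u)| does not dominate; hence it can be
  absorbed only after integration over u.\<close>

text \<open>The Poisson kernel of the disc at r, normalised to mass 1 over one period. It takes the
  cosine of the angle, so that an inner product of unit vectors can be inserted.\<close>

definition circle_kernel :: "real \<Rightarrow> real \<Rightarrow> real" where
  "circle_kernel r c = (1 - r\<^sup>2) / (2 * pi * (1 - 2 * r * c + r\<^sup>2))"

lemma circle_kernel_denom_pos:
  fixes r c :: real
  assumes "0 \<le> r" "r < 1" "c \<le> 1"
  shows "0 < 1 - 2 * r * c + r\<^sup>2"
proof -
  have "2 * r * c \<le> 2 * r" using assms by (simp add: mult_left_le)
  moreover have "0 < (1 - r)\<^sup>2" using assms by simp
  ultimately show ?thesis by (simp add: power2_eq_square algebra_simps)
qed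

lemma circle_kernel_nonneg:
  assumes "0 \<le> r" "r < 1" "c \<le> 1"
  shows "0 \<le> circle_kernel r c"
proof -
  have "r\<^sup>2 \<le> 1" using assms by (simp add: power_le_one)
  then show ?thesis
    using circle_kernel_denom_pos[OF assms] by (simp add: circle_kernel_def)
qed

lemma norm_one_minus_cis: "(cmod (1 - complex_of_real r * cis t))\<^sup>2 = 1 - 2 * r * cos t + r\<^sup>2"
proof -
  have "(cmod (1 - complex_of_real r * cis t))\<^sup>2 = (1 - r * cos t)\<^sup>2 + (r * sin t)\<^sup>2"
    by (simp add: cmod_power2)
  also have "\<dots> = 1 - 2 * r * cos t + r\<^sup>2 * ((cos t)\<^sup>2 + (sin t)\<^sup>2)"
    by (simp only: power2_eq_square algebra_simps)
  finally show ?thesis by simp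
qed

lemma continuous_on_circle_kernel:
  fixes f :: "'a::t2_space \<Rightarrow> real"
  assumes "0 \<le> r" "r < 1" "continuous_on A f"
  shows "continuous_on A (\<lambda>x. circle_kernel r (cos (f x)))"
proof -
  have "continuous_on A (\<lambda>x. cos (f x))" by (rule continuous_on_cos[OF assms(3)])
  then show ?thesis
    unfolding circle_kernel_def
    using circle_kernel_denom_pos[OF assms(1,2) cos_le_one]
    by (intro continuous_on_divide continuous_on_diff continuous_on_add continuous_on_mult
        continuous_on_const) (auto simp: less_le)
qed

text \<open>Cauchy's formula at r for G(z) (1 - r^2) / (1 - r z): the extra factor is 1 at z = r,
  has no pole in the closed disc, and turns the Cauchy kernel into the Poisson kernel on the
  circle.\<close>

lemma poisson_formula:
  assumes G: "G holomorphic_on cball 0 1" and r: "0 \<le> r" "r < 1"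
  shows "((\<lambda>t. of_real (circle_kernel r (cos t)) * G (cis t)) has_integral G (of_real r)) {0..2*pi}"
proof -
  define f where "f = (\<lambda>z. G z * of_real (1 - r\<^sup>2) / (1 - of_real r * z))"
  have denom: "1 - of_real r * z \<noteq> 0" if "cmod z \<le> 1" for z
  proof
    assume "1 - of_real r * z = 0"
    then have "cmod (of_real r * z) = 1" by (metis eq_iff_diff_eq_0 norm_one)
    moreover have "r * cmod z \<le> r * 1" using that r by (intro mult_left_mono) auto
    ultimately show False using r by (simp add: norm_mult)
  qed
  have "f holomorphic_on cball 0 1"
    unfolding f_def using denom by (intro holomorphic_intros G) auto
  from Cauchy_integral_circlepath_simple[OF this, of "of_real r"] r
  have "((\<lambda>u. f u / (u - of_real r)) has_contour_integral 2 * of_real pi * \<i> * f (of_real r))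
      (part_circlepath 0 1 0 (2 * pi))"
    by (simp add: circlepath_def)
  then have int: "((\<lambda>t. f (cis t) / (cis t - of_real r) * \<i> * cis t) has_integral
      2 * of_real pi * \<i> * f (of_real r)) {0..2*pi}"
    by (subst (asm) has_contour_integral_part_circlepath_iff) (simp_all add: mult_ac)
  have "1 - r * r \<noteq> 0" using r mult_strict_mono'[of r 1 r 1] by simp
  then have "(1::complex) - of_real r * of_real r \<noteq> 0"
    by (metis of_real_1 of_real_diff of_real_eq_0_iff of_real_mult)
  then have fr: "f (of_real r) = G (of_real r)"
    by (simp add: f_def power2_eq_square)
  have "f (cis t) / (cis t - of_real r) * \<i> * cis t =
      2 * of_real pi * \<i> * (of_real (circle_kernel r (cos t)) * G (cis t))" for t
  proof -
    let ?a = "1 - complex_of_real r * cis t"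
    have cis: "cis t * cis (- t) = 1" by (simp add: cis_mult)
    have "cis t * cnj ?a = cis t - of_real r * (cis t * cis (- t))"
      by (simp add: cis_cnj right_diff_distrib mult_ac del: cis_mult)
    then have 1: "cis t - of_real r = cis t * cnj ?a" by (simp only: cis mult_1_right)
    have "?a * cnj ?a = of_real ((cmod ?a)\<^sup>2)" by (simp only: complex_norm_square)
    then have 2: "?a * cnj ?a = of_real (1 - 2 * r * cos t + r\<^sup>2)" by (simp only: norm_one_minus_cis)
    have "f (cis t) / (cis t - of_real r) * \<i> * cis t =
        \<i> * G (cis t) * of_real (1 - r\<^sup>2) / (?a * cnj ?a)"
      unfolding 1 f_def by (simp only: times_divide_eq_left times_divide_eq_right divide_divide_eq_left mult.assoc) (simp add: mult_ac)
    also have "\<dots> = 2 * of_real pi * \<i> * (of_real (circle_kernel r (cos t)) * G (cis t))"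
      unfolding 2 circle_kernel_def by simp
    finally show ?thesis .
  qed
  with int have "((\<lambda>t. 2 * of_real pi * \<i> * (of_real (circle_kernel r (cos t)) * G (cis t)))
      has_integral (2 * of_real pi * \<i>) * G (of_real r)) {0..2*pi}"
    by (simp only: fr)
  from has_integral_mult_right[OF this, of "inverse (2 * of_real pi * \<i>)"] show ?thesis
    by (simp add: field_simps)
qed

lemma has_integral_circle_kernel:
  assumes r: "0 \<le> r" "r < 1"
  shows "((\<lambda>t. circle_kernel r (cos t)) has_integral 1) {0..2*pi}"
  using has_integral_Re[OF poisson_formula[of "\<lambda>_. 1", OF _ r]] by simp

text \<open>A zero-free g is exp h on the disc, so |g|^q is the modulus of the holomorphic function
  exp (q h), however small q is. The dilation by \<rho> is needed because h exists on the open disc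
  while the Poisson formula wants the closed one.\<close>

lemma poisson_powr_mean_scaled:
  assumes g: "g holomorphic_on ball 0 1" and nz: "\<And>z. z \<in> ball 0 1 \<Longrightarrow> g z \<noteq> 0"
    and r: "0 \<le> r" "r < 1" and \<rho>: "0 < \<rho>" "\<rho> < 1"
  shows "cmod (g (of_real (\<rho> * r))) powr q \<le>
    integral {0..2*pi} (\<lambda>t. circle_kernel r (cos t) * cmod (g (of_real \<rho> * cis t)) powr q)"
proof -
  obtain h where h: "h holomorphic_on ball 0 1" and gh: "\<And>z. z \<in> ball 0 1 \<Longrightarrow> g z = exp (h z)"
    using contractible_imp_holomorphic_log[OF g convex_imp_contractible[OF convex_ball]] nz by metis
  have abs: "cmod (exp (of_real q * h z)) = cmod (g z) powr q" if "z \<in> ball 0 1" for z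
    using gh[OF that] nz[OF that] by (simp add: powr_def)
  have in_ball: "of_real \<rho> * z \<in> ball 0 1" if "cmod z \<le> 1" for z
  proof -
    have "\<rho> * cmod z \<le> \<rho> * 1" using that \<rho> by (intro mult_left_mono) auto
    then have "\<rho> * cmod z < 1" using \<rho> by linarith
    then show ?thesis using \<rho> by (simp add: norm_mult)
  qed
  define G where "G = (\<lambda>z. exp (of_real q * h (of_real \<rho> * z)))"
  have "(h \<circ> (\<lambda>z. of_real \<rho> * z)) holomorphic_on cball 0 1"
  proof (rule holomorphic_on_compose_gen)
    show "h holomorphic_on ball 0 1" by (rule h)
  qed (use in_ball in \<open>auto intro!: holomorphic_intros\<close>)
  then have "G holomorphic_on cball 0 1"
    unfolding G_def o_def by (intro holomorphic_intros)
  note int = poisson_formula[OF this r]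
  have norm_eq: "cmod (of_real (circle_kernel r (cos t)) * G (cis t)) =
      circle_kernel r (cos t) * cmod (g (of_real \<rho> * cis t)) powr q" for t
    unfolding norm_mult G_def using circle_kernel_nonneg[OF r cos_le_one[of t]]
    by (subst abs) (use in_ball[of "cis t"] in simp_all)
  have cont_g: "continuous_on {0..2*pi} (\<lambda>t. cmod (g (of_real \<rho> * cis t)))"
    by (intro continuous_intros continuous_on_compose2[OF holomorphic_on_imp_continuous_on[OF g]])
      (use in_ball in auto)
  have cont: "continuous_on {0..2*pi}
      (\<lambda>t. circle_kernel r (cos t) * cmod (g (of_real \<rho> * cis t)) powr q)"
    using nz in_ball
    by (intro continuous_intros continuous_on_circle_kernel[OF r] continuous_on_powr cont_g) auto
  have "cmod (integral {0..2*pi} (\<lambda>t. of_real (circle_kernel r (cos t)) * G (cis t))) \<le>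
      integral {0..2*pi} (\<lambda>t. circle_kernel r (cos t) * cmod (g (of_real \<rho> * cis t)) powr q)"
    using int cont norm_eq
    by (intro integral_norm_bound_integral) (auto intro: integrable_continuous_interval)
  then show ?thesis
    unfolding integral_unique[OF int] using abs[of "of_real \<rho> * of_real r"] in_ball[of "of_real r"] r
    by (simp add: G_def)
qed

text \<open>The limit \<rho> -> 1 of the dilated inequality. Zeros of g on the circle itself are
  allowed; q > 0 keeps the integrand continuous there.\<close>

lemma poisson_powr_mean:
  assumes g: "g holomorphic_on ball 0 1" "continuous_on (cball 0 1) g"
    and nz: "\<And>z. z \<in> ball 0 1 \<Longrightarrow> g z \<noteq> 0"
    and r: "0 \<le> r" "r < 1" and q: "0 < q"
  shows "cmod (g (of_real r)) powr q \<le>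
    integral {0..2*pi} (\<lambda>t. circle_kernel r (cos t) * cmod (g (cis t)) powr q)"
proof -
  define F where "F = (\<lambda>\<rho>. integral {0..2*pi}
      (\<lambda>t. circle_kernel r (cos t) * cmod (g (of_real \<rho> * cis t)) powr q))"
  have "continuous_on ({0..1} \<times> cbox 0 (2*pi))
      (\<lambda>(\<rho>, t). circle_kernel r (cos t) * cmod (g (of_real \<rho> * cis t)) powr q)"
    unfolding split_beta using q
    by (intro continuous_intros continuous_on_circle_kernel[OF r] continuous_on_powr'
        continuous_on_compose2[OF g(2)]) (auto simp: norm_mult)
  from integral_continuous_on_param[OF this] have contF: "continuous_on {0..1} F"
    by (simp add: F_def)
  have "continuous_on {0..1} (\<lambda>\<rho>::real. cmod (g (of_real (\<rho> * r))) powr q)"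
  proof (intro continuous_on_powr' continuous_on_norm continuous_on_const continuous_on_compose2[OF g(2)])
    show "continuous_on {0..1} (\<lambda>\<rho>. complex_of_real (\<rho> * r))" by (intro continuous_intros)
    show "(\<lambda>\<rho>. of_real (\<rho> * r)) ` {0..1} \<subseteq> cball (0::complex) 1"
      using r by (auto simp: norm_mult intro!: mult_le_one)
  qed (use q in auto)
  then have contD: "continuous_on (closure {0<..<1}) (\<lambda>\<rho>. F \<rho> - cmod (g (of_real (\<rho> * r))) powr q)"
    using contF by (simp add: continuous_on_diff)
  have "0 \<le> F \<rho> - cmod (g (of_real (\<rho> * r))) powr q" if "\<rho> \<in> {0<..<1}" for \<rho>
    using poisson_powr_mean_scaled[OF g(1) nz r, of \<rho> q] that by (simp add: F_def)
  from continuous_ge_on_closure[OF contD _ this, of 1] show ?thesis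
    by (simp add: F_def)
qed

text \<open>
  The zeros of p inside the disc are reflected in the unit circle; since
  \<open>|w - r|\<^sup>2 \<ge> r |w - 1|\<^sup>2\<close> whenever \<open>|w| \<ge> 1\<close>, passing from the point 1 to the point r costs only
  a factor \<open>r\<^sup>1\<^sup>/\<^sup>2\<close> for each zero.
\<close>

lemma reflected_zeros:
  fixes p :: "complex poly"
  assumes "p \<noteq> 0" and r: "0 < r" "r < 1"
  shows "\<exists>g. g holomorphic_on UNIV \<and> (\<forall>z\<in>ball 0 1. g z \<noteq> 0) \<and>
     (\<forall>z. cmod z = 1 \<longrightarrow> cmod (g z) = cmod (poly p z)) \<and>
     sqrt r ^ degree p * cmod (poly p 1) \<le> cmod (g (of_real r))"
  using assms(1)
proof (induction "degree p" arbitrary: p)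
  case 0
  then obtain c where c: "p = [:c:]" "c \<noteq> 0" using degree_eq_zeroE by (metis pCons_0_0)
  then show ?case by (intro exI[of _ "\<lambda>_. c"]) auto
next
  case (Suc k)
  then obtain w where w: "poly p w = 0"
    by (metis fundamental_theorem_of_algebra constant_degree nat.distinct(1))
  then obtain s where s: "p = [:- w, 1:] * s" by (auto simp: poly_eq_0_iff_dvd elim: dvdE)
  have s0: "s \<noteq> 0" using s Suc.prems by auto
  then have "degree p = 1 + degree s" unfolding s by (subst degree_mult_eq) auto
  then have ds: "degree s = k" using Suc.hyps by simp
  obtain g where g: "g holomorphic_on UNIV" "\<forall>z\<in>ball 0 1. g z \<noteq> 0"
     "\<forall>z. cmod z = 1 \<longrightarrow> cmod (g z) = cmod (poly s z)"
     "sqrt r ^ k * cmod (poly s 1) \<le> cmod (g (of_real r))"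
    using Suc.hyps(1)[OF _ s0] ds by metis
  define \<phi> where "\<phi> z = (if cmod w \<ge> 1 then z - w else 1 - cnj w * z)" for z
  have "\<phi> holomorphic_on UNIV"
    unfolding \<phi>_def by (cases "cmod w \<ge> 1") (auto intro!: holomorphic_intros)
  moreover have "\<phi> z \<noteq> 0" if "z \<in> ball 0 1" for z
  proof -
    have "cmod (cnj w * z) < 1" if "cmod w < 1"
      using mult_strict_mono'[of "cmod w" 1 "cmod z" 1] that \<open>z \<in> ball 0 1\<close>
      by (simp add: norm_mult)
    then show ?thesis
      using that by (auto simp: \<phi>_def)
  qed
  moreover have "cmod (\<phi> z) = cmod (z - w)" if "cmod z = 1" for z
  proof -
    have "cmod (1 - cnj w * z) = cmod (z * cnj (z - w))"
      using that complex_norm_square[of z] by (simp add: algebra_simps)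
    also have "\<dots> = cmod (z - w)" using that by (simp only: norm_mult complex_mod_cnj mult_1)
    finally show ?thesis by (simp add: \<phi>_def)
  qed
  moreover have "sqrt r * cmod (1 - w) \<le> cmod (\<phi> (of_real r))"
  proof (rule power2_le_imp_le)
    show "(sqrt r * cmod (1 - w))\<^sup>2 \<le> (cmod (\<phi> (of_real r)))\<^sup>2"
    proof (cases "cmod w \<ge> 1")
      case True
      then have "1 \<le> (cmod w)\<^sup>2" by (simp add: one_le_power)
      \<comment> \<open>Both cases come from an identity: |r - w|^2 - r |1 - w|^2 = (1 - r) (|w|^2 -
        r) here, and |1 - cnj w r|^2 - r |1 - w|^2 = (1 - r) (1 - r |w|^2) for a reflected
        zero.\<close>
      then have "0 \<le> (1 - r) * ((Re w)\<^sup>2 + (Im w)\<^sup>2 - r)"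
        using r by (intro mult_nonneg_nonneg) (simp_all add: cmod_power2)
      also have "\<dots> = (r - Re w)\<^sup>2 + (Im w)\<^sup>2 - r * ((1 - Re w)\<^sup>2 + (Im w)\<^sup>2)"
        by (simp add: power2_eq_square algebra_simps)
      finally show ?thesis using True r by (simp add: \<phi>_def power_mult_distrib cmod_power2)
    next
      case False
      then have "(cmod w)\<^sup>2 \<le> 1" by (simp add: power_le_one)
      then have "r * ((Re w)\<^sup>2 + (Im w)\<^sup>2) \<le> 1 * 1"
        using r by (intro mult_mono) (simp_all add: cmod_power2)
      then have "0 \<le> (1 - r) * (1 - r * ((Re w)\<^sup>2 + (Im w)\<^sup>2))"
        using r by (intro mult_nonneg_nonneg) simp_all
      also have "\<dots> = (1 - Re w * r)\<^sup>2 + (Im w * r)\<^sup>2 - r * ((1 - Re w)\<^sup>2 + (Im w)\<^sup>2)"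
        by (simp add: power2_eq_square algebra_simps)
      finally show ?thesis using False r by (simp add: \<phi>_def power_mult_distrib cmod_power2)
    qed
  qed simp
  then have "(sqrt r * cmod (1 - w)) * (sqrt r ^ k * cmod (poly s 1)) \<le>
      cmod (\<phi> (of_real r)) * cmod (g (of_real r))"
    using g(4) r by (intro mult_mono) simp_all
  moreover have "poly p z = (z - w) * poly s z" for z by (simp add: s algebra_simps)
  ultimately show ?case
    using g unfolding Suc.hyps(2)[symmetric]
    by (intro exI[of _ "\<lambda>z. \<phi> z * g z"]) (auto simp: norm_mult mult_ac intro!: holomorphic_intros)
qed

text \<open>At most 2 L zeros at a cost of \<open>sqrt r\<close> each give the factor
  \<open>r ^ L\<close>.\<close>

lemma poly_powr_le_poisson:
  fixes p :: "complex poly"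
  assumes deg: "degree p \<le> 2 * L" and r: "0 < r" "r < 1" and q: "0 < q"
  shows "(r ^ L * cmod (poly p 1)) powr q \<le>
    integral {0..2*pi} (\<lambda>t. circle_kernel r (cos t) * cmod (poly p (cis t)) powr q)"
proof (cases "p = 0")
  case False
  from reflected_zeros[OF this r] obtain g where g: "g holomorphic_on UNIV" "\<forall>z\<in>ball 0 1. g z \<noteq> 0"
     "\<forall>z. cmod z = 1 \<longrightarrow> cmod (g z) = cmod (poly p z)"
     "sqrt r ^ degree p * cmod (poly p 1) \<le> cmod (g (of_real r))" by blast
  have "r ^ L = sqrt r ^ (2 * L)" using r by (simp add: power_mult)
  also have "\<dots> \<le> sqrt r ^ degree p" using r deg by (intro power_decreasing) simp_all
  finally have "r ^ L * cmod (poly p 1) \<le> sqrt r ^ degree p * cmod (poly p 1)"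
    by (intro mult_right_mono) simp_all
  then have "r ^ L * cmod (poly p 1) \<le> cmod (g (of_real r))" using g(4) by linarith
  then have "(r ^ L * cmod (poly p 1)) powr q \<le> cmod (g (of_real r)) powr q"
    using r q by (intro powr_mono2) simp_all
  also have "\<dots> \<le> integral {0..2*pi} (\<lambda>t. circle_kernel r (cos t) * cmod (g (cis t)) powr q)"
    using g(1,2) r q
    by (intro poisson_powr_mean) (auto intro: holomorphic_on_subset
        holomorphic_on_imp_continuous_on)
  finally show ?thesis using g(3) by simp
qed simp


section \<open>Power means and sets of positive measure\<close>

text \<open>The tangent at l to the concave function x^s, obtained from Young's inequality with
  second factor 1. The point l stays free so that it can be optimised after integration.\<close>

lemma powr_tangent_bound:
  fixes x l s :: real
  assumes "0 \<le> x" "0 < l" "0 < s" "s \<le> 1"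
  shows "x powr s \<le> s * l powr (s - 1) * x + (1 - s) * l powr s"
proof (cases "x = 0")
  case False
  have "(x / l) powr s * 1 powr (1 - s) \<le> s * (x / l) + (1 - s) * 1"
    using assms False by (intro Youngs_inequality_0) auto
  then have "l powr s * (x / l) powr s \<le> l powr s * (s * (x / l) + (1 - s))"
    using assms by (intro mult_left_mono) auto
  moreover have "l powr s * (x / l) powr s = x powr s"
    using assms by (simp add: powr_divide)
  moreover have "l powr s = l powr (s - 1) * l"
    using assms by (simp add: powr_diff)
  ultimately show ?thesis
    using assms by (simp add: algebra_simps)
qed (use assms in auto)

text \<open>Hoelder's inequality on A: integrate the tangent bound and take for the tangent point
  the average of f over A.\<close>

lemma (in prob_space) integral_powr_concave:
  fixes f :: "'a \<Rightarrow> real"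
  assumes f: "f \<in> borel_measurable M" "\<And>x. 0 \<le> f x" "\<And>x. f x \<le> b"
    and A: "A \<in> sets M" and s: "0 < s" "s \<le> 1"
  shows "(LINT x:A|M. f x powr s) \<le> prob A powr (1 - s) * (LINT x:A|M. f x) powr s"
proof -
  have b: "0 \<le> b" using f(2,3) order_trans by blast
  have int: "set_integrable M A f"
    unfolding set_integrable_def
    by (rule integrable_const_bound[where B = b]) (use f A b in \<open>auto split: split_indicator\<close>)
  have int_s: "set_integrable M A (\<lambda>x. f x powr s)"
    unfolding set_integrable_def
    by (rule integrable_const_bound[where B = "b powr s"])
      (use f A b s in \<open>auto intro!: powr_mono2 split: split_indicator\<close>)
  have int_c: "set_integrable M A (\<lambda>x. c :: real)" for c
    unfolding set_integrable_def using A
    by (intro integrable_const_bound[where B = "\<bar>c\<bar>"]) (auto split: split_indicator)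
  have bound: "(LINT x:A|M. f x powr s) \<le> s * l powr (s - 1) * (LINT x:A|M. f x) + (1 - s) * l powr s * prob A"
    if "0 < l" for l
  proof -
    have "(LINT x:A|M. f x powr s) \<le> (LINT x:A|M. s * l powr (s - 1) * f x + (1 - s) * l powr s)"
      using int int_s int_c powr_tangent_bound[OF f(2) that s]
      by (intro set_integral_mono set_integral_add set_integrable_mult_right) auto
    also have "\<dots> = s * l powr (s - 1) * (LINT x:A|M. f x) + (1 - s) * l powr s * prob A"
      using int int_c A
      by (subst set_integral_add) (simp_all add: set_integrable_mult_right set_integral_const algebra_simps)
    finally show ?thesis .
  qed
  let ?I = "LINT x:A|M. f x" and ?a = "prob A"
  have I: "0 \<le> ?I" using f(2) by (auto simp: set_lebesgue_integral_def intro!: integral_nonneg_AE)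
  consider "?a = 0" | "0 < ?a" "?I = 0" | "0 < ?a" "0 < ?I"
    using I measure_nonneg[of M A] by linarith
  then show ?thesis
  proof cases
    case 1
    then have "AE x in M. x \<notin> A" using A by (simp add: prob_eq_0)
    then have "(LINT x:A|M. f x powr s) = (LINT x:A|M. 0)"
      using f(1) A by (intro set_lebesgue_integral_cong_AE) auto
    then show ?thesis by simp
  next
    case 2
    \<comment> \<open>The average of f over A is 0 here and cannot be a tangent point; l =
      \<epsilon>^(1/s) is taken instead and \<epsilon> tends to 0.\<close>
    have "(LINT x:A|M. f x powr s) \<le> \<epsilon>" if "0 < \<epsilon>" for \<epsilon>
    proof -
      have "(LINT x:A|M. f x powr s) \<le> (1 - s) * \<epsilon> * ?a"
        using bound[of "\<epsilon> powr (1 / s)"] 2 s that by (simp add: powr_powr)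
      also have "\<dots> \<le> 1 * \<epsilon> * 1"
        using s that by (intro mult_mono) (auto simp: prob_le_1)
      finally show ?thesis by simp
    qed
    then have "(LINT x:A|M. f x powr s) \<le> 0" by (rule field_le_epsilon[of _ 0, simplified])
    then show ?thesis using 2 by simp
  next
    case 3
    have "s * (?I / ?a) powr (s - 1) * ?I + (1 - s) * (?I / ?a) powr s * ?a = (?I / ?a) powr s * ?a"
      using 3 by (simp add: powr_diff field_simps)
    also have "\<dots> = ?a powr (1 - s) * ?I powr s"
      using 3 by (simp add: powr_divide powr_diff field_simps)
    finally show ?thesis using bound[of "?I / ?a"] 3 by simp
  qed
qed

text \<open>As s decreases to 0, the left-hand side tends to 1 - a and the right-hand side to
  1.\<close>

lemma exists_small_exponent:
  fixes a :: real
  assumes "0 < a" "a < 1"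
  shows "\<exists>s. 0 < s \<and> s \<le> 1 \<and> (1 - a) powr (1 - s) < a powr s"
proof -
  have "((\<lambda>s. a powr s - (1 - a) powr (1 - s)) \<longlongrightarrow> a powr 0 - (1 - a) powr (1 - 0)) (at_right 0)"
    using assms by (intro tendsto_intros) auto
  then have "\<forall>\<^sub>F s in at_right 0. 0 < a powr s - (1 - a) powr (1 - s)"
    using assms by (intro order_tendstoD) auto
  moreover have "\<forall>\<^sub>F s in at_right 0. s \<in> {0<..1 :: real}"
    by (auto simp: eventually_at_right_field intro!: exI[of _ 1])
  ultimately have "\<forall>\<^sub>F s in at_right 0. 0 < s \<and> s \<le> 1 \<and> (1 - a) powr (1 - s) < a powr s"
    by eventually_elim auto
  then show ?thesis by (auto dest!: eventually_happens)
qed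

text \<open>
  A replacement for Jensen's inequality for the logarithm: if the power means of order s \<rightarrow> 0 of f
  all dominate X, and f is small on a set A of measure at least a, then X is small.
\<close>

lemma power_means_set_bound:
  fixes C \<epsilon> :: real
  assumes "0 < C" "0 < \<epsilon>"
  obtains K where "0 \<le> K"
    and "\<And>(M :: 'a measure) f b X A. \<lbrakk>prob_space M; f \<in> borel_measurable M; \<And>x. 0 \<le> f x; \<And>x. f x \<le> b;
       A \<in> sets M; 0 \<le> X; \<And>s. 0 < s \<Longrightarrow> s \<le> 1 \<Longrightarrow> X powr s \<le> C powr s * (LINT x|M. f x powr s)\<rbrakk> \<Longrightarrow>
       measure M A * X \<le> K * (LINT x:A|M. f x) + \<epsilon> * (LINT x|M. f x)"
proof -
  \<comment> \<open>If A has measure at most a, the mean of order 1 alone suffices: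
    \<open>prob A * X\<close> is at most a C \<open>?I\<close> = \<epsilon> \<open>?I\<close>. For a
    \<ge> 1 this covers every A, whence K = 0 below.\<close>
  define a where "a = \<epsilon> / C"
  have a0: "0 < a" using assms by (simp add: a_def)
  obtain s where s: "a < 1 \<Longrightarrow> 0 < s \<and> s \<le> 1 \<and> (1 - a) powr (1 - s) < a powr s"
    using exists_small_exponent[OF a0] by blast
  \<comment> \<open>The solution of \<kappa>^s + (1 - a)^(1 - s) = a^s. If A carries at most the
    fraction \<kappa> of the integral of f, Hoelder on A and on its complement gives X \<le> C a
    \<open>?I\<close> = \<epsilon> \<open>?I\<close>; otherwise \<open>?I\<close> <
    \<open>?IA\<close> / \<kappa>, which yields K = C / \<kappa>.\<close>
  define \<kappa> where "\<kappa> = (a powr s - (1 - a) powr (1 - s)) powr (1 / s)"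
  have \<kappa>: "0 < \<kappa>" if "a < 1" using s[OF that] by (simp add: \<kappa>_def)
  define K where "K = (if a < 1 then C / \<kappa> else 0)"
  have K: "0 \<le> K" using \<kappa> assms by (auto simp: K_def)
  show thesis
  proof (rule that[OF K])
    fix M :: "'a measure" and f :: "'a \<Rightarrow> real" and b X A
    assume M: "prob_space M" and f: "f \<in> borel_measurable M" "\<And>x. 0 \<le> f x" "\<And>x. f x \<le> b"
      and A: "A \<in> sets M" and X: "0 \<le> X"
      and mean: "\<And>s. 0 < s \<Longrightarrow> s \<le> 1 \<Longrightarrow> X powr s \<le> C powr s * (LINT x|M. f x powr s)"
    interpret prob_space M by (rule M)
    have b: "0 \<le> b" using f(2,3) order_trans by blast
    let ?I = "LINT x|M. f x" and ?IA = "LINT x:A|M. f x" and ?IB = "LINT x:space M - A|M. f x"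
    have int: "integrable M f"
      by (rule integrable_const_bound[where B = b]) (use f b in auto)
    have I: "0 \<le> ?I" "0 \<le> ?IA" "0 \<le> ?IB"
      using f(2) by (auto simp: set_lebesgue_integral_def intro!: integral_nonneg_AE)
    have le: "?IA \<le> ?I" "?IB \<le> ?I"
      using f(2) A int integrable_mult_indicator[OF A int]
        integrable_mult_indicator[OF sets.compl_sets[OF A] int] unfolding set_lebesgue_integral_def
      by (auto intro!: integral_mono split: split_indicator)
    have XI: "X \<le> C * ?I" using mean[of 1] X assms f(2) I(1) by simp
    show "prob A * X \<le> K * ?IA + \<epsilon> * ?I"
    proof (cases "prob A \<le> a")
      case True
      have "prob A * X \<le> a * (C * ?I)" using XI X True a0 by (intro mult_mono) auto
      then show ?thesis using K I(2) assms by (simp add: a_def add_increasing)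
    next
      case False
      then have "a < 1" using prob_le_1[of A] by linarith
      note s = s[OF this] and \<kappa> = \<kappa>[OF this]
      have "X \<le> K * ?IA + \<epsilon> * ?I"
      proof (cases "?IA \<le> \<kappa> * ?I")
        case True
        have int_s: "integrable M (\<lambda>x. f x powr s)"
          by (rule integrable_const_bound[where B = "b powr s"])
            (use f b s in \<open>auto intro!: powr_mono2\<close>)
        have eq: "(LINT x|M. f x powr s) = (LINT x:A|M. f x powr s) + (LINT x:space M - A|M. f x powr s)"
          using A int_s sets.sets_into_space[OF A] integrable_mult_indicator[OF A int_s]
            integrable_mult_indicator[OF sets.compl_sets[OF A] int_s]
          by (subst set_integral_Un[symmetric])
            (auto simp: set_integral_space Un_absorb1 set_integrable_def)
        have "(LINT x:A|M. f x powr s) \<le> prob A powr (1 - s) * ?IA powr s"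
          using f A s by (intro integral_powr_concave) auto
        also have "\<dots> \<le> 1 * (\<kappa> * ?I) powr s"
          using s I True by (intro mult_mono powr_le1 powr_mono2) (auto simp: prob_le_1)
        finally have 1: "(LINT x:A|M. f x powr s) \<le> (a powr s - (1 - a) powr (1 - s)) * ?I powr s"
          using s I \<kappa> by (simp add: powr_mult \<kappa>_def powr_powr)
        have "(LINT x:space M - A|M. f x powr s) \<le> prob (space M - A) powr (1 - s) * ?IB powr s"
          using f A s by (intro integral_powr_concave) auto
        also have "\<dots> \<le> (1 - a) powr (1 - s) * ?I powr s"
          using s I le False A by (intro mult_mono powr_mono2) (auto simp: prob_compl prob_le_1)
        finally have "(LINT x|M. f x powr s) \<le> a powr s * ?I powr s"
          using 1 eq by (simp add: algebra_simps)
        then have "C powr s * (LINT x|M. f x powr s) \<le> C powr s * (a powr s * ?I powr s)"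
          by (intro mult_left_mono) auto
        with mean[of s] s have "X powr s \<le> C powr s * (a powr s * ?I powr s)" by simp
        also have "\<dots> = (\<epsilon> * ?I) powr s"
          using assms a0 I by (simp add: powr_mult[symmetric] a_def mult_ac)
        finally have "X \<le> \<epsilon> * ?I"
          using s X I assms powr_less_mono2[of s "\<epsilon> * ?I" X] by (meson linorder_not_le mult_nonneg_nonneg less_imp_le)
        then show ?thesis using K I(2) by (simp add: add_increasing)
      next
        case False
        then have "C * ?I \<le> C * (?IA / \<kappa>)"
          using assms \<kappa> by (intro mult_left_mono) (auto simp: field_simps)
        then have "X \<le> K * ?IA" using XI \<open>a < 1\<close> by (simp add: K_def)
        then show ?thesis using I assms by (simp add: add_increasing2)
      qed
      moreover have "prob A * X \<le> 1 * X" using X by (intro mult_right_mono) auto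
      ultimately show ?thesis by simp
    qed
  qed
qed


section \<open>The inequality on a circle\<close>

lemma nn_integral_circle_kernel:
  assumes r: "0 \<le> r" "r < 1"
  shows "(\<integral>\<^sup>+t. ennreal (circle_kernel r (cos t)) * indicator {0..2*pi} t \<partial>lborel) = 1"
proof -
  let ?k = "\<lambda>t. if t \<in> {0..2*pi} then circle_kernel r (cos t) else 0"
  have "(\<integral>\<^sup>+t. ennreal (circle_kernel r (cos t)) * indicator {0..2*pi} t \<partial>lborel) = (\<integral>\<^sup>+t. ennreal (?k t) \<partial>lborel)"
    by (intro nn_integral_cong) (auto split: split_indicator)
  also have "\<dots> = ennreal 1"
  proof (rule nn_integral_has_integral_lborel)
    show "?k \<in> borel_measurable borel" unfolding circle_kernel_def by measurable
    show "(?k has_integral 1) UNIV"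
      unfolding has_integral_restrict_UNIV by (rule has_integral_circle_kernel[OF r])
  qed (use circle_kernel_nonneg[OF r cos_le_one] in auto)
  finally show ?thesis by simp
qed

text \<open>The inequality (1 + 1/L)^L \<le> e. It makes the loss \<open>r ^ L\<close> harmless,
  uniformly in L.\<close>

lemma radius_power_ge: "exp (- 1) \<le> (real L / (real L + 1)) ^ L"
proof (cases "L = 0")
  case False
  have "(1 + 1 / real L) ^ L \<le> exp (1 / real L) ^ L"
    by (intro power_mono exp_ge_add_one_self) auto
  also have "\<dots> = exp 1" using False by (simp add: exp_of_nat_mult[symmetric])
  finally have "inverse (exp 1) \<le> inverse ((1 + 1 / real L) ^ L)"
    using False by (intro le_imp_inverse_le) (auto simp: add_pos_nonneg)
  also have "\<dots> = (real L / (real L + 1)) ^ L"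
    using False by (simp add: power_inverse[symmetric] field_simps)
  finally show ?thesis by (simp add: exp_minus)
qed auto

text \<open>\<open>power_means_set_bound\<close> for the probability measure whose density is the
  circle kernel, with X = |P(1)|^p and C = e^p from \<open>radius_power_ge\<close>. Extended
  nonnegative integrals allow the result to be integrated over families of circles without
  integrability conditions.\<close>

lemma circle_logvinenko_sereda:
  fixes p \<epsilon> :: real
  assumes p: "0 < p" and "0 < \<epsilon>"
  obtains K where "0 \<le> K"
    and "\<And>L (P :: complex poly) A. \<lbrakk>1 \<le> L; degree P \<le> 2 * L; A \<in> sets borel\<rbrakk> \<Longrightarrow>
      (let k = \<lambda>t. ennreal (circle_kernel (real L / (real L + 1)) (cos t)) * indicator {0..2*pi} t in
       (\<integral>\<^sup>+t. k t * indicator A t \<partial>lborel) * ennreal (cmod (poly P 1) powr p) \<le>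
         ennreal K * (\<integral>\<^sup>+t. k t * (indicator A t * ennreal (cmod (poly P (cis t)) powr p)) \<partial>lborel)
         + ennreal \<epsilon> * (\<integral>\<^sup>+t. k t * ennreal (cmod (poly P (cis t)) powr p) \<partial>lborel))"
proof -
  obtain K where K: "0 \<le> K" and bound:
    "\<And>(M :: real measure) f b X A. \<lbrakk>prob_space M; f \<in> borel_measurable M; \<And>x. 0 \<le> f x; \<And>x. f x \<le> b;
       A \<in> sets M; 0 \<le> X; \<And>s. 0 < s \<Longrightarrow> s \<le> 1 \<Longrightarrow> X powr s \<le> exp p powr s * (LINT x|M. f x powr s)\<rbrakk> \<Longrightarrow>
       measure M A * X \<le> K * (LINT x:A|M. f x) + \<epsilon> * (LINT x|M. f x)"
    using power_means_set_bound[of "exp p" \<epsilon>, OF exp_gt_zero \<open>0 < \<epsilon>\<close>] by blast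
  show thesis
  proof (rule that[OF K])
    fix L :: nat and P :: "complex poly" and A :: "real set"
    assume L: "1 \<le> L" and P: "degree P \<le> 2 * L" and A: "A \<in> sets borel"
    define r where "r = real L / (real L + 1)"
    have r: "0 < r" "r < 1" using L by (auto simp: r_def)
    define k where "k t = circle_kernel r (cos t) * indicator {0..2*pi} t" for t
    define M where "M = density lborel (\<lambda>t. ennreal (k t))"
    define f where "f t = cmod (poly P (cis t)) powr p" for t
    have k0: "0 \<le> k t" for t
      using circle_kernel_nonneg[of r "cos t"] r by (simp add: k_def)
    have k_meas [measurable]: "k \<in> borel_measurable borel"
      unfolding k_def circle_kernel_def by measurable
    have f_cont: "continuous_on UNIV f"
      unfolding f_def using p by (intro continuous_on_powr' continuous_intros) auto
    then have f_meas [measurable]: "f \<in> borel_measurable borel"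
      by (rule borel_measurable_continuous_onI)
    have f0: "0 \<le> f t" for t by (simp add: f_def)
    have "compact ((\<lambda>z. cmod (poly P z) powr p) ` sphere 0 1)"
      using p by (intro compact_continuous_image continuous_on_powr' continuous_intros) auto
    then have "bdd_above ((\<lambda>z. cmod (poly P z) powr p) ` sphere 0 1)"
      by (intro bounded_imp_bdd_above compact_imp_bounded)
    then obtain b where "\<And>y. y \<in> (\<lambda>z. cmod (poly P z) powr p) ` sphere 0 1 \<Longrightarrow> y \<le> b"
      unfolding bdd_above_def by blast
    then have b: "cmod (poly P z) powr p \<le> b" if "cmod z = 1" for z using that by auto
    have fb: "f t \<le> b" for t using b[of "cis t"] by (simp add: f_def)
    have k_eq: "ennreal (circle_kernel r (cos t)) * indicator {0..2*pi} t = ennreal (k t)" for t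
      by (auto simp: k_def split: split_indicator)
    have "(\<integral>\<^sup>+t. ennreal (k t) \<partial>lborel) = 1"
      using nn_integral_circle_kernel[of r] r unfolding k_eq by simp
    then interpret prob_space M
      by (intro prob_spaceI) (simp add: M_def emeasure_density)
    have LINT_M: "(LINT t|M. g t) = integral {0..2*pi} (\<lambda>t. circle_kernel r (cos t) * g t)"
      if "continuous_on UNIV g" "g \<in> borel_measurable borel" for g
    proof -
      have "(LINT t|M. g t) = (LINT t|lborel. k t * g t)"
        unfolding M_def using that k0 by (subst integral_density) auto
      also have "\<dots> = (LINT t:{0..2*pi}|lborel. circle_kernel r (cos t) * g t)"
        by (simp add: set_lebesgue_integral_def k_def mult_ac)
      also have "\<dots> = integral {0..2*pi} (\<lambda>t. circle_kernel r (cos t) * g t)"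
      proof (intro set_borel_integral_eq_integral borel_integrable_atLeastAtMost' continuous_on_mult)
        show "continuous_on {0..2 * pi} (\<lambda>t. circle_kernel r (cos t))"
          using r by (intro continuous_on_circle_kernel continuous_on_id) auto
        show "continuous_on {0..2 * pi} g" using that(1) by (rule continuous_on_subset) auto
      qed
      finally show ?thesis .
    qed
    have mean: "(cmod (poly P 1) powr p) powr s \<le> exp p powr s * (LINT t|M. f t powr s)"
      if s: "0 < s" "s \<le> 1" for s
    proof -
      have ps: "0 < p * s" using p s by simp
      have "exp (- 1) powr (p * s) * cmod (poly P 1) powr (p * s) \<le> (r ^ L * cmod (poly P 1)) powr (p * s)"
        using ps radius_power_ge[of L]
        by (subst powr_mult[symmetric]) (auto intro!: powr_mono2 mult_right_mono simp: r_def)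
      also have "\<dots> \<le> integral {0..2*pi} (\<lambda>t. circle_kernel r (cos t) * cmod (poly P (cis t)) powr (p * s))"
        by (rule poly_powr_le_poisson[OF P r ps])
      also have "\<dots> = (LINT t|M. f t powr s)"
      proof (subst LINT_M)
        show "continuous_on UNIV (\<lambda>t. f t powr s)"
          using s f0 by (intro continuous_on_powr' f_cont continuous_on_const) auto
        show "(\<lambda>t. f t powr s) \<in> borel_measurable borel" by measurable
      qed (auto simp: f_def powr_powr)
      finally have "exp p powr s * (exp (- 1) powr (p * s) * cmod (poly P 1) powr (p * s)) \<le>
          exp p powr s * (LINT t|M. f t powr s)"
        by (intro mult_left_mono) auto
      moreover have "exp p powr s * exp (- 1) powr (p * s) = 1"
        unfolding powr_def by (simp add: mult_exp_exp)
      ultimately show ?thesis by (simp add: powr_powr mult.assoc[symmetric])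
    qed
    have main: "measure M A * cmod (poly P 1) powr p \<le> K * (LINT t:A|M. f t) + \<epsilon> * (LINT t|M. f t)"
      using A by (intro bound[where b = b] mean f0 fb prob_space_axioms) (auto simp: M_def)
    have int: "integrable M f"
      by (rule integrable_const_bound[where B = b]) (use f0 fb in \<open>auto simp: M_def\<close>)
    have 1: "ennreal (measure M A) = (\<integral>\<^sup>+t. ennreal (k t) * indicator A t \<partial>lborel)"
      unfolding emeasure_eq_measure[symmetric] using A by (simp add: M_def emeasure_density)
    have 2: "ennreal (LINT t:A|M. f t) = (\<integral>\<^sup>+t. ennreal (k t) * (indicator A t * ennreal (f t)) \<partial>lborel)"
    proof -
      have "ennreal (LINT t:A|M. f t) = (\<integral>\<^sup>+t. ennreal (indicator A t *\<^sub>R f t) \<partial>M)"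
        unfolding set_lebesgue_integral_def using A f0
        by (intro nn_integral_eq_integral[symmetric] integrable_mult_indicator int) (auto simp: M_def)
      also have "\<dots> = (\<integral>\<^sup>+t. indicator A t * ennreal (f t) \<partial>M)"
        by (intro nn_integral_cong) (auto split: split_indicator)
      finally show ?thesis using A unfolding M_def by (simp add: nn_integral_density)
    qed
    have 3: "ennreal (LINT t|M. f t) = (\<integral>\<^sup>+t. ennreal (k t) * ennreal (f t) \<partial>lborel)"
      using nn_integral_eq_integral[OF int] f0 unfolding M_def by (simp add: nn_integral_density)
    have nonneg: "0 \<le> (LINT t:A|M. f t)" "0 \<le> (LINT t|M. f t)"
      using f0 by (auto simp: set_lebesgue_integral_def intro!: integral_nonneg_AE)
    have "ennreal (measure M A) * ennreal (cmod (poly P 1) powr p) \<le>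
        ennreal K * ennreal (LINT t:A|M. f t) + ennreal \<epsilon> * ennreal (LINT t|M. f t)"
      using main K nonneg \<open>0 < \<epsilon>\<close>
      by (simp only: ennreal_mult[symmetric] ennreal_plus[symmetric] measure_nonneg powr_ge_zero
          mult_nonneg_nonneg less_imp_le ennreal_leI)
    then show "let k = \<lambda>t. ennreal (circle_kernel (real L / (real L + 1)) (cos t)) * indicator {0..2*pi} t in
       (\<integral>\<^sup>+t. k t * indicator A t \<partial>lborel) * ennreal (cmod (poly P 1) powr p) \<le>
         ennreal K * (\<integral>\<^sup>+t. k t * (indicator A t * ennreal (cmod (poly P (cis t)) powr p)) \<partial>lborel)
         + ennreal \<epsilon> * (\<integral>\<^sup>+t. k t * ennreal (cmod (poly P (cis t)) powr p) \<partial>lborel)"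
      unfolding Let_def r_def[symmetric] k_eq f_def[symmetric] 1[symmetric] 2[symmetric] 3[symmetric] .
  qed
qed

subsection \<open>Integration over the sphere along great circles\<close>

lemma borel_measurable_sgn_vec [measurable]: "(sgn :: real ^ 'n \<Rightarrow> _) \<in> borel_measurable borel"
proof -
  have "(sgn :: real ^ 'n \<Rightarrow> _) = (\<lambda>x. inverse (norm x) *\<^sub>R x)"
    by (simp add: fun_eq_iff sgn_div_norm)
  then show ?thesis by simp
qed

lemma borel_measurable_sphere_borel_measure [measurable (raw)]:
  "f \<in> borel_measurable borel \<Longrightarrow> f \<in> borel_measurable (sphere_borel_measure :: (real ^ 'n) measure)"
proof -
  assume "f \<in> borel_measurable borel"
  then have "f \<in> borel_measurable (restrict_space borel (sphere 0 1))"
    by (rule measurable_restrict_space1)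
  moreover have "sets (sphere_borel_measure :: (real ^ 'n) measure) = sets (restrict_space borel (sphere 0 1))"
    by (simp add: sphere_borel_measure_def)
  ultimately show ?thesis
    by (metis measurable_cong_sets)
qed

lemma space_sphere_borel_measure [simp]:
  "space (sphere_borel_measure :: (real ^ 'n) measure) = sphere 0 1"
  by (simp add: sphere_borel_measure_def space_scale_measure space_restrict_space)

section \<open>Polar coordinates\<close>

lemma nn_integral_sphere_borel_measure:
  fixes F :: "real ^ 'n \<Rightarrow> ennreal"
  assumes [measurable]: "F \<in> borel_measurable borel"
  shows "(\<integral>\<^sup>+v. F v \<partial>sphere_borel_measure) =
    ennreal (real CARD('n)) * (\<integral>\<^sup>+x. F (sgn x) * indicator (ball 0 1) x \<partial>lborel)"
proof -
  let ?R = "restrict_space borel (sphere 0 1) :: (real ^ 'n) measure"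
  have F: "F \<in> borel_measurable ?R"
    by (rule measurable_restrict_space1) simp
  have ae: "AE x in lborel. (x :: real ^ 'n) \<noteq> 0"
    using AE_lborel_singleton[of "0 :: real ^ 'n"] by simp
  have "(\<integral>\<^sup>+v. F v \<partial>sphere_borel_measure) = of_nat CARD('n) *
      (\<integral>\<^sup>+x. F (sgn x) \<partial>restrict_space lborel (ball 0 1 - {0}))"
    unfolding sphere_borel_measure_def using F
    by (simp add: nn_integral_scale_measure nn_integral_distr[OF sgn_measurable_sphere])
  also have "\<dots> = of_nat CARD('n) * (\<integral>\<^sup>+x. F (sgn x) * indicator (ball 0 1 - {0}) x \<partial>lborel)"
    by (subst nn_integral_restrict_space) auto
  also have "(\<integral>\<^sup>+x. F (sgn x) * indicator (ball 0 1 - {0}) x \<partial>lborel) =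
      (\<integral>\<^sup>+x. F (sgn x) * indicator (ball 0 1) x \<partial>lborel)"
    by (rule nn_integral_cong_AE) (use ae in eventually_elim, auto split: split_indicator)
  finally show ?thesis by (simp add: ennreal_of_nat_eq_real_of_nat)
qed

lemma nn_integral_lborel_scaleR:
  fixes f :: "'a::euclidean_space \<Rightarrow> ennreal"
  assumes [measurable]: "f \<in> borel_measurable borel" and "c \<noteq> 0"
  shows "(\<integral>\<^sup>+x. f x \<partial>lborel) = ennreal (\<bar>c\<bar> ^ DIM('a)) * (\<integral>\<^sup>+x. f (c *\<^sub>R x) \<partial>lborel)"
  by (subst lborel_affine[OF assms(2), of 0])
    (simp add: nn_integral_density nn_integral_distr nn_integral_cmult)

lemma nn_integral_lborel_translation:
  fixes f :: "'a::euclidean_space \<Rightarrow> ennreal"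
  assumes [measurable]: "f \<in> borel_measurable borel"
  shows "(\<integral>\<^sup>+x. f (c + x) \<partial>lborel) = (\<integral>\<^sup>+x. f x \<partial>lborel)"
  using nn_integral_distr[of "(+) c" lborel borel f] by (simp add: lborel_distr_plus)

lemma nn_integral_power_tail:
  fixes a :: real
  assumes "0 < a" "0 < n"
  shows "(\<integral>\<^sup>+x. ennreal (real n / x ^ Suc n) * indicator {a<..} x \<partial>lborel) = ennreal (1 / a ^ n)"
proof -
  have ae: "AE x in lborel. x \<noteq> a" by (rule AE_lborel_singleton)
  have "(\<integral>\<^sup>+x. ennreal (real n / x ^ Suc n) * indicator {a<..} x \<partial>lborel) =
      (\<integral>\<^sup>+x. ennreal (real n / x ^ Suc n) * indicator {a..} x \<partial>lborel)"
    by (rule nn_integral_cong_AE) (use ae in eventually_elim, auto split: split_indicator)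
  also have "\<dots> = ennreal (0 - - (1 / a ^ n))"
  proof (rule nn_integral_FTC_atLeast)
    fix x assume "a \<le> x"
    then have x: "0 < x" using assms by simp
    have "x ^ n = x * x ^ (n - 1)" using power_minus_mult[OF assms(2), of x] by (simp add: mult.commute)
    then show "((\<lambda>x. - (1 / x ^ n)) has_real_derivative real n / x ^ Suc n) (at x)"
      using x by (auto intro!: derivative_eq_intros simp: field_simps)
    show "0 \<le> real n / x ^ Suc n" using x by simp
  next
    have "((\<lambda>x::real. 1 / x ^ n) \<longlongrightarrow> 0) at_top"
      using assms by (intro tendsto_divide_0[OF tendsto_const] filterlim_at_top_imp_at_infinity
          filterlim_pow_at_top filterlim_ident) auto
    then show "((\<lambda>x::real. - (1 / x ^ n)) \<longlongrightarrow> 0) at_top"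
      using tendsto_minus by fastforce
  qed measurable
  finally show ?thesis by simp
qed

text \<open>Supplies joint measurability for half-lines whose end point varies, as in the Fubini
  exchange for polar coordinates.\<close>

lemma pred_greaterThan [measurable (raw)]:
  fixes f g :: "'a \<Rightarrow> real"
  assumes [measurable]: "f \<in> borel_measurable M" "g \<in> borel_measurable M"
  shows "Measurable.pred M (\<lambda>x. f x \<in> {g x<..})"
  unfolding greaterThan_iff by measurable

text \<open>
  The sphere measure is defined through cones; inserting this and scaling by every \<open>l > 0\<close> in turn reduces
  polar coordinates to Fubini and \<open>\<integral> n l\<^sup>-\<^sup>n\<^sup>-\<^sup>1 dl = |y|\<^sup>-\<^sup>n\<close> over \<open>l > |y|\<close>.
\<close>

lemma nn_integral_polar:
  fixes H :: "real ^ 'n \<Rightarrow> ennreal"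
  assumes [measurable]: "H \<in> borel_measurable borel"
  shows "(\<integral>\<^sup>+x. H x \<partial>lborel) =
    (\<integral>\<^sup>+v. (\<integral>\<^sup>+r. H (r *\<^sub>R v) * ennreal (r ^ (CARD('n) - 1)) * indicator {0<..} r \<partial>lborel)
      \<partial>sphere_borel_measure)"
proof -
  let ?n = "CARD('n)"
  have n: "0 < ?n" by simp
  define J where "J r = ennreal (r ^ (?n - 1)) * indicator {0<..} r" for r :: real
  have [measurable]: "ball (0 :: real ^ 'n) 1 \<in> sets borel" by simp
  have [measurable]: "J \<in> borel_measurable borel" unfolding J_def by measurable
  have ae: "AE x in lborel. (x :: real ^ 'n) \<noteq> 0"
    using AE_lborel_singleton[of "0 :: real ^ 'n"] by simp
  have J_scale: "J (c * r) = ennreal (c ^ (?n - 1)) * J r" if "0 < c" for c r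
    using that by (auto simp: J_def power_mult_distrib ennreal_mult zero_less_mult_iff split: split_indicator)
  have pow_n: "ennreal c * ennreal (c ^ (?n - 1)) = ennreal (c ^ ?n)" if "0 < c" for c
    using that power_minus_mult[OF n, of c] by (simp add: ennreal_mult[symmetric] mult.commute)
  \<comment> \<open>The substitution r = |x| l removes \<open>sgn x\<close> from the argument of
    H.\<close>
  have radial: "(\<integral>\<^sup>+r. H (r *\<^sub>R sgn x) * J r \<partial>lborel) =
      (\<integral>\<^sup>+l. H (l *\<^sub>R x) * J l * ennreal (norm x ^ ?n) \<partial>lborel)" if "x \<noteq> 0" for x :: "real ^ 'n"
  proof -
    have "(\<integral>\<^sup>+r. H (r *\<^sub>R sgn x) * J r \<partial>lborel) =
        ennreal (norm x) * (\<integral>\<^sup>+l. H ((norm x * l) *\<^sub>R sgn x) * J (norm x * l) \<partial>lborel)"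
      using that by (subst nn_integral_real_affine[where c = "norm x" and t = 0]) auto
    also have "\<dots> = ennreal (norm x) * (\<integral>\<^sup>+l. (H (l *\<^sub>R x) * J l) * ennreal (norm x ^ (?n - 1)) \<partial>lborel)"
      using that by (simp add: J_scale sgn_div_norm) (simp add: mult_ac)
    also have "\<dots> = (\<integral>\<^sup>+l. H (l *\<^sub>R x) * J l * ennreal (norm x ^ ?n) \<partial>lborel)"
      using that by (subst nn_integral_cmult[symmetric]) (auto simp: pow_n[symmetric] mult_ac)
    finally show ?thesis .
  qed
  \<comment> \<open>The substitution y = l x turns |x| < 1 into |y| < l, so that after the exchange
    of integrals the variable l occurs in a tail integral only.\<close>
  have scaled: "(\<integral>\<^sup>+x. H (l *\<^sub>R x) * J l * ennreal (norm x ^ ?n) * indicator (ball 0 1) x \<partial>lborel) =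
      (\<integral>\<^sup>+y. H y * ennreal (norm y ^ ?n) * (ennreal (1 / l ^ Suc ?n) * indicator {norm y<..} l) \<partial>lborel)"
    for l :: real
  proof (cases "0 < l")
    case True
    let ?G = "\<lambda>y :: real ^ 'n. H y * ennreal (norm y ^ ?n) * (ennreal (1 / l ^ Suc ?n) * indicator {norm y<..} l)"
    have "?G (l *\<^sub>R x) * ennreal (l ^ ?n) = H (l *\<^sub>R x) * J l * ennreal (norm x ^ ?n) * indicator (ball 0 1) x" for x
    proof -
      have "ennreal ((l * norm x) ^ ?n) * ennreal (1 / l ^ Suc ?n) * ennreal (l ^ ?n) =
          ennreal ((l * norm x) ^ ?n * (1 / l ^ Suc ?n) * l ^ ?n)"
        using True by (simp add: ennreal_mult[symmetric])
      also have "(l * norm x) ^ ?n * (1 / l ^ Suc ?n) * l ^ ?n = l ^ (?n - 1) * norm x ^ ?n"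
        using True power_minus_mult[OF n, of l] by (simp add: power_mult_distrib field_simps)
      also have "ennreal \<dots> = J l * ennreal (norm x ^ ?n)"
        using True by (simp add: J_def ennreal_mult)
      finally have eq: "ennreal ((l * norm x) ^ ?n) * ennreal (1 / l ^ Suc ?n) * ennreal (l ^ ?n) =
          J l * ennreal (norm x ^ ?n)" .
      have ind: "indicator {norm (l *\<^sub>R x)<..} l = (indicator (ball 0 1) x :: ennreal)"
        using True by (auto split: split_indicator)
      have "?G (l *\<^sub>R x) * ennreal (l ^ ?n) = H (l *\<^sub>R x) * indicator (ball 0 1) x *
          (ennreal ((l * norm x) ^ ?n) * ennreal (1 / l ^ Suc ?n) * ennreal (l ^ ?n))"
        unfolding ind using True by (simp add: mult_ac)
      then show ?thesis unfolding eq by (simp add: mult_ac)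
    qed
    note pointwise = this
    have G [measurable]: "?G \<in> borel_measurable borel" by measurable
    have "(\<integral>\<^sup>+x. H (l *\<^sub>R x) * J l * ennreal (norm x ^ ?n) * indicator (ball 0 1) x \<partial>lborel) =
        (\<integral>\<^sup>+x. ?G (l *\<^sub>R x) * ennreal (l ^ ?n) \<partial>lborel)"
      by (simp only: pointwise)
    also have "\<dots> = ennreal (l ^ ?n) * (\<integral>\<^sup>+x. ?G (l *\<^sub>R x) \<partial>lborel)"
      by (subst nn_integral_multc) (measurable, rule mult.commute)
    also have "\<dots> = (\<integral>\<^sup>+y. ?G y \<partial>lborel)"
      using nn_integral_lborel_scaleR[OF G, of l] True by simp
    finally show ?thesis .
  next
    case False
    then have "indicator {norm y<..} l = (0 :: ennreal)" for y :: "real ^ 'n"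
      using le_less_trans[OF norm_ge_zero, of y l] by (auto simp: indicator_def)
    then show ?thesis using False by (simp add: J_def)
  qed
  have "(\<integral>\<^sup>+v. (\<integral>\<^sup>+r. H (r *\<^sub>R v) * ennreal (r ^ (?n - 1)) * indicator {0<..} r \<partial>lborel)
      \<partial>sphere_borel_measure) = (\<integral>\<^sup>+v. (\<integral>\<^sup>+r. H (r *\<^sub>R v) * J r \<partial>lborel) \<partial>sphere_borel_measure)"
    by (simp add: J_def mult_ac)
  also have "\<dots> = ennreal (real ?n) *
      (\<integral>\<^sup>+x. (\<integral>\<^sup>+r. H (r *\<^sub>R sgn x) * J r \<partial>lborel) * indicator (ball 0 1) x \<partial>lborel)"
    by (rule nn_integral_sphere_borel_measure) measurable
  also have "(\<integral>\<^sup>+x. (\<integral>\<^sup>+r. H (r *\<^sub>R sgn x) * J r \<partial>lborel) * indicator (ball 0 1) x \<partial>lborel) =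
      (\<integral>\<^sup>+x. (\<integral>\<^sup>+l. H (l *\<^sub>R x) * J l * ennreal (norm x ^ ?n) * indicator (ball 0 1) x \<partial>lborel) \<partial>lborel)"
    by (rule nn_integral_cong_AE)
      (use ae in eventually_elim, simp add: radial nn_integral_multc)
  also have "\<dots> = (\<integral>\<^sup>+l. (\<integral>\<^sup>+x. H (l *\<^sub>R x) * J l * ennreal (norm x ^ ?n) * indicator (ball 0 1) x \<partial>lborel) \<partial>lborel)"
    by (rule lborel_pair.Fubini') measurable
  also have "\<dots> = (\<integral>\<^sup>+l. (\<integral>\<^sup>+y. H y * ennreal (norm y ^ ?n) *
      (ennreal (1 / l ^ Suc ?n) * indicator {norm y<..} l) \<partial>lborel) \<partial>lborel)"
    by (simp only: scaled)
  also have "\<dots> = (\<integral>\<^sup>+y. (\<integral>\<^sup>+l. H y * ennreal (norm y ^ ?n) *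
      (ennreal (1 / l ^ Suc ?n) * indicator {norm y<..} l) \<partial>lborel) \<partial>lborel)"
    by (rule lborel_pair.Fubini') measurable
  also have "ennreal (real ?n) * \<dots> = (\<integral>\<^sup>+y. H y * ennreal (norm y ^ ?n) *
      (\<integral>\<^sup>+l. ennreal (real ?n / l ^ Suc ?n) * indicator {norm y<..} l \<partial>lborel) \<partial>lborel)"
  proof (subst nn_integral_cmult[symmetric], measurable, rule nn_integral_cong)
    fix y :: "real ^ 'n"
    have "ennreal (real ?n / l ^ Suc ?n) * indicator {norm y<..} l =
        ennreal (real ?n) * (ennreal (1 / l ^ Suc ?n) * indicator {norm y<..} l)" for l :: real
    proof (cases "norm y < l")
      case True
      then have "0 < l" by (rule le_less_trans[OF norm_ge_zero])
      then show ?thesis using True by (simp add: ennreal_mult[symmetric])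
    qed simp
    note scale = this
    have "(\<integral>\<^sup>+l. H y * ennreal (norm y ^ ?n) * (ennreal (1 / l ^ Suc ?n) * indicator {norm y<..} l) \<partial>lborel) =
        H y * ennreal (norm y ^ ?n) * (\<integral>\<^sup>+l. ennreal (1 / l ^ Suc ?n) * indicator {norm y<..} l \<partial>lborel)"
      by (rule nn_integral_cmult) measurable
    moreover have "(\<integral>\<^sup>+l. ennreal (real ?n / l ^ Suc ?n) * indicator {norm y<..} l \<partial>lborel) =
        ennreal (real ?n) * (\<integral>\<^sup>+l. ennreal (1 / l ^ Suc ?n) * indicator {norm y<..} l \<partial>lborel)"
      unfolding scale by (rule nn_integral_cmult) measurable
    ultimately show "ennreal (real ?n) * (\<integral>\<^sup>+l. H y * ennreal (norm y ^ ?n) *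
        (ennreal (1 / l ^ Suc ?n) * indicator {norm y<..} l) \<partial>lborel) = H y * ennreal (norm y ^ ?n) *
        (\<integral>\<^sup>+l. ennreal (real ?n / l ^ Suc ?n) * indicator {norm y<..} l \<partial>lborel)"
      by (simp only: mult_ac)
  qed
  also have "\<dots> = (\<integral>\<^sup>+y. H y \<partial>lborel)"
  proof (rule nn_integral_cong_AE, use ae in eventually_elim)
    fix y :: "real ^ 'n" assume "y \<noteq> 0"
    then have "ennreal (norm y ^ ?n) * ennreal (1 / norm y ^ ?n) = 1"
      by (simp add: ennreal_mult[symmetric])
    then show "H y * ennreal (norm y ^ ?n) *
        (\<integral>\<^sup>+l. ennreal (real ?n / l ^ Suc ?n) * indicator {norm y<..} l \<partial>lborel) = H y"
      using \<open>y \<noteq> 0\<close> n nn_integral_power_tail[of "norm y" ?n] by (simp add: mult.assoc del: power_Suc)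
  qed
  finally show ?thesis by simp
qed

section \<open>Parallel lines and great circles\<close>

text \<open>Fubini along the direction u without a choice of coordinates: a slab of thickness one
  replaces the hyperplane orthogonal to u, since the shifts t that carry a point into the slab form
  an interval of length one.\<close>

lemma nn_integral_slab_translation:
  fixes H :: "'a::euclidean_space \<Rightarrow> ennreal"
  assumes [measurable]: "H \<in> borel_measurable borel" and u: "norm u = 1"
  shows "(\<integral>\<^sup>+x. indicator {x. \<bar>x \<bullet> u\<bar> < 1/2} x * (\<integral>\<^sup>+t. H (x + t *\<^sub>R u) \<partial>lborel) \<partial>lborel) =
    (\<integral>\<^sup>+x. H x \<partial>lborel)"
proof -
  have uu: "u \<bullet> u = 1" using u by (simp add: dot_square_norm)
  have [measurable]: "{x::'a. \<bar>x \<bullet> u\<bar> < 1/2} \<in> sets borel" by measurable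
  have "(\<integral>\<^sup>+x. indicator {x. \<bar>x \<bullet> u\<bar> < 1/2} x * (\<integral>\<^sup>+t. H (x + t *\<^sub>R u) \<partial>lborel) \<partial>lborel) =
      (\<integral>\<^sup>+x. (\<integral>\<^sup>+t. indicator {x. \<bar>x \<bullet> u\<bar> < 1/2} x * H (x + t *\<^sub>R u) \<partial>lborel) \<partial>lborel)"
    by (simp add: nn_integral_cmult)
  also have "\<dots> = (\<integral>\<^sup>+t. (\<integral>\<^sup>+x. indicator {x. \<bar>x \<bullet> u\<bar> < 1/2} x * H (x + t *\<^sub>R u) \<partial>lborel) \<partial>lborel)"
    by (rule lborel_pair.Fubini') measurable
  also have "\<dots> = (\<integral>\<^sup>+t. (\<integral>\<^sup>+x. H x * indicator {x \<bullet> u - 1/2<..<x \<bullet> u + 1/2} t \<partial>lborel) \<partial>lborel)"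
  proof (rule nn_integral_cong)
    fix t
    let ?g = "\<lambda>x. H x * indicator {x. \<bar>x \<bullet> u - t\<bar> < 1/2} x"
    have [measurable]: "{x::'a. \<bar>x \<bullet> u - t\<bar> < 1/2} \<in> sets borel" by measurable
    have "(\<integral>\<^sup>+x. indicator {x. \<bar>x \<bullet> u\<bar> < 1/2} x * H (x + t *\<^sub>R u) \<partial>lborel) = (\<integral>\<^sup>+x. ?g (t *\<^sub>R u + x) \<partial>lborel)"
      by (intro nn_integral_cong) (simp add: inner_add_left uu add.commute indicator_def)
    also have "\<dots> = (\<integral>\<^sup>+x. ?g x \<partial>lborel)"
      by (rule nn_integral_lborel_translation) measurable
    also have "\<dots> = (\<integral>\<^sup>+x. H x * indicator {x \<bullet> u - 1/2<..<x \<bullet> u + 1/2} t \<partial>lborel)"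
    proof (intro nn_integral_cong)
      fix x
      have "(\<bar>x \<bullet> u - t\<bar> < 1/2) = (x \<bullet> u - 1/2 < t \<and> t < x \<bullet> u + 1/2)" by linarith
      then show "?g x = H x * indicator {x \<bullet> u - 1/2<..<x \<bullet> u + 1/2} t"
        by (simp add: indicator_def)
    qed
    finally show "(\<integral>\<^sup>+x. indicator {x. \<bar>x \<bullet> u\<bar> < 1/2} x * H (x + t *\<^sub>R u) \<partial>lborel) =
      (\<integral>\<^sup>+x. H x * indicator {x \<bullet> u - 1/2<..<x \<bullet> u + 1/2} t \<partial>lborel)" .
  qed
  also have "\<dots> = (\<integral>\<^sup>+x. (\<integral>\<^sup>+t. H x * indicator {x \<bullet> u - 1/2<..<x \<bullet> u + 1/2} t \<partial>lborel) \<partial>lborel)"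
    unfolding greaterThanLessThan_def greaterThan_def lessThan_def
    by (rule lborel_pair.Fubini') measurable
  also have "\<dots> = (\<integral>\<^sup>+x. H x \<partial>lborel)"
    by (simp add: nn_integral_cmult)
  finally show ?thesis .
qed

text \<open>Stated through the equality of two measures, which need only be compared on sets; there
  the change of variables theorem applies to the bounded set \<open>A \<inter> ?I\<close>.\<close>

lemma nn_integral_arctan:
  fixes f :: "real \<Rightarrow> ennreal"
  assumes [measurable]: "f \<in> borel_measurable borel"
  shows "(\<integral>\<^sup>+t. f (arctan t) * ennreal (1 / (1 + t\<^sup>2)) \<partial>lborel) =
    (\<integral>\<^sup>+x. f x * indicator {- (pi/2)<..<pi/2} x \<partial>lborel)"
proof -
  have [measurable]: "arctan \<in> borel_measurable borel"
    by (intro borel_measurable_continuous_onI continuous_intros)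
  let ?I = "{- (pi/2)<..<pi/2} :: real set"
  let ?M = "distr (density lborel (\<lambda>t. ennreal (1 / (1 + t\<^sup>2)))) borel arctan"
  let ?N = "density lborel (\<lambda>x::real. indicator ?I x :: ennreal)"
  have ran: "range arctan = ?I"
  proof
    show "range arctan \<subseteq> ?I" using arctan_bounded by auto
    show "?I \<subseteq> range arctan" using arctan_tan by (metis greaterThanLessThan_iff rangeI subsetI)
  qed
  have "?M = ?N"
  proof (rule measure_eqI)
    fix A :: "real set" assume "A \<in> sets ?M"
    then have A [measurable]: "A \<in> sets borel" by simp
    have [measurable]: "arctan -` A \<in> sets borel"
      using measurable_sets[of arctan borel borel A] by simp
    let ?g = "\<lambda>t. 1 / (1 + t\<^sup>2) * indicator A (arctan t) :: real"
    have AI: "A \<inter> ?I \<in> lmeasurable"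
    proof (rule bounded_set_imp_lmeasurable)
      show "bounded (A \<inter> ?I)"
        by (rule bounded_subset[OF bounded_closed_interval[of "- (pi/2)" "pi/2"]]) auto
      show "A \<inter> ?I \<in> sets lebesgue" by (rule sets_completionI_sets) simp
    qed
    have ind: "(indicator A :: real \<Rightarrow> real) absolutely_integrable_on ?I \<and>
        integral ?I (indicator A) = measure lebesgue (A \<inter> ?I)"
    proof
      have "(\<lambda>x. indicator ?I x * indicator A x :: real) = indicator (A \<inter> ?I)"
        by (auto simp: fun_eq_iff split: split_indicator)
      then show "(indicator A :: real \<Rightarrow> real) absolutely_integrable_on ?I"
        using AI by (simp add: set_integrable_def fmeasurable_def)
      show "integral ?I (indicator A) = measure lebesgue (A \<inter> ?I)"
        using AI by (simp add: lmeasure_integral integral_indicator Int_commute)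
    qed
    have "(\<lambda>t. \<bar>1 / (1 + t\<^sup>2)\<bar> * indicator A (arctan t) :: real) absolutely_integrable_on UNIV \<and>
        integral UNIV (\<lambda>t. \<bar>1 / (1 + t\<^sup>2)\<bar> * indicator A (arctan t)) = measure lebesgue (A \<inter> ?I)"
      using ind unfolding ran[symmetric]
      by (subst has_absolute_integral_change_of_variables_1')
        (auto intro!: derivative_eq_intros simp: inj_on_def arctan_eq_iff field_simps)
    then have "(?g has_integral measure lebesgue (A \<inter> ?I)) UNIV"
      by (auto simp: has_integral_iff absolutely_integrable_on_def)
    from nn_integral_has_integral_lborel[OF _ _ this]
    have "(\<integral>\<^sup>+t. ennreal (?g t) \<partial>lborel) = ennreal (measure lebesgue (A \<inter> ?I))"
      by simp
    moreover have "ennreal (measure lebesgue (A \<inter> ?I)) = emeasure ?N A"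
    proof -
      have "emeasure ?N A = (\<integral>\<^sup>+x. indicator ?I x * indicator A x \<partial>lborel)"
        by (rule emeasure_density) measurable
      also have "\<dots> = (\<integral>\<^sup>+x. indicator (A \<inter> ?I) x \<partial>lborel)"
        by (rule nn_integral_cong) (auto split: split_indicator)
      also have "\<dots> = emeasure lborel (A \<inter> ?I)" by simp
      also have "\<dots> = emeasure lebesgue (A \<inter> ?I)" by simp
      also have "\<dots> = ennreal (measure lebesgue (A \<inter> ?I))"
        using fmeasurableD2[OF AI] by (intro emeasure_eq_ennreal_measure) simp
      finally show ?thesis ..
    qed
    moreover have "emeasure ?M A = (\<integral>\<^sup>+t. ennreal (?g t) \<partial>lborel)"
      by (subst emeasure_distr, measurable, subst emeasure_density)
        (auto intro!: nn_integral_cong split: split_indicator)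
    ultimately show "emeasure ?M A = emeasure ?N A" by simp
  qed simp
  then have "(\<integral>\<^sup>+x. f x \<partial>?M) = (\<integral>\<^sup>+x. f x \<partial>?N)" by simp
  then show ?thesis
    by (simp add: nn_integral_distr nn_integral_density mult.commute)
qed


definition perp :: "'a::real_inner \<Rightarrow> 'a \<Rightarrow> 'a" where
  "perp u v = v - (v \<bullet> u) *\<^sub>R u"

lemma borel_measurable_perp [measurable (raw)]:
  fixes f g :: "'b \<Rightarrow> 'a::euclidean_space"
  assumes [measurable]: "f \<in> borel_measurable M" "g \<in> borel_measurable M"
  shows "(\<lambda>x. perp (g x) (f x)) \<in> borel_measurable M"
  unfolding perp_def by measurable

lemma perp_inner: "norm u = 1 \<Longrightarrow> perp u x \<bullet> u = 0"
  by (simp add: perp_def inner_diff_left dot_square_norm)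

lemma perp_add_scaleR: "norm u = 1 \<Longrightarrow> perp u (x + t *\<^sub>R u) = perp u x"
  by (simp add: perp_def inner_add_left dot_square_norm algebra_simps)

lemma perp_scaleR: "perp u (c *\<^sub>R x) = c *\<^sub>R perp u x"
  by (simp add: perp_def algebra_simps)

lemma perp_uminus: "perp u (- x) = - perp u x"
  by (simp add: perp_def)

lemma norm_perp_decomp:
  assumes "norm u = 1"
  shows "(norm (perp u x + t *\<^sub>R u))\<^sup>2 = (norm (perp u x))\<^sup>2 + t\<^sup>2"
  using perp_inner[OF assms, of x] assms
  by (subst norm_add_Pythagorean) (simp_all add: orthogonal_def power_mult_distrib)

text \<open>
  The weight is \<open>sin \<theta>\<close> to the power 2 - n for the angle \<open>\<theta>\<close> between u and v, written so that it vanishes at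
  \<open>v = u\<close> and \<open>v = - u\<close> for every dimension n.
\<close>

definition circle_weight :: "real ^ 'n \<Rightarrow> real ^ 'n \<Rightarrow> ennreal" where
  "circle_weight u v = ennreal (norm (perp u v) / norm (perp u v) ^ (CARD('n) - 1))"

text \<open>The radial factor of the volume of the shell 1 < |y| < 2 in the hyperplane orthogonal to
  u, whose dimension n - 1 explains the exponent n - 2.\<close>

definition radial_mass :: "nat \<Rightarrow> ennreal" where
  "radial_mass n = (\<integral>\<^sup>+\<rho>. ennreal (\<rho> ^ (n - 2)) * indicator {1<..<2} \<rho> \<partial>lborel)"

text \<open>A hollow cylinder with axis u. Its point x represents the great circle through u and
  \<open>sgn (perp u x)\<close>; the thickness 1 along u is the one of
  \<open>nn_integral_slab_translation\<close>.\<close>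

definition slab_shell :: "real ^ 'n \<Rightarrow> (real ^ 'n) set" where
  "slab_shell u = {x. \<bar>x \<bullet> u\<bar> < 1/2 \<and> 1 < norm (perp u x) \<and> norm (perp u x) < 2}"

lemma slab_shell_borel [measurable]: "slab_shell u \<in> sets borel"
  unfolding slab_shell_def by measurable

lemma circle_weight_measurable [measurable (raw)]:
  assumes [measurable]: "f \<in> borel_measurable M" "g \<in> borel_measurable M"
  shows "(\<lambda>x. circle_weight (g x) (f x)) \<in> borel_measurable M"
  unfolding circle_weight_def by measurable

text \<open>
  The integrand is chosen so that the radial integral in polar coordinates produces the weight, while on each line
  parallel to u the factor \<open>|perp u x| / |x|\<^sup>2\<close> is the derivative of the angle.
\<close>

lemma nn_integral_shell_weight:
  fixes u :: "real ^ 'n" and F :: "real ^ 'n \<Rightarrow> ennreal"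
  assumes [measurable]: "F \<in> borel_measurable borel" and n: "2 \<le> CARD('n)" and u: "norm u = 1"
  shows "(\<integral>\<^sup>+x. F (sgn x) * ennreal (norm (perp u x) / (norm x)\<^sup>2) *
      indicator {1<..<2} (norm (perp u x)) \<partial>lborel) =
    radial_mass CARD('n) * (\<integral>\<^sup>+v. F v * circle_weight u v \<partial>sphere_borel_measure)"
proof -
  let ?n = "CARD('n)"
  let ?H = "\<lambda>x. F (sgn x) * ennreal (norm (perp u x) / (norm x)\<^sup>2) * indicator {1<..<2} (norm (perp u x))"
  have radial: "(\<integral>\<^sup>+r. ?H (r *\<^sub>R v) * ennreal (r ^ (?n - 1)) * indicator {0<..} r \<partial>lborel) =
      radial_mass ?n * (F v * circle_weight u v)" if v: "v \<in> sphere 0 1" for v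
  proof -
    let ?s = "norm (perp u v)"
    have integrand: "?H (r *\<^sub>R v) * ennreal (r ^ (?n - 1)) * indicator {0<..} r =
        F v * (ennreal (?s * r ^ (?n - 2)) * indicator {1<..<2} (r * ?s) * indicator {0<..} r)" for r
    proof (cases "0 < r")
      case True
      have rn: "r ^ (?n - 1) = r * r ^ (?n - 2)"
        using n by (metis Suc_diff_le diff_Suc_Suc numeral_2_eq_2 power_Suc One_nat_def)
      have "?s * r / r\<^sup>2 * r ^ (?n - 1) = ?s * r ^ (?n - 2)"
        using True unfolding rn by (simp add: power2_eq_square)
      then have "ennreal (r * ?s / r\<^sup>2) * ennreal (r ^ (?n - 1)) = ennreal (?s * r ^ (?n - 2))"
        using True by (simp add: ennreal_mult[symmetric] mult.commute)
      moreover have "sgn (r *\<^sub>R v) = v" using True v by (simp add: sgn_div_norm)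
      moreover have "?H (r *\<^sub>R v) * ennreal (r ^ (?n - 1)) = F (sgn (r *\<^sub>R v)) *
          (ennreal (r * ?s / r\<^sup>2) * ennreal (r ^ (?n - 1))) * indicator {1<..<2} (r * ?s)"
        using True v by (simp add: perp_scaleR mult_ac)
      ultimately show ?thesis
        using True by (simp add: mult_ac)
    qed simp
    have "(\<integral>\<^sup>+r. ennreal (?s * r ^ (?n - 2)) * indicator {1<..<2} (r * ?s) * indicator {0<..} r \<partial>lborel) =
        radial_mass ?n * circle_weight u v"
    proof (cases "?s = 0")
      case False
      then have s: "0 < ?s" by simp
      have "(\<integral>\<^sup>+r. ennreal (?s * r ^ (?n - 2)) * indicator {1<..<2} (r * ?s) * indicator {0<..} r \<partial>lborel) =
          ennreal (1 / ?s) * (\<integral>\<^sup>+\<rho>. ennreal (?s * (1 / ?s * \<rho>) ^ (?n - 2)) * indicator {1<..<2} (1 / ?s * \<rho> * ?s) *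
            indicator {0<..} (1 / ?s * \<rho>) \<partial>lborel)"
        using s by (subst nn_integral_real_affine[where c = "1 / ?s" and t = 0]) auto
      also have "\<dots> = ennreal (1 / ?s) * (\<integral>\<^sup>+\<rho>. ennreal (?s / ?s ^ (?n - 2)) *
          (ennreal (\<rho> ^ (?n - 2)) * indicator {1<..<2} \<rho>) \<partial>lborel)"
        using s by (intro arg_cong[where f = "(*) _"] nn_integral_cong)
          (auto simp: ennreal_mult[symmetric] power_divide split: split_indicator)
      also have "\<dots> = ennreal (1 / ?s) * ennreal (?s / ?s ^ (?n - 2)) * radial_mass ?n"
        by (simp add: nn_integral_cmult radial_mass_def mult.assoc)
      also have "ennreal (1 / ?s) * ennreal (?s / ?s ^ (?n - 2)) = circle_weight u v"
      proof -
        have "?s ^ (?n - 1) = ?s * ?s ^ (?n - 2)"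
          using n by (metis Suc_diff_le diff_Suc_Suc numeral_2_eq_2 power_Suc One_nat_def)
        then show ?thesis
          using s by (simp add: circle_weight_def ennreal_mult[symmetric])
      qed
      finally show ?thesis by (simp add: mult.commute)
    qed (simp add: circle_weight_def)
    then show ?thesis
      unfolding integrand by (simp add: nn_integral_cmult mult_ac)
  qed
  have "(\<integral>\<^sup>+x. ?H x \<partial>lborel) =
      (\<integral>\<^sup>+v. (\<integral>\<^sup>+r. ?H (r *\<^sub>R v) * ennreal (r ^ (?n - 1)) * indicator {0<..} r \<partial>lborel) \<partial>sphere_borel_measure)"
    by (rule nn_integral_polar) measurable
  also have "\<dots> = (\<integral>\<^sup>+v. radial_mass ?n * (F v * circle_weight u v) \<partial>sphere_borel_measure)"
    by (rule nn_integral_cong) (use radial in simp)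
  finally show ?thesis by (simp add: nn_integral_cmult)
qed

text \<open>Central projection maps the line y + t u onto the half great circle between -u and u
  through \<open>sgn y\<close>. Substitute t = |y| tan x; finally \<theta> = pi/2 - x is the angle
  from u.\<close>

lemma nn_integral_half_circle:
  fixes F :: "'a::euclidean_space \<Rightarrow> ennreal"
  assumes [measurable]: "F \<in> borel_measurable borel" "sgn \<in> borel_measurable (borel :: 'a measure)"
    and u: "norm u = 1" and y: "y \<bullet> u = 0" "y \<noteq> 0"
  shows "(\<integral>\<^sup>+t. F (sgn (y + t *\<^sub>R u)) * ennreal (norm y / (norm (y + t *\<^sub>R u))\<^sup>2) \<partial>lborel) =
    (\<integral>\<^sup>+\<theta>. F (cos \<theta> *\<^sub>R u + sin \<theta> *\<^sub>R sgn y) * indicator {0<..<pi} \<theta> \<partial>lborel)"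
proof -
  have norm_sq: "(norm (y + t *\<^sub>R u))\<^sup>2 = (norm y)\<^sup>2 + t\<^sup>2" for t
    using y u by (subst norm_add_Pythagorean) (simp_all add: orthogonal_def power_mult_distrib)
  let ?G = "\<lambda>x. F (sin x *\<^sub>R u + cos x *\<^sub>R sgn y)"
  have "(\<integral>\<^sup>+t. F (sgn (y + t *\<^sub>R u)) * ennreal (norm y / (norm (y + t *\<^sub>R u))\<^sup>2) \<partial>lborel) =
      ennreal (norm y) * (\<integral>\<^sup>+t. F (sgn (y + (norm y * t) *\<^sub>R u)) *
        ennreal (norm y / (norm (y + (norm y * t) *\<^sub>R u))\<^sup>2) \<partial>lborel)"
    using y by (subst nn_integral_real_affine[where c = "norm y" and t = 0]) auto
  also have "\<dots> = (\<integral>\<^sup>+t. F (sgn (y + (norm y * t) *\<^sub>R u)) * (ennreal (norm y) *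
        ennreal (norm y / (norm (y + (norm y * t) *\<^sub>R u))\<^sup>2)) \<partial>lborel)"
    by (subst nn_integral_cmult[symmetric]) (auto simp: mult_ac)
  also have "\<dots> = (\<integral>\<^sup>+t. ?G (arctan t) * ennreal (1 / (1 + t\<^sup>2)) \<partial>lborel)"
  proof (rule nn_integral_cong)
    fix t :: real
    have pos: "0 < 1 + t\<^sup>2" by (simp add: add_pos_nonneg)
    have sq: "(norm (y + (norm y * t) *\<^sub>R u))\<^sup>2 = (norm y)\<^sup>2 * (1 + t\<^sup>2)"
      unfolding norm_sq by (simp add: algebra_simps power_mult_distrib)
    then have "norm (y + (norm y * t) *\<^sub>R u) = sqrt ((norm y)\<^sup>2 * (1 + t\<^sup>2))"
      by (metis norm_ge_zero real_sqrt_unique)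
    then have "norm (y + (norm y * t) *\<^sub>R u) = norm y * sqrt (1 + t\<^sup>2)"
      by (simp add: real_sqrt_mult)
    then have "sgn (y + (norm y * t) *\<^sub>R u) = sin (arctan t) *\<^sub>R u + cos (arctan t) *\<^sub>R sgn y"
      using y(2) pos by (simp add: sgn_div_norm sin_arctan cos_arctan scaleR_add_right divide_inverse mult_ac)
    moreover have "ennreal (norm y) * ennreal (norm y / (norm (y + (norm y * t) *\<^sub>R u))\<^sup>2) =
        ennreal (1 / (1 + t\<^sup>2))"
      using y(2) pos unfolding sq by (simp add: ennreal_mult[symmetric] power2_eq_square)
    ultimately show "F (sgn (y + (norm y * t) *\<^sub>R u)) * (ennreal (norm y) *
        ennreal (norm y / (norm (y + (norm y * t) *\<^sub>R u))\<^sup>2)) = ?G (arctan t) * ennreal (1 / (1 + t\<^sup>2))"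
      by simp
  qed
  also have "\<dots> = (\<integral>\<^sup>+x. ?G x * indicator {- (pi/2)<..<pi/2} x \<partial>lborel)"
    by (rule nn_integral_arctan) measurable
  also have "\<dots> = (\<integral>\<^sup>+x. ?G (pi/2 + (-1) * x) * indicator {- (pi/2)<..<pi/2} (pi/2 + (-1) * x) \<partial>lborel)"
    by (subst nn_integral_real_affine[where c = "-1" and t = "pi/2"]) auto
  also have "\<dots> = (\<integral>\<^sup>+\<theta>. F (cos \<theta> *\<^sub>R u + sin \<theta> *\<^sub>R sgn y) * indicator {0<..<pi} \<theta> \<partial>lborel)"
    by (intro nn_integral_cong) (auto simp: sin_diff cos_diff split: split_indicator)
  finally show ?thesis .
qed

text \<open>Each line parallel to u through the shell projects to half a great circle. The
  reflection x -> -x preserves the shell and supplies the opposite half, which accounts for the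
  factor 2.\<close>

lemma great_circle_average:
  fixes u :: "real ^ 'n" and F :: "real ^ 'n \<Rightarrow> ennreal"
  assumes [measurable]: "F \<in> borel_measurable borel" and n: "2 \<le> CARD('n)" and u: "norm u = 1"
  shows "2 * radial_mass CARD('n) * (\<integral>\<^sup>+v. F v * circle_weight u v \<partial>sphere_borel_measure) =
    (\<integral>\<^sup>+x. indicator (slab_shell u) x *
      (\<integral>\<^sup>+\<theta>. F (cos \<theta> *\<^sub>R u + sin \<theta> *\<^sub>R sgn (perp u x)) * indicator {0..2*pi} \<theta> \<partial>lborel) \<partial>lborel)"
proof -
  let ?H = "\<lambda>x. F (sgn x) * ennreal (norm (perp u x) / (norm x)\<^sup>2) * indicator {1<..<2} (norm (perp u x))"
  let ?half = "\<lambda>w. \<integral>\<^sup>+\<theta>. F (cos \<theta> *\<^sub>R u + sin \<theta> *\<^sub>R w) * indicator {0<..<pi} \<theta> \<partial>lborel"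
  have [measurable]: "{x. \<bar>x \<bullet> u\<bar> < 1/2} \<in> sets borel" by measurable
  have line: "indicator {x. \<bar>x \<bullet> u\<bar> < 1/2} x * (\<integral>\<^sup>+t. ?H (x + t *\<^sub>R u) \<partial>lborel) =
      indicator (slab_shell u) x * ?half (sgn (perp u x))" for x
  proof (cases "x \<in> slab_shell u")
    case True
    let ?y = "perp u x"
    have y: "?y \<noteq> 0" "1 < norm ?y" "norm ?y < 2" using True by (auto simp: slab_shell_def)
    \<comment> \<open>A shift of t puts the origin of the line at the point \<open>perp u x\<close>
      orthogonal to u.\<close>
    have "(\<integral>\<^sup>+t. ?H (x + t *\<^sub>R u) \<partial>lborel) = (\<integral>\<^sup>+t. ?H (x + (- (x \<bullet> u) + t) *\<^sub>R u) \<partial>lborel)"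
      using nn_integral_lborel_translation[of "\<lambda>t. ?H (x + t *\<^sub>R u)" "- (x \<bullet> u)"] by simp
    also have "\<dots> = (\<integral>\<^sup>+t. F (sgn (?y + t *\<^sub>R u)) * ennreal (norm ?y / (norm (?y + t *\<^sub>R u))\<^sup>2) \<partial>lborel)"
    proof (rule nn_integral_cong)
      fix t
      have "x + (- (x \<bullet> u) + t) *\<^sub>R u = ?y + t *\<^sub>R u" by (simp add: perp_def algebra_simps)
      moreover have "perp u (x + (- (x \<bullet> u) + t) *\<^sub>R u) = ?y" by (rule perp_add_scaleR[OF u])
      ultimately show "?H (x + (- (x \<bullet> u) + t) *\<^sub>R u) =
          F (sgn (?y + t *\<^sub>R u)) * ennreal (norm ?y / (norm (?y + t *\<^sub>R u))\<^sup>2)"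
        using y by simp
    qed
    also have "\<dots> = ?half (sgn ?y)"
      by (rule nn_integral_half_circle) (use y u perp_inner in \<open>auto\<close>)
    finally show ?thesis using True by (simp add: slab_shell_def)
  next
    case False
    then show ?thesis
      using perp_add_scaleR[OF u, of x] by (auto simp: slab_shell_def split: split_indicator)
  qed
  have half: "radial_mass CARD('n) * (\<integral>\<^sup>+v. F v * circle_weight u v \<partial>sphere_borel_measure) =
      (\<integral>\<^sup>+x. indicator (slab_shell u) x * ?half (sgn (perp u x)) \<partial>lborel)"
    unfolding nn_integral_shell_weight[OF assms, symmetric] line[symmetric]
    by (rule nn_integral_slab_translation[symmetric]) (use u in measurable)
  have "(\<integral>\<^sup>+x. indicator (slab_shell u) x * ?half (sgn (perp u x)) \<partial>lborel) =
      (\<integral>\<^sup>+x. indicator (slab_shell u) ((-1) *\<^sub>R x) * ?half (sgn (perp u ((-1) *\<^sub>R x))) \<partial>lborel)"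
    by (subst nn_integral_lborel_scaleR[where c = "-1"]) auto
  also have "\<dots> = (\<integral>\<^sup>+x. indicator (slab_shell u) x * ?half (- sgn (perp u x)) \<partial>lborel)"
    by (intro nn_integral_cong) (simp add: perp_uminus slab_shell_def sgn_minus indicator_def)
  finally have half': "radial_mass CARD('n) * (\<integral>\<^sup>+v. F v * circle_weight u v \<partial>sphere_borel_measure) =
      (\<integral>\<^sup>+x. indicator (slab_shell u) x * ?half (- sgn (perp u x)) \<partial>lborel)"
    using half by simp
  have full: "?half w + ?half (- w) =
      (\<integral>\<^sup>+\<theta>. F (cos \<theta> *\<^sub>R u + sin \<theta> *\<^sub>R w) * indicator {0..2*pi} \<theta> \<partial>lborel)" for w
  proof -
    have ae: "AE \<theta> in lborel. \<theta> \<noteq> (0::real)" "AE \<theta> in lborel. \<theta> \<noteq> pi" "AE \<theta> in lborel. \<theta> \<noteq> 2 * pi"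
      by (rule AE_lborel_singleton)+
    have "?half (- w) = (\<integral>\<^sup>+\<theta>. F (cos (2*pi + (-1) * \<theta>) *\<^sub>R u + sin (2*pi + (-1) * \<theta>) *\<^sub>R (- w)) *
        indicator {0<..<pi} (2*pi + (-1) * \<theta>) \<partial>lborel)"
      by (subst nn_integral_real_affine[where c = "-1" and t = "2*pi"]) auto
    also have "\<dots> = (\<integral>\<^sup>+\<theta>. F (cos \<theta> *\<^sub>R u + sin \<theta> *\<^sub>R w) * indicator {pi<..<2*pi} \<theta> \<partial>lborel)"
      by (intro nn_integral_cong) (auto simp: cos_diff sin_diff split: split_indicator)
    finally have "?half w + ?half (- w) = (\<integral>\<^sup>+\<theta>. F (cos \<theta> *\<^sub>R u + sin \<theta> *\<^sub>R w) * indicator {0<..<pi} \<theta> +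
        F (cos \<theta> *\<^sub>R u + sin \<theta> *\<^sub>R w) * indicator {pi<..<2*pi} \<theta> \<partial>lborel)"
      by (subst nn_integral_add) auto
    also have "\<dots> = (\<integral>\<^sup>+\<theta>. F (cos \<theta> *\<^sub>R u + sin \<theta> *\<^sub>R w) * indicator {0..2*pi} \<theta> \<partial>lborel)"
      by (rule nn_integral_cong_AE) (use ae in eventually_elim, auto split: split_indicator)
    finally show ?thesis .
  qed
  have "2 * radial_mass CARD('n) * (\<integral>\<^sup>+v. F v * circle_weight u v \<partial>sphere_borel_measure) =
      (\<integral>\<^sup>+x. indicator (slab_shell u) x * ?half (sgn (perp u x)) \<partial>lborel) +
      (\<integral>\<^sup>+x. indicator (slab_shell u) x * ?half (- sgn (perp u x)) \<partial>lborel)"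
    by (simp only: half[symmetric] half'[symmetric] mult_2 distrib_right)
  also have "\<dots> = (\<integral>\<^sup>+x. indicator (slab_shell u) x * (?half (sgn (perp u x)) + ?half (- sgn (perp u x))) \<partial>lborel)"
    by (subst nn_integral_add[symmetric]) (auto simp: distrib_left)
  finally show ?thesis by (simp only: full)
qed

subsection \<open>Polynomials of bounded degree\<close>

definition real_monomial :: "('n::finite \<Rightarrow> nat) \<Rightarrow> real ^ 'n \<Rightarrow> real" where
  "real_monomial \<alpha> x = (\<Prod>i\<in>UNIV. (x $ i) ^ \<alpha> i)"

lemma real_monomial_mult: "real_monomial \<alpha> x * real_monomial \<beta> x = real_monomial (\<lambda>i. \<alpha> i + \<beta> i) x"
  by (simp add: real_monomial_def power_add prod.distrib)

lemma polynomials_upto_iff: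
  "Q \<in> polynomials_upto L \<longleftrightarrow>
    (\<exists>c. Q = (\<lambda>x. \<Sum>\<alpha> | (\<Sum>i\<in>UNIV. \<alpha> i) \<le> L. c \<alpha> * complex_of_real (real_monomial \<alpha> x)))"
  by (simp add: polynomials_upto_def real_monomial_def)

lemma polynomials_upto_scaled_monomial:
  assumes "(\<Sum>i\<in>UNIV. \<beta> i) \<le> L"
  shows "(\<lambda>x. a * complex_of_real (real_monomial \<beta> x)) \<in> polynomials_upto L"
proof -
  have "a * complex_of_real (real_monomial \<beta> x) =
      (\<Sum>\<alpha> | (\<Sum>i\<in>UNIV. \<alpha> i) \<le> L. (if \<alpha> = \<beta> then a else 0) * complex_of_real (real_monomial \<alpha> x))" for x
    using assms by (simp add: if_distrib[of "\<lambda>c. c * _"] sum.delta[OF finite_multi_indices] cong: if_cong)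
  then show ?thesis
    unfolding polynomials_upto_iff by (intro exI[of _ "\<lambda>\<alpha>. if \<alpha> = \<beta> then a else 0"]) (rule ext)
qed

lemma polynomials_upto_const: "(\<lambda>x. a) \<in> polynomials_upto L"
  using polynomials_upto_scaled_monomial[of "\<lambda>_. 0" L a] by (simp add: real_monomial_def)

lemma polynomials_upto_add:
  assumes "P \<in> polynomials_upto L" "Q \<in> polynomials_upto L"
  shows "(\<lambda>x. P x + Q x) \<in> polynomials_upto L"
proof -
  obtain c d where "P = (\<lambda>x. \<Sum>\<alpha> | (\<Sum>i\<in>UNIV. \<alpha> i) \<le> L. c \<alpha> * complex_of_real (real_monomial \<alpha> x))"
    "Q = (\<lambda>x. \<Sum>\<alpha> | (\<Sum>i\<in>UNIV. \<alpha> i) \<le> L. d \<alpha> * complex_of_real (real_monomial \<alpha> x))"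
    using assms by (auto simp: polynomials_upto_iff)
  then show ?thesis
    unfolding polynomials_upto_iff
    by (intro exI[of _ "\<lambda>\<alpha>. c \<alpha> + d \<alpha>"]) (simp add: sum.distrib distrib_right)
qed

lemma polynomials_upto_sum:
  assumes "finite A" "\<And>a. a \<in> A \<Longrightarrow> f a \<in> polynomials_upto L"
  shows "(\<lambda>x. \<Sum>a\<in>A. f a x) \<in> polynomials_upto L"
  using assms
proof (induction A rule: finite_induct)
  case empty
  then show ?case using polynomials_upto_const[of 0 L] by simp
next
  case (insert a A)
  then show ?case using polynomials_upto_add[of "f a" L "\<lambda>x. \<Sum>a\<in>A. f a x"] by simp
qed

lemma polynomials_upto_mult:
  assumes "P \<in> polynomials_upto K" "Q \<in> polynomials_upto L"
  shows "(\<lambda>x. P x * Q x) \<in> polynomials_upto (K + L)"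
proof -
  obtain c d where P: "P = (\<lambda>x. \<Sum>\<alpha> | (\<Sum>i\<in>UNIV. \<alpha> i) \<le> K. c \<alpha> * complex_of_real (real_monomial \<alpha> x))"
    and Q: "Q = (\<lambda>x. \<Sum>\<alpha> | (\<Sum>i\<in>UNIV. \<alpha> i) \<le> L. d \<alpha> * complex_of_real (real_monomial \<alpha> x))"
    using assms by (auto simp: polynomials_upto_iff)
  have "P x * Q x = (\<Sum>\<alpha> | (\<Sum>i\<in>UNIV. \<alpha> i) \<le> K. \<Sum>\<beta> | (\<Sum>i\<in>UNIV. \<beta> i) \<le> L.
      c \<alpha> * d \<beta> * complex_of_real (real_monomial (\<lambda>i. \<alpha> i + \<beta> i) x))" for x
    unfolding P Q sum_product by (simp add: real_monomial_mult[symmetric] mult_ac)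
  moreover have "(\<lambda>x. \<Sum>\<alpha> | (\<Sum>i\<in>UNIV. \<alpha> i) \<le> K. \<Sum>\<beta> | (\<Sum>i\<in>UNIV. \<beta> i) \<le> L.
      c \<alpha> * d \<beta> * complex_of_real (real_monomial (\<lambda>i. \<alpha> i + \<beta> i) x)) \<in> polynomials_upto (K + L)"
    by (intro polynomials_upto_sum finite_multi_indices polynomials_upto_scaled_monomial)
      (auto simp: sum.distrib)
  ultimately show ?thesis by simp
qed

lemma polynomials_upto_mono:
  assumes "P \<in> polynomials_upto K" "K \<le> L"
  shows "P \<in> polynomials_upto L"
  using polynomials_upto_mult[OF assms(1) polynomials_upto_const[of 1 "L - K"]] assms(2) by simp

lemma polynomials_upto_power:
  assumes "P \<in> polynomials_upto K"
  shows "(\<lambda>x. P x ^ k) \<in> polynomials_upto (k * K)"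
proof (induction k)
  case 0
  then show ?case using polynomials_upto_const[of 1 0] by simp
next
  case (Suc k)
  then show ?case using polynomials_upto_mult[OF assms Suc] by simp
qed

lemma polynomials_upto_inner:
  fixes u :: "real ^ 'n"
  shows "(\<lambda>x. complex_of_real (x \<bullet> u)) \<in> polynomials_upto 1"
proof -
  have mon: "real_monomial (\<lambda>j. if j = i then 1 else 0) x = x $ i" for i and x :: "real ^ 'n"
  proof -
    have "real_monomial (\<lambda>j. if j = i then 1 else 0) x = (\<Prod>j\<in>UNIV. if j = i then x $ i else 1)"
      unfolding real_monomial_def by (intro prod.cong) auto
    then show ?thesis by simp
  qed
  have "(\<lambda>x. \<Sum>i\<in>UNIV. complex_of_real (u $ i) * complex_of_real (real_monomial (\<lambda>j. if j = i then 1 else 0) x))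
      \<in> polynomials_upto 1"
    by (intro polynomials_upto_sum polynomials_upto_scaled_monomial) auto
  then show ?thesis
    unfolding mon by (simp add: inner_vec_def mult.commute)
qed

lemma polynomials_upto_continuous:
  assumes "Q \<in> polynomials_upto L"
  shows "continuous_on UNIV Q"
  using assms unfolding polynomials_upto_def by (auto intro!: continuous_intros)

text \<open>
  On a great circle \<open>cos t = (z + 1/z) / 2\<close> and \<open>sin t = (z - 1/z) / (2 i)\<close> with \<open>z = e\<^sup>i\<^sup>t\<close>, so that \<open>z\<^sup>L Q\<close> is a
  polynomial in z.
\<close>

lemma polynomials_upto_on_circle:
  fixes u w :: "real ^ 'n"
  assumes "Q \<in> polynomials_upto L"
  obtains P :: "complex poly" where "degree P \<le> 2 * L"
    and "\<And>t. cmod (poly P (cis t)) = cmod (Q (cos t *\<^sub>R u + sin t *\<^sub>R w))"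
proof -
  obtain c where Q: "Q = (\<lambda>x. \<Sum>\<alpha> | (\<Sum>i\<in>UNIV. \<alpha> i) \<le> L. c \<alpha> * complex_of_real (real_monomial \<alpha> x))"
    using assms by (auto simp: polynomials_upto_iff)
  define l where "l i = [: (of_real (u $ i) + \<i> * of_real (w $ i)) / 2, 0,
      (of_real (u $ i) - \<i> * of_real (w $ i)) / 2 :]" for i
  have deg_l: "degree (l i) \<le> 2" for i by (simp add: l_def)
  have poly_l: "poly (l i) (cis t) = cis t * of_real (cos t * u $ i + sin t * w $ i)" for i t
  proof -
    have sq: "cos t * cos t = 1 - sin t * sin t"
      using sin_cos_squared_add2[of t] unfolding power2_eq_square by linarith
    have id: "cos t * (cos t * a) + sin t * (sin t * a) = a" for a
      by (simp only: mult.assoc[symmetric] distrib_right[symmetric] sin_cos_squared_add3 mult_1)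
    show ?thesis
      by (simp add: l_def complex_eq_iff sq algebra_simps) (auto simp: field_simps sq id)
  qed
  \<comment> \<open>With z = \<open>cis t\<close>, \<open>l i\<close> is z times the i-th coordinate
    on the circle. The monomial in front pads every term to the common factor z^L, and the degree is
    at most (L - |\<alpha>|) + 2 |\<alpha>| \<le> 2 L.\<close>
  define R where "R \<alpha> = monom 1 (L - (\<Sum>i\<in>UNIV. \<alpha> i)) * (\<Prod>i\<in>UNIV. l i ^ \<alpha> i)" for \<alpha>
  have deg_R: "degree (R \<alpha>) \<le> 2 * L" if "(\<Sum>i\<in>UNIV. \<alpha> i) \<le> L" for \<alpha>
  proof -
    have "degree (\<Prod>i\<in>UNIV. l i ^ \<alpha> i) \<le> (\<Sum>i\<in>UNIV. degree (l i ^ \<alpha> i))"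
      using degree_prod_sum_le[of UNIV "\<lambda>i. l i ^ \<alpha> i"] by (simp add: o_def)
    also have "\<dots> \<le> (\<Sum>i\<in>UNIV. 2 * \<alpha> i)"
      by (intro sum_mono order_trans[OF degree_power_le]) (simp add: deg_l mult.commute)
    finally have "degree (\<Prod>i\<in>UNIV. l i ^ \<alpha> i) \<le> 2 * (\<Sum>i\<in>UNIV. \<alpha> i)"
      by (simp add: sum_distrib_left)
    moreover have "degree (R \<alpha>) \<le> (L - (\<Sum>i\<in>UNIV. \<alpha> i)) + degree (\<Prod>i\<in>UNIV. l i ^ \<alpha> i)"
      unfolding R_def by (rule order_trans[OF degree_mult_le]) (simp add: degree_monom_le)
    ultimately show ?thesis using that by linarith
  qed
  have poly_R: "poly (R \<alpha>) (cis t) = cis t ^ L * complex_of_real (real_monomial \<alpha> (cos t *\<^sub>R u + sin t *\<^sub>R w))"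
    if "(\<Sum>i\<in>UNIV. \<alpha> i) \<le> L" for \<alpha> t
  proof -
    have "poly (R \<alpha>) (cis t) = cis t ^ (L - (\<Sum>i\<in>UNIV. \<alpha> i)) *
        (\<Prod>i\<in>UNIV. (cis t * of_real (cos t * u $ i + sin t * w $ i)) ^ \<alpha> i)"
      by (simp only: R_def poly_mult poly_monom poly_prod poly_power poly_l mult_1)
    also have "\<dots> = cis t ^ (L - (\<Sum>i\<in>UNIV. \<alpha> i)) * cis t ^ (\<Sum>i\<in>UNIV. \<alpha> i) *
        complex_of_real (real_monomial \<alpha> (cos t *\<^sub>R u + sin t *\<^sub>R w))"
      by (simp only: power_mult_distrib prod.distrib power_sum mult.assoc real_monomial_def
          of_real_prod of_real_power vector_add_component vector_scaleR_component real_scaleR_def)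
    also have "cis t ^ (L - (\<Sum>i\<in>UNIV. \<alpha> i)) * cis t ^ (\<Sum>i\<in>UNIV. \<alpha> i) = cis t ^ L"
      using that by (simp only: power_add[symmetric] le_add_diff_inverse2)
    finally show ?thesis .
  qed
  define P where "P = (\<Sum>\<alpha> | (\<Sum>i\<in>UNIV. \<alpha> i) \<le> L. smult (c \<alpha>) (R \<alpha>))"
  show thesis
  proof (rule that)
    show "degree P \<le> 2 * L"
      unfolding P_def
      by (intro degree_sum_le finite_multi_indices order_trans[OF degree_smult_le] deg_R) auto
    fix t
    have "poly P (cis t) = cis t ^ L * Q (cos t *\<^sub>R u + sin t *\<^sub>R w)"
      unfolding P_def Q poly_sum sum_distrib_left by (intro sum.cong) (auto simp: poly_R)
    then show "cmod (poly P (cis t)) = cmod (Q (cos t *\<^sub>R u + sin t *\<^sub>R w))"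
      by (simp add: norm_mult norm_power)
  qed
qed

subsection \<open>Fejer polynomials\<close>

text \<open>The unnormalised Fejer kernel (sin (m x / 2) / sin (x / 2))^2 as a polynomial in t = cos
  x, of degree m - 1 for m \<ge> 1. It equals (1 - T_m) / (1 - t) for the Chebyshev polynomial T_m,
  whose recurrence becomes this one; the constants leave the summand 2.\<close>

fun fejer :: "nat \<Rightarrow> real \<Rightarrow> real" where
  "fejer 0 t = 0"
| "fejer (Suc 0) t = 1"
| "fejer (Suc (Suc m)) t = 2 * t * fejer (Suc m) t - fejer m t + 2"

lemma fejer_cos: "fejer m (cos x) * (1 - cos x) = 1 - cos (real m * x)"
proof (induction m "cos x" rule: fejer.induct)
  case (3 m)
  have "cos (real (Suc (Suc m)) * x) = cos (real (Suc m) * x + x)" by (simp add: algebra_simps)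
  moreover have "cos (real m * x) = cos (real (Suc m) * x - x)" by (simp add: algebra_simps)
  ultimately have "cos (real (Suc (Suc m)) * x) = 2 * cos x * cos (real (Suc m) * x) - cos (real m * x)"
    by (simp only: cos_add cos_diff) simp
  moreover have "fejer (Suc (Suc m)) (cos x) * (1 - cos x) =
      2 * cos x * (fejer (Suc m) (cos x) * (1 - cos x)) - fejer m (cos x) * (1 - cos x) + 2 * (1 - cos x)"
    by (simp add: algebra_simps)
  ultimately show ?case
    unfolding 3 by (simp only:) (simp only: algebra_simps)
qed auto

lemma fejer_one: "fejer m 1 = (real m)\<^sup>2"
  by (induction m "1::real" rule: fejer.induct) (simp_all add: power2_eq_square algebra_simps)

lemma abs_sin_multiple: "\<bar>sin (real m * x)\<bar> \<le> real m * \<bar>sin x\<bar>"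
proof (induction m)
  case (Suc m)
  have "\<bar>sin (real (Suc m) * x)\<bar> = \<bar>sin (real m * x) * cos x + cos (real m * x) * sin x\<bar>"
    by (simp add: algebra_simps sin_add)
  also have "\<dots> \<le> \<bar>sin (real m * x)\<bar> * \<bar>cos x\<bar> + \<bar>cos (real m * x)\<bar> * \<bar>sin x\<bar>"
    by (metis abs_mult abs_triangle_ineq)
  also have "\<dots> \<le> \<bar>sin (real m * x)\<bar> * 1 + 1 * \<bar>sin x\<bar>"
    by (intro add_mono mult_mono) auto
  finally show ?case using Suc by (simp add: algebra_simps)
qed auto

text \<open>For t = cos x the kernel is a quotient of squared sines, so the bound m^2 is |sin (m y)|
  \<le> m |sin y|; t = 1 is treated apart. The last bound is the decay away from the peak.\<close>

lemma fejer_bounds: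
  assumes "\<bar>t\<bar> \<le> 1"
  shows "0 \<le> fejer m t" "fejer m t \<le> (real m)\<^sup>2" "fejer m t * (1 - t) \<le> 2"
proof -
  obtain x where x: "t = cos x" using assms cos_arccos_abs by metis
  have "fejer m t * (1 - t) = 1 - cos (real m * x)" unfolding x by (rule fejer_cos)
  then show "fejer m t * (1 - t) \<le> 2" using cos_ge_minus_one[of "real m * x"] by linarith
  have half: "1 - cos y = 2 * (sin (y / 2))\<^sup>2" for y :: real
    using cos_double_sin[of "y / 2"] by simp
  have "0 \<le> fejer m t \<and> fejer m t \<le> (real m)\<^sup>2"
  proof (cases "t = 1")
    case False
    then have pos: "0 < 1 - t" using assms by auto
    have "(sin (real m * (x / 2)))\<^sup>2 \<le> (real m * \<bar>sin (x / 2)\<bar>)\<^sup>2"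
      using abs_sin_multiple[of m "x / 2"] by (metis abs_ge_zero power2_abs power_mono)
    then have "fejer m t * (1 - t) \<le> (real m)\<^sup>2 * (1 - t)"
      unfolding x fejer_cos unfolding half by (simp add: power_mult_distrib)
    moreover have "0 \<le> fejer m t * (1 - t)" unfolding x fejer_cos by simp
    ultimately show ?thesis using pos by (simp add: zero_le_mult_iff)
  qed (simp add: fejer_one)
  then show "0 \<le> fejer m t" "fejer m t \<le> (real m)\<^sup>2" by auto
qed

lemma half_le_sin:
  fixes x :: real
  assumes "0 \<le> x" "x \<le> 1"
  shows "x / 2 \<le> sin x"
proof -
  have "sin 0 - 0 / 2 \<le> sin x - x / 2"
  proof (rule DERIV_nonneg_imp_nondecreasing[OF assms(1)])
    fix y assume "0 \<le> y" "y \<le> x"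
    then have "cos (pi / 3) \<le> cos y"
      using assms pi_gt3 by (intro cos_monotone_0_pi_le) auto
    then have "0 \<le> cos y - 1 / 2" by (simp add: cos_60)
    then show "\<exists>d. ((\<lambda>x. sin x - x / 2) has_real_derivative d) (at y) \<and> 0 \<le> d"
      by (intro exI[of _ "cos y - 1 / 2"]) (auto intro!: derivative_eq_intros)
  qed
  then show ?thesis by simp
qed

text \<open>Near the peak, sin (m x / 2) \<ge> m x / 4 and sin (x / 2) \<le> x / 2, so a quarter of
  the maximum m^2 is kept.\<close>

lemma fejer_lower_bound:
  assumes "0 < x" "real m * x \<le> 1" "0 < m"
  shows "(real m)\<^sup>2 / 4 \<le> fejer m (cos x)"
proof -
  have x1: "x \<le> 1"
    using assms mult_right_mono[of 1 "real m" x] by linarith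
  have half: "1 - cos y = 2 * (sin (y / 2))\<^sup>2" for y :: real
    using cos_double_sin[of "y / 2"] by simp
  have s: "0 < sin (x / 2)" using assms x1 by (intro sin_gt_zero) (use pi_gt3 in linarith)+
  have "sin (x / 2) \<le> x / 2" using assms by (intro sin_x_le_x) auto
  then have "real m / 2 * sin (x / 2) \<le> (real m * x / 2) / 2"
    using mult_left_mono[of "sin (x/2)" "x/2" "real m / 2"] by simp
  also have "\<dots> \<le> sin (real m * x / 2)"
    using assms by (intro half_le_sin) auto
  finally have "(real m / 2 * sin (x / 2))\<^sup>2 \<le> (sin (real m * x / 2))\<^sup>2"
    using s by (intro power_mono) auto
  then have "(real m)\<^sup>2 / 4 * (1 - cos x) \<le> fejer m (cos x) * (1 - cos x)"
    unfolding fejer_cos unfolding half by (simp add: power_mult_distrib power_divide)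
  moreover have "0 < 1 - cos x" unfolding half using s by simp
  ultimately show ?thesis by (simp only: mult_le_cancel_right_pos)
qed

lemma fejer_polynomials_upto:
  fixes u :: "real ^ 'n"
  shows "(\<lambda>x. complex_of_real (fejer (Suc m) (x \<bullet> u))) \<in> polynomials_upto m"
proof (induction m rule: less_induct)
  case (less m)
  show ?case
  proof (cases m)
    case 0
    then show ?thesis using polynomials_upto_const[of 1 0] by simp
  next
    case (Suc k)
    have 1: "(\<lambda>x. (2 * complex_of_real (x \<bullet> u)) * complex_of_real (fejer (Suc k) (x \<bullet> u))) \<in> polynomials_upto m"
      using polynomials_upto_mult[OF polynomials_upto_mult[OF polynomials_upto_const[of 2 0]
          polynomials_upto_inner[of u]] less[of k]] Suc by simp
    have 2: "(\<lambda>x. - complex_of_real (fejer k (x \<bullet> u))) \<in> polynomials_upto m"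
    proof (cases k)
      case 0
      then show ?thesis using polynomials_upto_const[of 0] by simp
    next
      case (Suc j)
      then have "(\<lambda>x. complex_of_real (fejer k (x \<bullet> u))) \<in> polynomials_upto m"
        using polynomials_upto_mono[OF less[of j]] \<open>m = Suc k\<close> by simp
      from polynomials_upto_mult[OF polynomials_upto_const[of "-1" 0] this] show ?thesis by simp
    qed
    from polynomials_upto_add[OF polynomials_upto_add[OF 1 2] polynomials_upto_const[of 2]]
    show ?thesis using Suc by simp
  qed
qed

subsection \<open>Harmonic measure and the averaged circle kernel\<close>

lemma borel_measurable_sphere_ident [measurable]:
  "(\<lambda>x. x) \<in> borel_measurable (sphere_borel_measure :: (real ^ 'n) measure)"
  by (rule borel_measurable_sphere_borel_measure) simp

lemma emeasure_sphere_borel_measure_space: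
  "emeasure sphere_borel_measure (sphere 0 1 :: (real ^ 'n) set) =
    ennreal (real CARD('n) * unit_ball_vol (real CARD('n)))"
proof -
  have "emeasure sphere_borel_measure (sphere 0 1 :: (real ^ 'n) set) =
      (\<integral>\<^sup>+v. 1 \<partial>(sphere_borel_measure :: (real ^ 'n) measure))"
    by simp
  also have "\<dots> = ennreal (real CARD('n)) * emeasure lborel (ball (0 :: real ^ 'n) 1)"
    by (subst nn_integral_sphere_borel_measure) simp_all
  finally show ?thesis by (simp add: emeasure_ball ennreal_mult)
qed

interpretation sphere: finite_measure "sphere_borel_measure :: (real ^ 'n) measure"
  by (intro finite_measureI) (simp add: emeasure_sphere_borel_measure_space)

lemma measure_sphere_pos: "0 < measure sphere_measure (sphere 0 1 :: (real ^ 'n) set)"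
proof -
  have "sphere 0 1 \<in> sets (sphere_borel_measure :: (real ^ 'n) measure)"
    using sets.top[of "sphere_borel_measure :: (real ^ 'n) measure"] by simp
  then have "measure sphere_measure (sphere 0 1 :: (real ^ 'n) set) = real CARD('n) * unit_ball_vol (real CARD('n))"
    by (simp add: sphere_measure_def measure_def emeasure_sphere_borel_measure_space)
  then show ?thesis by simp
qed

text \<open>The given sets are measurable for the completed measure only, whereas the Tonelli
  arguments use Borel sets.\<close>

lemma borel_version:
  assumes "A \<in> sets (sphere_measure :: (real ^ 'n) measure)"
  obtains B where "B \<in> sets borel" "AE v in sphere_measure. v \<in> A \<longleftrightarrow> v \<in> B"
proof -
  let ?S = "sphere_borel_measure :: (real ^ 'n) measure"
  have A: "A \<in> sets (completion ?S)" using assms by (simp add: sphere_measure_def)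
  have "main_part ?S A \<in> sets (restrict_space borel (sphere 0 1))"
    using main_part_sets[OF A] by (simp add: sphere_borel_measure_def)
  then have "main_part ?S A \<in> sets borel" by (simp add: sets_restrict_space_iff)
  moreover have "AE v in sphere_measure. v \<in> A \<longleftrightarrow> v \<in> main_part ?S A"
    using AE_notin_null_part[OF A] main_part_null_part_Un[OF A]
    unfolding sphere_measure_def by (auto simp: AE_completion_iff)
  ultimately show thesis by (rule that)
qed

text \<open>The bound b secures integrability; without it the Bochner integral could be the default
  value 0.\<close>

lemma set_integral_sphere_eq_nn_integral:
  fixes f :: "real ^ 'n \<Rightarrow> real"
  assumes f [measurable]: "f \<in> borel_measurable borel" and f0: "\<And>v. 0 \<le> f v"
    and fb: "\<And>v. norm v = 1 \<Longrightarrow> f v \<le> b"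
    and A: "A \<in> sets sphere_measure"
    and B [measurable]: "B \<in> sets borel" and AB: "AE v in sphere_measure. v \<in> A \<longleftrightarrow> v \<in> B"
  shows "ennreal (LINT v:A|sphere_measure. f v) = (\<integral>\<^sup>+v. indicator B v * ennreal (f v) \<partial>sphere_borel_measure)"
proof -
  let ?S = "sphere_borel_measure :: (real ^ 'n) measure"
  let ?g = "\<lambda>v. indicator B v * f v :: real"
  have g [measurable]: "?g \<in> borel_measurable ?S" by (rule borel_measurable_sphere_borel_measure) measurable
  have f' [measurable]: "f \<in> borel_measurable sphere_measure"
    unfolding sphere_measure_def by (intro measurable_completion borel_measurable_sphere_borel_measure f)
  have g' [measurable]: "?g \<in> borel_measurable sphere_measure"
    unfolding sphere_measure_def by (intro measurable_completion g)
  note A [measurable]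
  have "(LINT v:A|sphere_measure. f v) = (LINT v|sphere_measure. ?g v)"
    unfolding set_lebesgue_integral_def
  proof (rule integral_cong_AE)
    show "AE v in sphere_measure. indicator A v *\<^sub>R f v = indicator B v * f v"
      using AB by eventually_elim (simp add: indicator_def)
  qed measurable
  also have "\<dots> = (LINT v|?S. ?g v)"
    unfolding sphere_measure_def by (rule integral_completion[OF g])
  also have "ennreal \<dots> = (\<integral>\<^sup>+v. ennreal (?g v) \<partial>?S)"
  proof (rule nn_integral_eq_integral[symmetric])
    show "integrable ?S ?g"
    proof (rule sphere.integrable_const_bound[where B = "\<bar>b\<bar>"])
      show "AE v in ?S. norm (?g v) \<le> \<bar>b\<bar>"
        using f0 order_trans[OF fb abs_ge_self] by (intro AE_I2) (auto split: split_indicator)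
    qed measurable
  qed (use f0 in auto)
  also have "\<dots> = (\<integral>\<^sup>+v. indicator B v * ennreal (f v) \<partial>?S)"
    by (intro nn_integral_cong) (auto split: split_indicator)
  finally show ?thesis .
qed

text \<open>The normalising factor of \<open>harmonic_measure\<close> is left out and reappears as
  the total mass in \<open>harmonic_measure_eq_nn_integral\<close>.\<close>

definition poisson_kernel :: "real ^ 'n \<Rightarrow> real ^ 'n \<Rightarrow> real" where
  "poisson_kernel z v = (1 - (norm z)\<^sup>2) / norm (z - v) ^ CARD('n)"

lemma poisson_kernel_measurable [measurable]: "poisson_kernel z \<in> borel_measurable borel"
  unfolding poisson_kernel_def by measurable

lemma poisson_kernel_nonneg: "norm z < 1 \<Longrightarrow> 0 \<le> poisson_kernel z v"
  unfolding poisson_kernel_def by (simp add: power_le_one)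

lemma poisson_kernel_le:
  fixes z v :: "real ^ 'n"
  assumes "norm z < 1" "norm v = 1"
  shows "poisson_kernel z v \<le> (1 - (norm z)\<^sup>2) / (1 - norm z) ^ CARD('n)"
proof -
  have "1 - norm z \<le> norm (z - v)"
    using norm_triangle_ineq2[of v z] assms by (simp add: norm_minus_commute)
  then show ?thesis
    unfolding poisson_kernel_def using assms
    by (intro divide_left_mono power_mono mult_pos_pos zero_less_power)
      (auto simp: power_le_one)
qed

lemma harmonic_measure_nonneg:
  fixes z :: "real ^ 'n"
  assumes "norm z < 1"
  shows "0 \<le> harmonic_measure z A"
  unfolding harmonic_measure_def set_lebesgue_integral_def poisson_kernel_def[symmetric]
  using poisson_kernel_nonneg[OF assms] by (intro mult_nonneg_nonneg integral_nonneg_AE) auto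

lemma harmonic_measure_eq_nn_integral:
  fixes z :: "real ^ 'n"
  assumes "norm z < 1" "A \<in> sets sphere_measure" "B \<in> sets borel" "AE v in sphere_measure. v \<in> A \<longleftrightarrow> v \<in> B"
  shows "ennreal (measure sphere_measure (sphere 0 1 :: (real ^ 'n) set) * harmonic_measure z A) =
    (\<integral>\<^sup>+v. indicator B v * ennreal (poisson_kernel z v) \<partial>sphere_borel_measure)"
  using measure_sphere_pos[where 'n = 'n]
    set_integral_sphere_eq_nn_integral[OF poisson_kernel_measurable poisson_kernel_nonneg[OF assms(1)]
      poisson_kernel_le[OF assms(1)] assms(2-4)]
  by (simp add: harmonic_measure_def poisson_kernel_def)

lemma norm_perp_squared:
  assumes "norm u = 1"
  shows "(norm (perp u v))\<^sup>2 = (norm v)\<^sup>2 - (v \<bullet> u)\<^sup>2"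
  using norm_perp_decomp[OF assms, of v "v \<bullet> u"] by (simp add: perp_def)

lemma norm_perp_commute:
  assumes "norm u = 1" "norm v = 1"
  shows "norm (perp u v) = norm (perp v u)"
  by (rule power2_eq_imp_eq) (simp_all add: norm_perp_squared assms inner_commute)

lemma circle_weight_commute:
  fixes u v :: "real ^ 'n"
  assumes "norm u = 1" "norm v = 1"
  shows "circle_weight u v = circle_weight v u"
  using norm_perp_commute[OF assms] by (simp add: circle_weight_def)

lemma norm_perp_le:
  assumes "norm u = 1"
  shows "norm (perp u x) \<le> norm x"
proof -
  have "(norm (perp u x))\<^sup>2 \<le> (norm (perp u x + (x \<bullet> u) *\<^sub>R u))\<^sup>2"
    unfolding norm_perp_decomp[OF assms] by simp
  then show ?thesis by (simp add: perp_def power2_le_iff_abs_le)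
qed

text \<open>The exceptional points span a line at most, which is null in dimension at least 2. They
  must be excluded since \<open>circle_weight\<close> vanishes there while the Poisson kernel is
  positive.\<close>

lemma AE_perp_nonzero:
  fixes u :: "real ^ 'n"
  assumes n: "2 \<le> CARD('n)"
  shows "AE v in sphere_borel_measure. perp u v \<noteq> 0"
proof -
  let ?Z = "{x. perp u x = 0}"
  have [measurable]: "?Z \<in> sets borel" by measurable
  have sub: "?Z \<subseteq> span {u}"
    by (auto simp: perp_def span_singleton)
  have "dim ?Z \<le> dim (span {u})" using sub by (rule dim_subset)
  also have "\<dots> \<le> card {u}" by (simp only: dim_span) (rule dim_le_card', simp)
  finally have "negligible ?Z" using n by (intro negligible_lowdim) simp
  then have null: "emeasure lborel ?Z = 0"
    by (simp add: negligible_iff_emeasure0)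
  have "(\<integral>\<^sup>+v. indicator ?Z v \<partial>sphere_borel_measure) =
      ennreal (real CARD('n)) * (\<integral>\<^sup>+x. indicator ?Z (sgn x) * indicator (ball 0 1) x \<partial>lborel)"
    by (rule nn_integral_sphere_borel_measure) measurable
  also have "(\<integral>\<^sup>+x. indicator ?Z (sgn x) * indicator (ball 0 1) x \<partial>lborel) \<le> (\<integral>\<^sup>+x. indicator ?Z x \<partial>lborel)"
  proof (rule nn_integral_mono)
    fix x :: "real ^ 'n"
    have "perp u x = norm x *\<^sub>R perp u (sgn x)"
      by (cases "x = 0") (simp_all add: perp_scaleR[symmetric] sgn_div_norm)
    then show "indicator ?Z (sgn x) * indicator (ball 0 1) x \<le> (indicator ?Z x :: ennreal)"
      by (auto split: split_indicator)
  qed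
  also have "\<dots> = 0" using null by simp
  finally have "(\<integral>\<^sup>+v. indicator ?Z v \<partial>sphere_borel_measure) = 0"
    by (simp add: mult_left_mono)
  then have "AE v in sphere_borel_measure. indicator ?Z v = (0 :: ennreal)"
    by (subst (asm) nn_integral_0_iff_AE) auto
  then show ?thesis by (auto simp: indicator_def)
qed

text \<open>
  The sine of the angle between u and v is at most \<open>|\<rho> u - v|\<close>, so the weight \<open>sin\<^sup>2\<^sup>-\<^sup>n\<close> supplies the missing
  n - 2 powers in the denominator of the Poisson kernel of the ball.
\<close>

lemma poisson_kernel_le_circle_kernel:
  fixes u v :: "real ^ 'n"
  assumes n: "2 \<le> CARD('n)" and u: "norm u = 1" and v: "norm v = 1" and L: "1 \<le> L"
    and s: "perp u v \<noteq> 0"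
  shows "ennreal (poisson_kernel ((1 - 1 / real L) *\<^sub>R u) v) \<le>
    ennreal (32 * pi) * (ennreal (circle_kernel (real L / (real L + 1)) (u \<bullet> v)) * circle_weight u v)"
proof -
  define \<rho> where "\<rho> = 1 - 1 / real L"
  define r where "r = real L / (real L + 1)"
  have L0: "1 \<le> real L" using L by simp
  have \<rho>: "0 \<le> \<rho>" "\<rho> < 1" using L0 by (auto simp: \<rho>_def)
  have r: "0 \<le> r" "r < 1" using L0 by (auto simp: r_def)
  define D where "D = norm (\<rho> *\<^sub>R u - v)"
  have D\<rho>: "1 - \<rho> \<le> D"
    using norm_triangle_ineq2[of v "\<rho> *\<^sub>R u"] u v \<rho> by (simp add: D_def norm_minus_commute)
  then have D0: "0 < D" using \<rho> by simp
  \<comment> \<open>Moving the pole from \<rho> u to r u changes the distance to v by at most 1 -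
    \<rho> \<le> D, so it at most doubles.\<close>
  have "r - \<rho> \<le> 1 - \<rho>" using r by simp
  moreover have "0 \<le> r - \<rho>" using L0 by (simp add: r_def \<rho>_def field_simps)
  ultimately have "norm ((r - \<rho>) *\<^sub>R u) \<le> D" using u D\<rho> by simp
  then have "norm (r *\<^sub>R u - v) \<le> 2 * D"
    using norm_triangle_ineq[of "\<rho> *\<^sub>R u - v" "(r - \<rho>) *\<^sub>R u"]
    by (simp add: D_def algebra_simps)
  then have "(norm (r *\<^sub>R u - v))\<^sup>2 \<le> (2 * D)\<^sup>2" by (intro power_mono) auto
  moreover have "(norm (r *\<^sub>R u - v))\<^sup>2 = 1 - 2 * r * (u \<bullet> v) + r\<^sup>2"
    unfolding power2_norm_eq_inner inner_diff_left inner_diff_right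
    using u v by (simp add: dot_square_norm inner_commute power2_eq_square)
  ultimately have den: "1 - 2 * r * (u \<bullet> v) + r\<^sup>2 \<le> 4 * D\<^sup>2" by (simp add: power_mult_distrib)
  have "u \<bullet> v \<le> 1" using norm_cauchy_schwarz[of u v] u v by simp
  then have pos: "0 < 1 - 2 * r * (u \<bullet> v) + r\<^sup>2" by (rule circle_kernel_denom_pos[OF r])
  \<comment> \<open>Since 1 - r = 1/(L+1) \<ge> 1/(2L) = (1 - \<rho>)/2. The constant
    \<open>32 * pi\<close> is this 4, times 4 from the squared distance, times 2 pi from the circle
    kernel.\<close>
  have num: "(1 - \<rho>\<^sup>2) / 4 \<le> 1 - r\<^sup>2"
  proof -
    have "(1 - \<rho>\<^sup>2) / 4 = (1 - \<rho>) * (1 + \<rho>) / 4" by (simp add: power2_eq_square algebra_simps)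
    also have "\<dots> \<le> (1 - \<rho>) * 2 / 4" using \<rho> by (intro divide_right_mono mult_left_mono) auto
    also have "\<dots> \<le> 1 - r" using L0 by (simp add: \<rho>_def r_def field_simps)
    also have "\<dots> \<le> 1 - r\<^sup>2" using r by (simp add: power2_eq_square mult_left_le)
    finally show ?thesis .
  qed
  have k: "(1 - \<rho>\<^sup>2) / (32 * pi * D\<^sup>2) \<le> circle_kernel r (u \<bullet> v)"
  proof -
    have "(1 - \<rho>\<^sup>2) / (32 * pi * D\<^sup>2) = ((1 - \<rho>\<^sup>2) / 4) / (2 * pi * (4 * D\<^sup>2))" by simp
    also have "\<dots> \<le> (1 - r\<^sup>2) / (2 * pi * (4 * D\<^sup>2))" using num by (intro divide_right_mono) auto
    also have "\<dots> \<le> (1 - r\<^sup>2) / (2 * pi * (1 - 2 * r * (u \<bullet> v) + r\<^sup>2))"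
      using den pos D0 r by (intro divide_left_mono mult_left_mono mult_pos_pos) (auto simp: power_le_one)
    finally show ?thesis by (simp add: circle_kernel_def)
  qed
  have "perp u (v - \<rho> *\<^sub>R u) = perp u v" using perp_add_scaleR[OF u, of v "- \<rho>"] by simp
  then have sD: "norm (perp u v) \<le> D"
    using norm_perp_le[OF u, of "v - \<rho> *\<^sub>R u"] by (simp add: D_def norm_minus_commute)
  have s0: "0 < norm (perp u v)" using s by simp
  have w: "1 / D ^ (CARD('n) - 2) \<le> norm (perp u v) / norm (perp u v) ^ (CARD('n) - 1)"
  proof -
    have "CARD('n) - 1 = Suc (CARD('n) - 2)" using n by simp
    then have "norm (perp u v) / norm (perp u v) ^ (CARD('n) - 1) = 1 / norm (perp u v) ^ (CARD('n) - 2)"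
      using s0 by simp
    then show ?thesis using sD s0 by (simp add: frac_le power_mono)
  qed
  have "CARD('n) = 2 + (CARD('n) - 2)" using n by simp
  then have Dn: "D ^ CARD('n) = D\<^sup>2 * D ^ (CARD('n) - 2)" by (metis power_add)
  have "poisson_kernel (\<rho> *\<^sub>R u) v = (32 * pi) * ((1 - \<rho>\<^sup>2) / (32 * pi * D\<^sup>2) * (1 / D ^ (CARD('n) - 2)))"
    using u \<rho> D0 by (simp add: poisson_kernel_def D_def[symmetric] Dn)
  also have "\<dots> \<le> (32 * pi) * (circle_kernel r (u \<bullet> v) * (norm (perp u v) / norm (perp u v) ^ (CARD('n) - 1)))"
    using k w D0 circle_kernel_nonneg[OF r \<open>u \<bullet> v \<le> 1\<close>] by (intro mult_left_mono mult_mono) auto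
  finally show ?thesis
    using circle_kernel_nonneg[OF r \<open>u \<bullet> v \<le> 1\<close>]
    unfolding circle_weight_def \<rho>_def[symmetric] r_def[symmetric]
    by (simp add: ennreal_mult[symmetric] ennreal_leI)
qed

lemma radial_mass_bounds: "1 \<le> radial_mass n" "radial_mass n < \<infinity>"
proof -
  have "1 = (\<integral>\<^sup>+\<rho>. indicator {1<..<2::real} \<rho> \<partial>lborel)" by simp
  also have "\<dots> \<le> radial_mass n"
    unfolding radial_mass_def by (intro nn_integral_mono) (auto simp: one_le_power split: split_indicator)
  finally show "1 \<le> radial_mass n" .
  have "radial_mass n \<le> (\<integral>\<^sup>+\<rho>. ennreal (2 ^ (n - 2)) * indicator {1<..<2::real} \<rho> \<partial>lborel)"
    unfolding radial_mass_def by (intro nn_integral_mono) (auto intro!: ennreal_leI power_mono split: split_indicator)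
  also have "\<dots> < \<infinity>" by (simp add: nn_integral_cmult)
  finally show "radial_mass n < \<infinity>" .
qed

lemma slab_shell_subset_ball:
  fixes u :: "real ^ 'n"
  assumes "norm u = 1"
  shows "slab_shell u \<subseteq> ball 0 3"
proof
  fix x assume "x \<in> slab_shell u"
  then have *: "\<bar>x \<bullet> u\<bar> < 1/2" "norm (perp u x) < 2" by (auto simp: slab_shell_def)
  have "norm x \<le> norm (perp u x) + norm ((x \<bullet> u) *\<^sub>R u)"
    using norm_triangle_ineq[of "perp u x" "(x \<bullet> u) *\<^sub>R u"] by (simp add: perp_def)
  then show "x \<in> ball 0 3" using * assms by simp
qed

text \<open>Bounds the volume of the shell from below uniformly in u. The centre lies at the middle
  radius 3/2 in a direction orthogonal to u.\<close>

lemma slab_shell_superset_ball: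
  fixes u :: "real ^ 'n"
  assumes "2 \<le> CARD('n)" and u: "norm u = 1"
  obtains c where "ball c (1/4) \<subseteq> slab_shell u"
proof -
  obtain y where y: "y \<noteq> 0" "orthogonal u y"
    using orthogonal_to_vector_exists[of u] assms by auto
  define w where "w = (3/2) *\<^sub>R sgn y"
  have w: "norm w = 3/2" "w \<bullet> u = 0"
    using y by (auto simp: w_def norm_sgn orthogonal_def sgn_div_norm inner_commute)
  have "ball w (1/4) \<subseteq> slab_shell u"
  proof
    fix x assume "x \<in> ball w (1/4)"
    then have e: "norm (x - w) < 1/4" by (simp add: dist_norm norm_minus_commute)
    have "x \<bullet> u = (x - w) \<bullet> u" using w by (simp add: inner_diff_left)
    also have "\<bar>\<dots>\<bar> \<le> norm (x - w)" using Cauchy_Schwarz_ineq2[of "x - w" u] u by simp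
    finally have 1: "\<bar>x \<bullet> u\<bar> < 1/2" using e by linarith
    have "perp u x - w = perp u (x - w)" using w by (simp add: perp_def inner_diff_left)
    then have "norm (perp u x - w) < 1/4" using norm_perp_le[OF u, of "x - w"] e by simp
    then have "\<bar>norm (perp u x) - norm w\<bar> < 1/4" using norm_triangle_ineq3[of "perp u x" w] by linarith
    then have "1 < norm (perp u x)" "norm (perp u x) < 2" using w(1) by linarith+
    then show "x \<in> slab_shell u" using 1 by (simp add: slab_shell_def)
  qed
  then show thesis by (rule that)
qed


lemma perp_on_circle:
  fixes u w :: "'a::real_inner"
  assumes "norm u = 1" "w \<bullet> u = 0"
  shows "u \<bullet> (cos t *\<^sub>R u + sin t *\<^sub>R w) = cos t" "perp u (cos t *\<^sub>R u + sin t *\<^sub>R w) = sin t *\<^sub>R w"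
  using assms by (simp_all add: perp_def inner_add_left inner_add_right dot_square_norm inner_commute)

lemma sgn_perp_inner: "norm u = 1 \<Longrightarrow> sgn (perp u x) \<bullet> u = 0"
  by (simp add: sgn_div_norm perp_inner)

section \<open>The averaged kernel and the inequality on the sphere\<close>

text \<open>With the factor from \<open>great_circle_average\<close>, integration against this
  density is exactly the integral over the shell of the Poisson means along the great circles
  through u.\<close>

definition circle_density :: "nat \<Rightarrow> real ^ 'n \<Rightarrow> real ^ 'n \<Rightarrow> ennreal" where
  "circle_density L u v = 2 * radial_mass CARD('n) *
     (ennreal (circle_kernel (real L / (real L + 1)) (u \<bullet> v)) * circle_weight u v)"

lemma circle_density_measurable [measurable (raw)]:
  assumes [measurable]: "f \<in> borel_measurable M" "g \<in> borel_measurable M"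
  shows "(\<lambda>x. circle_density L (f x) (g x)) \<in> borel_measurable M"
  unfolding circle_density_def circle_kernel_def by measurable

lemma circle_density_commute:
  assumes "norm u = 1" "norm v = 1"
  shows "circle_density L u v = circle_density L v u"
  using circle_weight_commute[OF assms] by (simp add: circle_density_def inner_commute)

lemma nn_integral_circle_density:
  fixes u :: "real ^ 'n" and G :: "real ^ 'n \<Rightarrow> ennreal"
  assumes [measurable]: "G \<in> borel_measurable borel" and n: "2 \<le> CARD('n)" and u: "norm u = 1"
  shows "(\<integral>\<^sup>+v. circle_density L u v * G v \<partial>sphere_borel_measure) =
    (\<integral>\<^sup>+x. indicator (slab_shell u) x * (\<integral>\<^sup>+t.
      (ennreal (circle_kernel (real L / (real L + 1)) (cos t)) * indicator {0..2*pi} t) *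
      G (cos t *\<^sub>R u + sin t *\<^sub>R sgn (perp u x)) \<partial>lborel) \<partial>lborel)"
proof -
  let ?k = "\<lambda>c. ennreal (circle_kernel (real L / (real L + 1)) c)"
  have [measurable]: "?k \<in> borel_measurable borel" unfolding circle_kernel_def by measurable
  have "(\<integral>\<^sup>+v. circle_density L u v * G v \<partial>sphere_borel_measure) =
      2 * radial_mass CARD('n) * (\<integral>\<^sup>+v. (?k (u \<bullet> v) * G v) * circle_weight u v \<partial>sphere_borel_measure)"
    unfolding circle_density_def by (subst nn_integral_cmult[symmetric]) (auto simp: mult_ac)
  also have "\<dots> = (\<integral>\<^sup>+x. indicator (slab_shell u) x * (\<integral>\<^sup>+t.
      (?k (u \<bullet> (cos t *\<^sub>R u + sin t *\<^sub>R sgn (perp u x))) * G (cos t *\<^sub>R u + sin t *\<^sub>R sgn (perp u x))) *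
      indicator {0..2*pi} t \<partial>lborel) \<partial>lborel)"
    by (rule great_circle_average[OF _ n u]) measurable
  finally show ?thesis
    unfolding perp_on_circle(1)[OF u sgn_perp_inner[OF u]] by (simp add: mult_ac)
qed

text \<open>Each circle kernel has mass 1, so the total mass is the volume of the shell.\<close>

lemma nn_integral_circle_density_le:
  fixes u :: "real ^ 'n"
  assumes n: "2 \<le> CARD('n)" and u: "norm u = 1"
  shows "(\<integral>\<^sup>+v. circle_density L u v \<partial>sphere_borel_measure) \<le> emeasure lborel (ball (0 :: real ^ 'n) 3)"
proof -
  define r where "r = real L / (real L + 1)"
  have r: "0 \<le> r" "r < 1" by (auto simp: r_def)
  note one = nn_integral_circle_kernel[OF r]
  have "(\<integral>\<^sup>+v. circle_density L u v * 1 \<partial>sphere_borel_measure) = emeasure lborel (slab_shell u)"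
    by (subst nn_integral_circle_density[OF _ n u]) (simp_all add: one r_def[symmetric])
  also have "\<dots> \<le> emeasure lborel (ball (0 :: real ^ 'n) 3)"
    using slab_shell_subset_ball[OF u] by (intro emeasure_mono) auto
  finally show ?thesis by simp
qed

text \<open>All the great circles pass through u at t = 0, so the circle inequality holds on each of
  them with the same |Q(u)| and the same K; it is linear in its integrals and survives integration
  over the shell.\<close>

lemma sphere_logvinenko_sereda_pointwise:
  fixes p \<epsilon> :: real
  assumes n: "2 \<le> CARD('n)" and p: "0 < p" and "0 < \<epsilon>"
  obtains K where "0 \<le> K"
    and "\<And>L Q B (u :: real ^ 'n). \<lbrakk>1 \<le> L; Q \<in> polynomials_upto L; B \<in> sets borel; norm u = 1\<rbrakk> \<Longrightarrow>
      (\<integral>\<^sup>+v. circle_density L u v * indicator B v \<partial>sphere_borel_measure) * ennreal (cmod (Q u) powr p) \<le>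
        ennreal K * (\<integral>\<^sup>+v. circle_density L u v * (indicator B v * ennreal (cmod (Q v) powr p)) \<partial>sphere_borel_measure)
        + ennreal \<epsilon> * (\<integral>\<^sup>+v. circle_density L u v * ennreal (cmod (Q v) powr p) \<partial>sphere_borel_measure)"
proof -
  obtain K where K: "0 \<le> K" and circle: "\<And>L (P :: complex poly) A. \<lbrakk>1 \<le> L; degree P \<le> 2 * L; A \<in> sets borel\<rbrakk> \<Longrightarrow>
      (let k = \<lambda>t. ennreal (circle_kernel (real L / (real L + 1)) (cos t)) * indicator {0..2*pi} t in
       (\<integral>\<^sup>+t. k t * indicator A t \<partial>lborel) * ennreal (cmod (poly P 1) powr p) \<le>
         ennreal K * (\<integral>\<^sup>+t. k t * (indicator A t * ennreal (cmod (poly P (cis t)) powr p)) \<partial>lborel)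
         + ennreal \<epsilon> * (\<integral>\<^sup>+t. k t * ennreal (cmod (poly P (cis t)) powr p) \<partial>lborel))"
    using circle_logvinenko_sereda[OF p \<open>0 < \<epsilon>\<close>] by blast
  show thesis
  proof (rule that[OF K])
    fix L and Q :: "real ^ 'n \<Rightarrow> complex" and B :: "(real ^ 'n) set" and u :: "real ^ 'n"
    assume L: "1 \<le> L" and Q: "Q \<in> polynomials_upto L" and B [measurable]: "B \<in> sets borel" and u: "norm u = 1"
    have [measurable]: "Q \<in> borel_measurable borel"
      by (rule borel_measurable_continuous_onI[OF polynomials_upto_continuous[OF Q]])
    define k where "k t = ennreal (circle_kernel (real L / (real L + 1)) (cos t)) * indicator {0..2*pi} t" for t
    have [measurable]: "k \<in> borel_measurable borel" unfolding k_def circle_kernel_def by measurable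
    let ?c = "\<lambda>x t. cos t *\<^sub>R u + sin t *\<^sub>R sgn (perp u x)"
    let ?q = "\<lambda>v. ennreal (cmod (Q v) powr p)"
    note density = nn_integral_circle_density[OF _ n u, of _ L, folded k_def]
    have on_circle: "(\<integral>\<^sup>+t. k t * indicator B (?c x t) \<partial>lborel) * ?q u \<le>
        ennreal K * (\<integral>\<^sup>+t. k t * (indicator B (?c x t) * ?q (?c x t)) \<partial>lborel)
        + ennreal \<epsilon> * (\<integral>\<^sup>+t. k t * ?q (?c x t) \<partial>lborel)" for x
    proof -
      obtain P :: "complex poly" where P: "degree P \<le> 2 * L" "\<And>t. cmod (poly P (cis t)) = cmod (Q (?c x t))"
        using polynomials_upto_on_circle[OF Q, of u "sgn (perp u x)"] by blast
      have P1: "cmod (poly P 1) = cmod (Q u)" using P(2)[of 0] by simp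
      have meas: "(?c x) -` B \<in> sets borel"
        using measurable_sets[of "?c x" borel borel B] by simp
      have "indicator ((?c x) -` B) t = (indicator B (?c x t) :: ennreal)" for t
        by (simp add: indicator_def)
      then show ?thesis
        using circle[OF L P(1) meas] unfolding Let_def k_def[symmetric] P(2) P1 by simp
    qed
    have "(\<integral>\<^sup>+v. circle_density L u v * indicator B v \<partial>sphere_borel_measure) * ?q u =
        (\<integral>\<^sup>+x. indicator (slab_shell u) x * ((\<integral>\<^sup>+t. k t * indicator B (?c x t) \<partial>lborel) * ?q u) \<partial>lborel)"
      by (subst density, measurable, subst nn_integral_multc[symmetric]) (auto simp: mult.assoc)
    also have "\<dots> \<le> (\<integral>\<^sup>+x. indicator (slab_shell u) x *
        (ennreal K * (\<integral>\<^sup>+t. k t * (indicator B (?c x t) * ?q (?c x t)) \<partial>lborel)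
        + ennreal \<epsilon> * (\<integral>\<^sup>+t. k t * ?q (?c x t) \<partial>lborel)) \<partial>lborel)"
      by (intro nn_integral_mono mult_left_mono on_circle) simp
    also have "\<dots> = (\<integral>\<^sup>+x. ennreal K * (indicator (slab_shell u) x *
        (\<integral>\<^sup>+t. k t * (indicator B (?c x t) * ?q (?c x t)) \<partial>lborel))
        + ennreal \<epsilon> * (indicator (slab_shell u) x * (\<integral>\<^sup>+t. k t * ?q (?c x t) \<partial>lborel)) \<partial>lborel)"
      by (intro nn_integral_cong) (simp only: distrib_left mult.left_commute)
    also have "\<dots> = ennreal K * (\<integral>\<^sup>+x. indicator (slab_shell u) x *
        (\<integral>\<^sup>+t. k t * (indicator B (?c x t) * ?q (?c x t)) \<partial>lborel) \<partial>lborel)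
        + ennreal \<epsilon> * (\<integral>\<^sup>+x. indicator (slab_shell u) x * (\<integral>\<^sup>+t. k t * ?q (?c x t) \<partial>lborel) \<partial>lborel)"
      by (subst nn_integral_add, measurable, subst (1 2) nn_integral_cmult) auto
    also have "\<dots> = ennreal K * (\<integral>\<^sup>+v. circle_density L u v * (indicator B v * ?q v) \<partial>sphere_borel_measure)
        + ennreal \<epsilon> * (\<integral>\<^sup>+v. circle_density L u v * ?q v \<partial>sphere_borel_measure)"
      by (subst (1 2) density) measurable
    finally show "(\<integral>\<^sup>+v. circle_density L u v * indicator B v \<partial>sphere_borel_measure) * ?q u \<le>
        ennreal K * (\<integral>\<^sup>+v. circle_density L u v * (indicator B v * ?q v) \<partial>sphere_borel_measure)
        + ennreal \<epsilon> * (\<integral>\<^sup>+v. circle_density L u v * ?q v \<partial>sphere_borel_measure)" .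
  qed
qed

text \<open>After the exchange of integrals the mass in the first variable is needed; symmetry
  reduces it to the known mass in the second.\<close>

lemma nn_integral_circle_density_iterated_le:
  fixes G :: "real ^ 'n \<Rightarrow> ennreal"
  assumes [measurable]: "G \<in> borel_measurable borel" and n: "2 \<le> CARD('n)"
  shows "(\<integral>\<^sup>+u. (\<integral>\<^sup>+v. circle_density L u v * G v \<partial>sphere_borel_measure) \<partial>sphere_borel_measure) \<le>
    emeasure lborel (ball (0 :: real ^ 'n) 3) * (\<integral>\<^sup>+v. G v \<partial>sphere_borel_measure)"
proof -
  let ?S = "sphere_borel_measure :: (real ^ 'n) measure"
  interpret pair: pair_sigma_finite ?S ?S ..
  have [measurable]: "fst \<in> borel_measurable (?S \<Otimes>\<^sub>M ?S)" "snd \<in> borel_measurable (?S \<Otimes>\<^sub>M ?S)"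
    using measurable_compose[OF measurable_fst borel_measurable_sphere_ident]
      measurable_compose[OF measurable_snd borel_measurable_sphere_ident] by auto
  have [measurable]: "(\<lambda>x. G (f x)) \<in> borel_measurable M" if "f \<in> borel_measurable M" for f :: "'b \<Rightarrow> _" and M
    using that by measurable
  have "(\<integral>\<^sup>+u. (\<integral>\<^sup>+v. circle_density L u v * G v \<partial>?S) \<partial>?S) = (\<integral>\<^sup>+v. (\<integral>\<^sup>+u. circle_density L u v * G v \<partial>?S) \<partial>?S)"
    by (rule pair.Fubini') measurable
  also have "\<dots> \<le> (\<integral>\<^sup>+v. emeasure lborel (ball (0 :: real ^ 'n) 3) * G v \<partial>?S)"
  proof (rule nn_integral_mono)
    fix v assume "v \<in> space ?S"
    then have v: "norm v = 1" by simp
    have "(\<integral>\<^sup>+u. circle_density L u v * G v \<partial>?S) = (\<integral>\<^sup>+u. circle_density L v u \<partial>?S) * G v"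
      using v by (subst nn_integral_multc[symmetric])
        (auto intro!: nn_integral_cong simp: circle_density_commute)
    also have "\<dots> \<le> emeasure lborel (ball (0 :: real ^ 'n) 3) * G v"
      by (intro mult_right_mono nn_integral_circle_density_le n v) simp
    finally show "(\<integral>\<^sup>+u. circle_density L u v * G v \<partial>?S) \<le> emeasure lborel (ball (0 :: real ^ 'n) 3) * G v" .
  qed
  also have "\<dots> = emeasure lborel (ball (0 :: real ^ 'n) 3) * (\<integral>\<^sup>+v. G v \<partial>?S)"
    by (rule nn_integral_cmult) measurable
  finally show ?thesis .
qed


lemma polynomials_upto_powr_bounded:
  fixes Q :: "real ^ 'n \<Rightarrow> complex"
  assumes "Q \<in> polynomials_upto L" "0 < p"
  obtains b where "\<And>v. norm v = 1 \<Longrightarrow> cmod (Q v) powr p \<le> b"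
proof -
  have "continuous_on (sphere 0 1) Q"
    using polynomials_upto_continuous[OF assms(1)] by (rule continuous_on_subset) simp
  then have "compact ((\<lambda>v. cmod (Q v) powr p) ` sphere 0 1)"
    using assms(2) by (intro compact_continuous_image continuous_on_powr' continuous_intros) auto
  then have "bdd_above ((\<lambda>v. cmod (Q v) powr p) ` sphere 0 1)"
    by (intro bounded_imp_bdd_above compact_imp_bounded)
  then obtain b where b: "\<And>y. y \<in> (\<lambda>v. cmod (Q v) powr p) ` sphere 0 1 \<Longrightarrow> y \<le> b"
    unfolding bdd_above_def by blast
  show thesis by (rule that[of b]) (use b in auto)
qed

lemma sphere_logvinenko_sereda:
  fixes p \<delta> :: real
  assumes n: "2 \<le> CARD('n)" and p: "0 < p" and \<delta>: "0 < \<delta>"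
  obtains C where "0 < C"
    and "\<And>L Q B. \<lbrakk>1 \<le> L; Q \<in> polynomials_upto L; B \<in> sets borel;
        \<And>u :: real ^ 'n. norm u = 1 \<Longrightarrow>
          ennreal \<delta> \<le> (\<integral>\<^sup>+v. circle_density L u v * indicator B v \<partial>sphere_borel_measure)\<rbrakk> \<Longrightarrow>
      (\<integral>\<^sup>+v. ennreal (cmod (Q v) powr p) \<partial>sphere_borel_measure) \<le>
        ennreal C * (\<integral>\<^sup>+v. indicator B v * ennreal (cmod (Q v) powr p) \<partial>sphere_borel_measure)"
proof -
  let ?S = "sphere_borel_measure :: (real ^ 'n) measure"
  define V where "V = measure lborel (ball (0 :: real ^ 'n) 3)"
  have V: "emeasure lborel (ball (0 :: real ^ 'n) 3) = ennreal V"
    unfolding V_def using emeasure_lborel_ball_finite[of "0 :: real ^ 'n" 3]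
    by (intro emeasure_eq_ennreal_measure) (simp add: less_top)
  have V0: "0 < V" unfolding V_def by (simp add: content_ball_pos)
  \<comment> \<open>Chosen so that the integrated error term \<epsilon> V \<open>?I\<close> is half
    of \<delta> \<open>?I\<close>.\<close>
  define \<epsilon> where "\<epsilon> = \<delta> / (2 * V)"
  have \<epsilon>: "0 < \<epsilon>" using \<delta> V0 by (simp add: \<epsilon>_def)
  obtain K where K: "0 \<le> K" and pointwise:
    "\<And>L Q B (u :: real ^ 'n). \<lbrakk>1 \<le> L; Q \<in> polynomials_upto L; B \<in> sets borel; norm u = 1\<rbrakk> \<Longrightarrow>
      (\<integral>\<^sup>+v. circle_density L u v * indicator B v \<partial>?S) * ennreal (cmod (Q u) powr p) \<le>
        ennreal K * (\<integral>\<^sup>+v. circle_density L u v * (indicator B v * ennreal (cmod (Q v) powr p)) \<partial>?S)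
        + ennreal \<epsilon> * (\<integral>\<^sup>+v. circle_density L u v * ennreal (cmod (Q v) powr p) \<partial>?S)"
    using sphere_logvinenko_sereda_pointwise[OF n p \<epsilon>] by blast
  \<comment> \<open>The summand 1 makes C positive even if K = 0.\<close>
  define C where "C = 2 * K * V / \<delta> + 1"
  have C: "0 < C" using K V0 \<delta> by (simp add: C_def add_nonneg_pos)
  show thesis
  proof (rule that[OF C])
    fix L and Q :: "real ^ 'n \<Rightarrow> complex" and B :: "(real ^ 'n) set"
    assume L: "1 \<le> L" and Q: "Q \<in> polynomials_upto L" and B [measurable]: "B \<in> sets borel"
      and dense: "\<And>u. norm u = 1 \<Longrightarrow> ennreal \<delta> \<le> (\<integral>\<^sup>+v. circle_density L u v * indicator B v \<partial>?S)"
    have cont: "continuous_on UNIV Q" by (rule polynomials_upto_continuous[OF Q])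
    have [measurable]: "Q \<in> borel_measurable borel" by (rule borel_measurable_continuous_onI[OF cont])
    let ?q = "\<lambda>v. ennreal (cmod (Q v) powr p)"
    let ?T = "\<lambda>G u. \<integral>\<^sup>+v. circle_density L u v * G v \<partial>?S"
    let ?I = "\<integral>\<^sup>+v. ?q v \<partial>?S" and ?J = "\<integral>\<^sup>+v. indicator B v * ?q v \<partial>?S"
    have [measurable]: "(\<lambda>u. \<integral>\<^sup>+v. circle_density L u v * G v \<partial>?S) \<in> borel_measurable ?S"
      if [measurable]: "G \<in> borel_measurable borel" for G :: "real ^ 'n \<Rightarrow> ennreal"
    proof -
      have [measurable]: "fst \<in> borel_measurable (?S \<Otimes>\<^sub>M ?S)" "snd \<in> borel_measurable (?S \<Otimes>\<^sub>M ?S)"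
        using measurable_compose[OF measurable_fst borel_measurable_sphere_ident]
          measurable_compose[OF measurable_snd borel_measurable_sphere_ident] by auto
      show ?thesis by measurable
    qed
    have "ennreal \<delta> * ?I = (\<integral>\<^sup>+u. ennreal \<delta> * ?q u \<partial>?S)"
      by (rule nn_integral_cmult[symmetric]) measurable
    also have "\<dots> \<le> (\<integral>\<^sup>+u. ennreal K * ?T (\<lambda>v. indicator B v * ?q v) u + ennreal \<epsilon> * ?T ?q u \<partial>?S)"
    proof (rule nn_integral_mono)
      fix u assume "u \<in> space ?S"
      then have u: "norm u = 1" by simp
      have "ennreal \<delta> * ?q u \<le> (\<integral>\<^sup>+v. circle_density L u v * indicator B v \<partial>?S) * ?q u"
        by (intro mult_right_mono dense u) simp
      also have "\<dots> \<le> ennreal K * ?T (\<lambda>v. indicator B v * ?q v) u + ennreal \<epsilon> * ?T ?q u"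
        by (rule pointwise[OF L Q B u])
      finally show "ennreal \<delta> * ?q u \<le> ennreal K * ?T (\<lambda>v. indicator B v * ?q v) u + ennreal \<epsilon> * ?T ?q u" .
    qed
    also have "\<dots> = ennreal K * (\<integral>\<^sup>+u. ?T (\<lambda>v. indicator B v * ?q v) u \<partial>?S) + ennreal \<epsilon> * (\<integral>\<^sup>+u. ?T ?q u \<partial>?S)"
      by (subst nn_integral_add, measurable, subst (1 2) nn_integral_cmult) auto
    also have "\<dots> \<le> ennreal K * (ennreal V * ?J) + ennreal \<epsilon> * (ennreal V * ?I)"
      unfolding V[symmetric]
      by (intro add_mono mult_left_mono nn_integral_circle_density_iterated_le n) auto
    finally have ineq: "ennreal \<delta> * ?I \<le> ennreal K * (ennreal V * ?J) + ennreal \<epsilon> * (ennreal V * ?I)" .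
    \<comment> \<open>Subtracting half of \<delta> \<open>?I\<close> from both sides requires
      \<open>?I\<close> to be finite, which the boundedness of Q on the sphere provides.\<close>
    obtain b where b: "\<And>v. norm v = 1 \<Longrightarrow> cmod (Q v) powr p \<le> b"
      using polynomials_upto_powr_bounded[OF Q p] by blast
    have "?I \<le> (\<integral>\<^sup>+v. ennreal b \<partial>?S)"
      by (intro nn_integral_mono ennreal_leI b) simp
    also have "\<dots> < \<infinity>"
      by (simp add: emeasure_sphere_borel_measure_space ennreal_mult_less_top)
    finally have I_fin: "?I < \<infinity>" .
    have "?J \<le> ?I" by (intro nn_integral_mono) (auto split: split_indicator)
    then have J_fin: "?J < \<infinity>" using I_fin by (rule le_less_trans)
    define i j where "i = enn2real ?I" and "j = enn2real ?J"
    then have i: "?I = ennreal i" "0 \<le> i" and j: "?J = ennreal j" "0 \<le> j"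
      using I_fin J_fin by (simp_all add: enn2real_nonneg)
    have "\<delta> * i \<le> K * (V * j) + \<epsilon> * (V * i)"
      using ineq i j K V0 \<delta> \<epsilon> unfolding i(1) j(1)
      by (simp add: ennreal_mult[symmetric] ennreal_plus[symmetric] del: ennreal_plus)
    also have "\<epsilon> * (V * i) = \<delta> * i / 2" using V0 by (simp add: \<epsilon>_def)
    finally have "i \<le> 2 * K * V / \<delta> * j" using \<delta> by (simp add: field_simps)
    also have "\<dots> \<le> C * j" unfolding C_def using j by (intro mult_right_mono) auto
    finally show "?I \<le> ennreal C * ?J"
      using C j unfolding i(1) j(1) by (simp add: ennreal_mult[symmetric] ennreal_leI)
  qed
qed

text \<open>The pointwise constant \<open>32 * pi\<close> is halved because the density carries the
  factor \<open>2 * radial_mass CARD('n)\<close>, which is at least 2.\<close>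

lemma circle_density_ge_poisson:
  fixes u :: "real ^ 'n"
  assumes n: "2 \<le> CARD('n)" and u: "norm u = 1" and L: "1 \<le> L" and [measurable]: "B \<in> sets borel"
  shows "(\<integral>\<^sup>+v. indicator B v * ennreal (poisson_kernel ((1 - 1 / real L) *\<^sub>R u) v) \<partial>sphere_borel_measure) \<le>
    ennreal (16 * pi) * (\<integral>\<^sup>+v. circle_density L u v * indicator B v \<partial>sphere_borel_measure)"
proof -
  have "(\<integral>\<^sup>+v. indicator B v * ennreal (poisson_kernel ((1 - 1 / real L) *\<^sub>R u) v) \<partial>sphere_borel_measure) \<le>
      (\<integral>\<^sup>+v. ennreal (16 * pi) * (circle_density L u v * indicator B v) \<partial>sphere_borel_measure)"
  proof (rule nn_integral_mono_AE)
    have sphere: "AE v in sphere_borel_measure. norm (v :: real ^ 'n) = 1" by (rule AE_I2) simp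
    show "AE v in sphere_borel_measure. indicator B v * ennreal (poisson_kernel ((1 - 1 / real L) *\<^sub>R u) v) \<le>
        ennreal (16 * pi) * (circle_density L u v * indicator B v)"
      using AE_perp_nonzero[OF n, of u] sphere
    proof eventually_elim
      fix v :: "real ^ 'n" assume v: "perp u v \<noteq> 0" "norm v = 1"
      let ?w = "ennreal (circle_kernel (real L / (real L + 1)) (u \<bullet> v)) * circle_weight u v"
      have "ennreal (poisson_kernel ((1 - 1 / real L) *\<^sub>R u) v) \<le> ennreal (32 * pi) * ?w"
        by (rule poisson_kernel_le_circle_kernel[OF n u v(2) L v(1)])
      also have "ennreal (32 * pi) = ennreal (16 * pi) * (2 * 1)"
        using ennreal_mult[of "16 * pi" 2] by (simp add: mult.commute)
      also have "ennreal (16 * pi) * (2 * 1) * ?w \<le> ennreal (16 * pi) * (2 * radial_mass CARD('n)) * ?w"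
        by (intro mult_right_mono mult_left_mono radial_mass_bounds) auto
      also have "\<dots> = ennreal (16 * pi) * circle_density L u v"
        by (simp add: circle_density_def mult.assoc)
      finally show "indicator B v * ennreal (poisson_kernel ((1 - 1 / real L) *\<^sub>R u) v) \<le>
          ennreal (16 * pi) * (circle_density L u v * indicator B v)"
        by (simp split: split_indicator)
    qed
  qed
  also have "\<dots> = ennreal (16 * pi) * (\<integral>\<^sup>+v. circle_density L u v * indicator B v \<partial>sphere_borel_measure)"
    by (rule nn_integral_cmult) measurable
  finally show ?thesis .
qed

subsection \<open>Peak polynomials\<close>

text \<open>The index m of a Fejer polynomial of degree m - 1 = \<open>L div n\<close>: its n-th
  power has degree at most L, and still n m > L.\<close>

definition peak_degree :: "nat \<Rightarrow> nat \<Rightarrow> nat" where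
  "peak_degree n L = Suc (L div n)"

text \<open>Normalised to be 1 at v = u for a unit vector u; the exponent is that of |z - v| in the
  Poisson kernel.\<close>

definition peak_polynomial :: "nat \<Rightarrow> real ^ 'n \<Rightarrow> real ^ 'n \<Rightarrow> real" where
  "peak_polynomial L u v =
     (fejer (peak_degree CARD('n) L) (v \<bullet> u) / (real (peak_degree CARD('n) L))\<^sup>2) ^ CARD('n)"

lemma peak_polynomial_upto:
  fixes u :: "real ^ 'n"
  shows "(\<lambda>v. complex_of_real (peak_polynomial L u v)) \<in> polynomials_upto L"
proof -
  let ?n = "CARD('n)" and ?m = "peak_degree CARD('n) L"
  have "(\<lambda>v. inverse (complex_of_real ((real ?m)\<^sup>2)) * complex_of_real (fejer ?m (v \<bullet> u))) \<in> polynomials_upto (0 + L div ?n)"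
    unfolding peak_degree_def by (intro polynomials_upto_mult polynomials_upto_const fejer_polynomials_upto)
  from polynomials_upto_power[OF this, of ?n]
  have "(\<lambda>v. (inverse (complex_of_real ((real ?m)\<^sup>2)) * complex_of_real (fejer ?m (v \<bullet> u))) ^ ?n) \<in> polynomials_upto (?n * (L div ?n))"
    by simp
  then have "(\<lambda>v. (inverse (complex_of_real ((real ?m)\<^sup>2)) * complex_of_real (fejer ?m (v \<bullet> u))) ^ ?n) \<in> polynomials_upto L"
    by (rule polynomials_upto_mono) (simp add: times_div_less_eq_dividend)
  moreover have "(\<lambda>v. (inverse (complex_of_real ((real ?m)\<^sup>2)) * complex_of_real (fejer ?m (v \<bullet> u))) ^ ?n) =
      (\<lambda>v. complex_of_real (peak_polynomial L u v))"
    by (simp add: peak_polynomial_def divide_inverse mult.commute)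
  ultimately show ?thesis by simp
qed

lemma peak_polynomial_bounds:
  fixes u v :: "real ^ 'n"
  assumes u: "norm u = 1" and v: "norm v = 1"
  shows "0 \<le> peak_polynomial L u v" "peak_polynomial L u v \<le> 1"
proof -
  let ?m = "peak_degree CARD('n) L"
  have "\<bar>v \<bullet> u\<bar> \<le> 1" using Cauchy_Schwarz_ineq2[of v u] u v by simp
  note f = fejer_bounds[OF this, of ?m]
  have "0 < ?m" by (simp add: peak_degree_def)
  then show "0 \<le> peak_polynomial L u v" "peak_polynomial L u v \<le> 1"
    using f unfolding peak_polynomial_def by (auto intro!: power_le_one)
qed

text \<open>The two upper bounds for the Fejer polynomial combine to a multiple of 1/D for its
  normalised values, where D = 1 + 2 L^2 (1 - t), while the distance from the pole to v is at most
  D/L.\<close>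

lemma peak_polynomial_le_poisson:
  fixes u v :: "real ^ 'n"
  assumes u: "norm u = 1" and v: "norm v = 1" and L: "1 \<le> L"
  shows "peak_polynomial L u v \<le>
    (1 + 4 * (real CARD('n))\<^sup>2) ^ CARD('n) / real L ^ (CARD('n) - 1) * poisson_kernel ((1 - 1 / real L) *\<^sub>R u) v"
proof -
  let ?n = "CARD('n)" and ?m = "peak_degree CARD('n) L"
  define t where "t = v \<bullet> u"
  define \<rho> where "\<rho> = 1 - 1 / real L"
  define D where "D = 1 + 2 * (real L)\<^sup>2 * (1 - t)"
  have L0: "1 \<le> real L" using L by simp
  have \<rho>: "0 \<le> \<rho>" "\<rho> < 1" using L0 by (auto simp: \<rho>_def)
  have t: "\<bar>t\<bar> \<le> 1" using Cauchy_Schwarz_ineq2[of v u] u v by (simp add: t_def)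
  then have t1: "t \<le> 1" by simp
  have D1: "1 \<le> D" using t1 by (simp add: D_def)
  note f = fejer_bounds[OF t, of ?m]
  have m: "0 < real ?m" by (simp add: peak_degree_def)
  have "L < ?n * ?m"
    unfolding peak_degree_def using dividend_less_times_div[of ?n L] by simp
  then have "real L \<le> real ?n * real ?m" by (simp flip: of_nat_mult)
  then have "(real L)\<^sup>2 \<le> (real ?n * real ?m)\<^sup>2" by (intro power_mono) auto
  then have Lm: "(real L)\<^sup>2 / (real ?m)\<^sup>2 \<le> (real ?n)\<^sup>2"
    using m by (simp add: power_mult_distrib pos_divide_le_eq)
  have "fejer ?m t / (real ?m)\<^sup>2 * D = fejer ?m t / (real ?m)\<^sup>2 + 2 * ((real L)\<^sup>2 / (real ?m)\<^sup>2) * (fejer ?m t * (1 - t))"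
    by (simp add: D_def algebra_simps add_divide_distrib diff_divide_distrib)
  also have "\<dots> \<le> 1 + 2 * (real ?n)\<^sup>2 * 2"
    using f m Lm t1 by (intro add_mono mult_mono) auto
  finally have "fejer ?m t / (real ?m)\<^sup>2 * D \<le> 1 + 4 * (real ?n)\<^sup>2" by simp
  then have "fejer ?m t / (real ?m)\<^sup>2 \<le> (1 + 4 * (real ?n)\<^sup>2) / D"
    using D1 by (simp add: pos_le_divide_eq)
  then have "peak_polynomial L u v \<le> ((1 + 4 * (real ?n)\<^sup>2) / D) ^ ?n"
    unfolding peak_polynomial_def t_def[symmetric] using f by (intro power_mono) auto
  also have "\<dots> = (1 + 4 * (real ?n)\<^sup>2) ^ ?n * (1 / D ^ ?n)" by (simp add: power_divide)
  finally have peak: "peak_polynomial L u v \<le> (1 + 4 * (real ?n)\<^sup>2) ^ ?n * (1 / D ^ ?n)" .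
  have kernel: "1 / D ^ ?n \<le> 1 / real L ^ (?n - 1) * poisson_kernel (\<rho> *\<^sub>R u) v"
  proof -
    have "(norm (\<rho> *\<^sub>R u - v))\<^sup>2 = (1 - \<rho>)\<^sup>2 + 2 * \<rho> * (1 - t)"
      unfolding power2_norm_eq_inner inner_diff_left inner_diff_right t_def
      using u v by (simp add: dot_square_norm inner_commute power2_eq_square algebra_simps)
    also have "\<dots> \<le> (1 - \<rho>)\<^sup>2 + 2 * 1 * (1 - t)"
      using \<rho> t1 by (intro add_mono mult_right_mono) auto
    also have "\<dots> = D / (real L)\<^sup>2" using L0 by (simp add: \<rho>_def D_def field_simps)
    \<comment> \<open>Giving away a factor D makes the distance itself, not its square, comparable
      with D; then the n-th powers match.\<close>
    also have "\<dots> \<le> D * D / (real L)\<^sup>2" using D1 by (intro divide_right_mono) auto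
    also have "\<dots> = (D / real L)\<^sup>2" by (simp add: power2_eq_square)
    finally have dist: "norm (\<rho> *\<^sub>R u - v) \<le> D / real L"
      by (rule power2_le_imp_le) (use D1 L0 in simp)
    have "1 - \<rho> \<le> norm (\<rho> *\<^sub>R u - v)"
      using norm_triangle_ineq2[of v "\<rho> *\<^sub>R u"] u v \<rho> by (simp add: norm_minus_commute)
    then have pos: "0 < norm (\<rho> *\<^sub>R u - v)" using \<rho> by linarith
    have "real L ^ ?n = real L * real L ^ (?n - 1)"
      using power_minus_mult[of ?n "real L"] by (simp add: mult.commute)
    then have eq: "1 / D ^ ?n = 1 / real L ^ (?n - 1) * ((1 / real L) / (D / real L) ^ ?n)"
      using L0 by (simp add: power_divide)
    have "(1 / real L) / (D / real L) ^ ?n \<le> (1 - \<rho>\<^sup>2) / norm (\<rho> *\<^sub>R u - v) ^ ?n"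
    proof (rule frac_le)
      have "1 / real L = (1 - \<rho>) * 1" by (simp add: \<rho>_def)
      also have "\<dots> \<le> (1 - \<rho>) * (1 + \<rho>)" using \<rho> by (intro mult_left_mono) auto
      also have "\<dots> = 1 - \<rho>\<^sup>2" by (simp add: power2_eq_square algebra_simps)
      finally show "1 / real L \<le> 1 - \<rho>\<^sup>2" .
    qed (use dist pos L0 \<rho> in \<open>auto intro!: power_mono simp: power_le_one\<close>)
    also have "\<dots> = poisson_kernel (\<rho> *\<^sub>R u) v" using u \<rho> by (simp add: poisson_kernel_def)
    finally show ?thesis unfolding eq using L0 by (intro mult_left_mono) auto
  qed
  note peak
  also have "(1 + 4 * (real ?n)\<^sup>2) ^ ?n * (1 / D ^ ?n) \<le>
      (1 + 4 * (real ?n)\<^sup>2) ^ ?n * (1 / real L ^ (?n - 1) * poisson_kernel (\<rho> *\<^sub>R u) v)"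
    using kernel by (intro mult_left_mono) auto
  finally show ?thesis by (simp add: \<rho>_def)
qed

lemma peak_polynomial_mass:
  fixes p :: real
  assumes n: "2 \<le> CARD('n)" and p: "1 \<le> p"
  obtains c where "0 < c"
    and "\<And>L (u :: real ^ 'n). \<lbrakk>1 \<le> L; norm u = 1\<rbrakk> \<Longrightarrow>
      ennreal (c / real L ^ (CARD('n) - 1)) \<le>
        (\<integral>\<^sup>+v. ennreal (peak_polynomial L u v powr p) \<partial>sphere_borel_measure)"
proof -
  let ?n = "CARD('n)" and ?S = "sphere_borel_measure :: (real ^ 'n) measure"
  define R where "R = enn2real (radial_mass ?n)"
  then have R: "radial_mass ?n = ennreal R" "0 \<le> R"
    using radial_mass_bounds(2)[of ?n] by (simp_all add: enn2real_nonneg)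
  then have R1: "1 \<le> R" using radial_mass_bounds(1)[of ?n] by simp
  define b where "b = measure lborel (ball (0 :: real ^ 'n) (1/4))"
  have b: "emeasure lborel (ball w (1/4)) = ennreal b" for w :: "real ^ 'n"
    by (simp add: b_def emeasure_ball measure_def)
  have b0: "0 < b" by (simp add: b_def content_ball_pos)
  define a where "a = ((1/4) ^ ?n) powr p"
  have a0: "0 < a" by (simp add: a_def)
  \<comment> \<open>Factors: b for the volume of the shell, a for the p-th power of the peak's lower
    bound 4^(-n), 1/8 per sine factor, and the arc length factor 1/4 divided by 2 R.\<close>
  define c where "c = b * a * (1/8) ^ (?n - 2) / (8 * R)"
  have c0: "0 < c" using a0 b0 R1 by (simp add: c_def)
  show thesis
  proof (rule that[OF c0])
    fix L :: nat and u :: "real ^ 'n" assume L: "1 \<le> L" and u: "norm u = 1"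
    have L0: "1 \<le> real L" using L by simp
    let ?m = "peak_degree ?n L"
    have "?m \<le> 2 * L" unfolding peak_degree_def using L div_le_dividend[of L ?n] by linarith
    then have "real ?m \<le> real (2 * L)" by (simp only: of_nat_le_iff)
    then have m: "0 < ?m" "real ?m \<le> 2 * real L" by (simp_all add: peak_degree_def)
    let ?q = "\<lambda>v. peak_polynomial L u v powr p"
    have [measurable]: "peak_polynomial L u \<in> borel_measurable borel"
    proof -
      have "continuous_on UNIV (\<lambda>v. Re (complex_of_real (peak_polynomial L u v)))"
        by (intro continuous_intros polynomials_upto_continuous[OF peak_polynomial_upto])
      then show ?thesis by (intro borel_measurable_continuous_onI) simp
    qed
    \<comment> \<open>The power of the sine cancels \<open>circle_weight\<close>.\<close>
    define F where "F v = ennreal (?q v * norm (perp u v) ^ (?n - 2))" for v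
    have [measurable]: "F \<in> borel_measurable borel" unfolding F_def by measurable
    \<comment> \<open>On this arc the angle is at most 1/m, as m \<le> 2 L, so the peak is high; and
      it is at least 1/(4L), so that its sine is at least 1/(8L).\<close>
    let ?J = "{1 / (4 * real L)..1 / (2 * real L)}"
    have on_circle: "ennreal (a * (1 / (8 * real L)) ^ (?n - 2)) * indicator ?J t \<le>
        F (cos t *\<^sub>R u + sin t *\<^sub>R sgn (perp u x)) * indicator {0..2*pi} t" if x: "x \<in> slab_shell u" for x t
    proof (cases "t \<in> ?J")
      case True
      let ?v = "cos t *\<^sub>R u + sin t *\<^sub>R sgn (perp u x)"
      have "0 < 1 / (4 * real L)" using L0 by simp
      then have t0: "0 < t" using True by (meson atLeastAtMost_iff less_le_trans)
      have "1 / (2 * real L) \<le> 1 / 2" using L0 by (simp add: field_simps)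
      then have t1: "t \<le> 1 / 2" using True by (meson atLeastAtMost_iff order_trans)
      have "real ?m * t \<le> (2 * real L) * (1 / (2 * real L))"
        using m t0 True L0 by (intro mult_mono) auto
      then have mt: "real ?m * t \<le> 1" using L0 by simp
      have "norm (sgn (perp u x)) = 1" using x by (auto simp: norm_sgn slab_shell_def)
      moreover have st: "t / 2 \<le> sin t" using half_le_sin[of t] t0 t1 by simp
      ultimately have "norm (perp u ?v) = sin t"
        using t0 by (simp add: perp_on_circle(2)[OF u sgn_perp_inner[OF u]])
      moreover have "1 / (8 * real L) \<le> t / 2" using True by simp
      ultimately have 1: "(1 / (8 * real L)) ^ (?n - 2) \<le> norm (perp u ?v) ^ (?n - 2)"
        using st L0 by (intro power_mono) auto
      have "?v \<bullet> u = cos t"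
        using perp_on_circle(1)[OF u sgn_perp_inner[OF u], of t x] by (simp add: inner_commute)
      then have "(1/4) ^ ?n \<le> peak_polynomial L u ?v"
        using fejer_lower_bound[OF t0 mt m(1)] m(1)
        unfolding peak_polynomial_def by (intro power_mono) (auto simp: pos_le_divide_eq)
      then have 2: "a \<le> ?q ?v" unfolding a_def using p by (intro powr_mono2) auto
      have "a * (1 / (8 * real L)) ^ (?n - 2) \<le> ?q ?v * norm (perp u ?v) ^ (?n - 2)"
        using 1 2 a0 L0 by (intro mult_mono) auto
      moreover have "t \<in> {0..2*pi}" using t0 t1 pi_gt3 by auto
      ultimately show ?thesis using True unfolding F_def by (simp add: ennreal_leI)
    qed simp
    obtain w where w: "ball w (1/4) \<subseteq> slab_shell u" using slab_shell_superset_ball[OF n u] .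
    have "ennreal b * ennreal (a * (1 / (8 * real L)) ^ (?n - 2) * (1 / (4 * real L))) \<le>
        emeasure lborel (slab_shell u) * ennreal (a * (1 / (8 * real L)) ^ (?n - 2) * (1 / (4 * real L)))"
      unfolding b[of w, symmetric] by (intro mult_right_mono emeasure_mono w) auto
    also have "\<dots> = (\<integral>\<^sup>+x. indicator (slab_shell u) x *
        (\<integral>\<^sup>+t. ennreal (a * (1 / (8 * real L)) ^ (?n - 2)) * indicator ?J t \<partial>lborel) \<partial>lborel)"
    proof -
      have len: "emeasure lborel ?J = ennreal (1 / (4 * real L))"
        using L0 by (subst emeasure_lborel_Icc) (auto simp: field_simps)
      have "(\<integral>\<^sup>+t. ennreal (a * (1 / (8 * real L)) ^ (?n - 2)) * indicator ?J t \<partial>lborel) =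
          ennreal (a * (1 / (8 * real L)) ^ (?n - 2)) * emeasure lborel ?J"
        by (rule nn_integral_cmult_indicator) simp
      also have "\<dots> = ennreal (a * (1 / (8 * real L)) ^ (?n - 2) * (1 / (4 * real L)))"
        unfolding len using a0 L0 by (intro ennreal_mult[symmetric]) auto
      finally show ?thesis
        by (simp add: nn_integral_multc)
    qed
    also have "\<dots> \<le> (\<integral>\<^sup>+x. indicator (slab_shell u) x *
        (\<integral>\<^sup>+t. F (cos t *\<^sub>R u + sin t *\<^sub>R sgn (perp u x)) * indicator {0..2*pi} t \<partial>lborel) \<partial>lborel)"
    proof (rule nn_integral_mono)
      fix x
      show "indicator (slab_shell u) x * (\<integral>\<^sup>+t. ennreal (a * (1 / (8 * real L)) ^ (?n - 2)) * indicator ?J t \<partial>lborel) \<le>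
          indicator (slab_shell u) x *
          (\<integral>\<^sup>+t. F (cos t *\<^sub>R u + sin t *\<^sub>R sgn (perp u x)) * indicator {0..2*pi} t \<partial>lborel)"
      proof (cases "x \<in> slab_shell u")
        case True
        then show ?thesis by (intro mult_left_mono nn_integral_mono on_circle) auto
      qed simp
    qed
    also have "\<dots> = 2 * radial_mass ?n * (\<integral>\<^sup>+v. F v * circle_weight u v \<partial>?S)"
      by (rule great_circle_average[OF _ n u, symmetric]) measurable
    also have "\<dots> \<le> 2 * radial_mass ?n * (\<integral>\<^sup>+v. ennreal (?q v) \<partial>?S)"
    proof (intro mult_left_mono nn_integral_mono)
      fix v :: "real ^ 'n"
      show "F v * circle_weight u v \<le> ennreal (?q v)"
      proof (cases "perp u v = 0")
        case False
        have "?n - 1 = Suc (?n - 2)" using n by simp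
        then have "norm (perp u v) ^ (?n - 2) * (norm (perp u v) / norm (perp u v) ^ (?n - 1)) = 1"
          using False by simp
        then show ?thesis
          unfolding F_def circle_weight_def
          by (simp add: ennreal_mult[symmetric] mult.assoc)
      qed (simp add: circle_weight_def)
    qed simp
    finally have main: "ennreal b * ennreal (a * (1 / (8 * real L)) ^ (?n - 2) * (1 / (4 * real L))) \<le>
        2 * radial_mass ?n * (\<integral>\<^sup>+v. ennreal (?q v) \<partial>?S)" .
    have "?n - 1 = Suc (?n - 2)" using n by simp
    then have Ln: "real L ^ (?n - 1) = real L * real L ^ (?n - 2)" by simp
    have "b * (a * (1 / (8 * real L)) ^ (?n - 2) * (1 / (4 * real L))) = 2 * R * (c / real L ^ (?n - 1))"
      using R1 L0 unfolding Ln c_def by (simp add: power_divide power_mult_distrib field_simps)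
    then have "ennreal (2 * R) * ennreal (c / real L ^ (?n - 1)) =
        ennreal b * ennreal (a * (1 / (8 * real L)) ^ (?n - 2) * (1 / (4 * real L)))"
      using R1 c0 b0 a0 L0 by (simp add: ennreal_mult[symmetric])
    also have "\<dots> \<le> ennreal (2 * R) * (\<integral>\<^sup>+v. ennreal (?q v) \<partial>?S)"
      using main R by (simp add: ennreal_mult)
    finally show "ennreal (c / real L ^ (?n - 1)) \<le> (\<integral>\<^sup>+v. ennreal (?q v) \<partial>?S)"
      using R1 by (subst (asm) ennreal_mult_le_mult_iff) auto
  qed
qed

lemma polynomial_integral_eq_nn_integral:
  fixes Q :: "real ^ 'n \<Rightarrow> complex"
  assumes Q: "Q \<in> polynomials_upto L" and p: "0 < p"
    and A: "A \<in> sets sphere_measure" and B: "B \<in> sets borel" and AB: "AE v in sphere_measure. v \<in> A \<longleftrightarrow> v \<in> B"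
  shows "ennreal (LINT v:A|sphere_measure. cmod (Q v) powr p) =
    (\<integral>\<^sup>+v. indicator B v * ennreal (cmod (Q v) powr p) \<partial>sphere_borel_measure)"
proof -
  have cont: "continuous_on UNIV Q" by (rule polynomials_upto_continuous[OF Q])
  have [measurable]: "Q \<in> borel_measurable borel" by (rule borel_measurable_continuous_onI[OF cont])
  obtain b where b: "\<And>v. norm v = 1 \<Longrightarrow> cmod (Q v) powr p \<le> b"
    using polynomials_upto_powr_bounded[OF Q p] by blast
  show ?thesis
    by (rule set_integral_sphere_eq_nn_integral[OF _ _ _ A B AB, of _ b]) (use b in auto)
qed

section \<open>The two implications\<close>

theorem mainTheorem1:
  fixes d :: nat and p :: real and E :: "nat \<Rightarrow> (real ^ 'n) set"
  assumes "d \<ge> 1"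
    and "CARD('n) = d + 1"
    and "1 \<le> p"
    and "\<And>L. L \<ge> 1 \<Longrightarrow> E L \<in> sets sphere_measure"
  shows "(\<exists>C>0. \<forall>L\<ge>1. \<forall>Q\<in>polynomials_upto L.
            (LINT u:sphere 0 1|sphere_measure. cmod (Q u) powr p)
              \<le> C * (LINT u:E L|sphere_measure. cmod (Q u) powr p))
         \<longleftrightarrow>
         Inf {harmonic_measure z (E L) | L z. L \<ge> 1 \<and> norm z < 1 \<and> 1 - norm z = 1 / real L} > 0"
  (is "?sampling \<longleftrightarrow> Inf ?H > 0")
proof -
  let ?S = "sphere_borel_measure :: (real ^ 'n) measure"
  let ?\<sigma> = "measure sphere_measure (sphere 0 1 :: (real ^ 'n) set)"
  have n: "2 \<le> CARD('n)" and p: "0 < p" using assms by auto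
  note \<sigma> = measure_sphere_pos[where 'n = 'n]
  \<comment> \<open>Measurability is assumed for L \<ge> 1, hence the guarded choice.\<close>
  have "\<exists>B. 1 \<le> L \<longrightarrow> B \<in> sets borel \<and> (AE v in sphere_measure. v \<in> E L \<longleftrightarrow> v \<in> B)" for L
  proof (cases "1 \<le> L")
    case True
    from borel_version[OF assms(4)[OF True]] show ?thesis by blast
  qed simp
  then have "\<exists>B. \<forall>L. 1 \<le> L \<longrightarrow> B L \<in> sets borel \<and> (AE v in sphere_measure. v \<in> E L \<longleftrightarrow> v \<in> B L)"
    by (intro choice allI)
  then obtain B where B: "\<And>L. 1 \<le> L \<Longrightarrow> B L \<in> sets borel"
    and EB: "\<And>L. 1 \<le> L \<Longrightarrow> AE v in sphere_measure. v \<in> E L \<longleftrightarrow> v \<in> B L"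
    by blast
  have sphere_sets: "sphere 0 1 \<in> sets (sphere_measure :: (real ^ 'n) measure)"
    using sets.top[of "sphere_measure :: (real ^ 'n) measure"] by (simp add: space_sphere_measure)
  have total: "ennreal (LINT u:sphere 0 1|sphere_measure. cmod (Q u) powr p) = (\<integral>\<^sup>+v. ennreal (cmod (Q v) powr p) \<partial>?S)"
    if "Q \<in> polynomials_upto L" for Q and L
    using polynomial_integral_eq_nn_integral[OF that p sphere_sets, of UNIV]
      AE_I2[of "sphere_measure :: (real ^ 'n) measure" "\<lambda>v. v \<in> sphere 0 1 \<longleftrightarrow> v \<in> UNIV"]
    by (simp add: space_sphere_measure)
  have part: "ennreal (LINT u:E L|sphere_measure. cmod (Q u) powr p) =
      (\<integral>\<^sup>+v. indicator (B L) v * ennreal (cmod (Q v) powr p) \<partial>?S)"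
    if "Q \<in> polynomials_upto L" "1 \<le> L" for Q L
    using polynomial_integral_eq_nn_integral[OF that(1) p assms(4) B EB] that(2) by blast
  have part_nonneg: "0 \<le> (LINT u:E L|sphere_measure. cmod (Q u) powr p)" for Q L
    by (auto simp: set_lebesgue_integral_def intro!: integral_nonneg_AE)
  have hm: "ennreal (?\<sigma> * harmonic_measure z (E L)) =
      (\<integral>\<^sup>+v. indicator (B L) v * ennreal (poisson_kernel z v) \<partial>?S)" if "1 \<le> L" "norm z < 1" for z L
    using harmonic_measure_eq_nn_integral[OF that(2) assms(4) B EB] that(1) by blast
  \<comment> \<open>The real \<open>Inf\<close> is meaningful only for a nonempty set bounded below;
    L = 1 with z = 0 is a witness.\<close>
  have H_nonempty: "?H \<noteq> {}"
    by (auto intro!: exI[of _ "1::nat"] exI[of _ "0 :: real ^ 'n"])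
  have H_bdd: "bdd_below ?H"
    by (rule bdd_belowI[of _ 0]) (auto intro: harmonic_measure_nonneg)
  show ?thesis
  proof
    assume "Inf ?H > 0"
    define h where "h = Inf ?H"
    have h0: "0 < h" using \<open>Inf ?H > 0\<close> by (simp add: h_def)
    \<comment> \<open>The total mass undoes the normalisation of the harmonic measure;
      \<open>16 * pi\<close> is the constant of \<open>circle_density_ge_poisson\<close>.\<close>
    define \<delta> where "\<delta> = ?\<sigma> * h / (16 * pi)"
    have \<delta>: "0 < \<delta>" using h0 \<sigma> by (simp add: \<delta>_def)
    obtain C where C: "0 < C" and LS: "\<And>L Q B. \<lbrakk>1 \<le> L; Q \<in> polynomials_upto L; B \<in> sets borel;
        \<And>u :: real ^ 'n. norm u = 1 \<Longrightarrow> ennreal \<delta> \<le> (\<integral>\<^sup>+v. circle_density L u v * indicator B v \<partial>?S)\<rbrakk> \<Longrightarrow>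
      (\<integral>\<^sup>+v. ennreal (cmod (Q v) powr p) \<partial>?S) \<le> ennreal C * (\<integral>\<^sup>+v. indicator B v * ennreal (cmod (Q v) powr p) \<partial>?S)"
      using sphere_logvinenko_sereda[OF n p \<delta>] by blast
    have "(LINT u:sphere 0 1|sphere_measure. cmod (Q u) powr p) \<le> C * (LINT u:E L|sphere_measure. cmod (Q u) powr p)"
      if L: "1 \<le> L" and Q: "Q \<in> polynomials_upto L" for L Q
    proof -
      have "ennreal \<delta> \<le> (\<integral>\<^sup>+v. circle_density L u v * indicator (B L) v \<partial>?S)" if u: "norm u = 1" for u
      proof -
        let ?z = "(1 - 1 / real L) *\<^sub>R u"
        have z: "norm ?z = 1 - 1 / real L" "norm ?z < 1" using L u by auto
        have "harmonic_measure ?z (E L) \<in> ?H"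
          by (intro CollectI exI[of _ L] exI[of _ ?z] conjI refl L z(2)) (use z(1) in linarith)
        then have "h \<le> harmonic_measure ?z (E L)" unfolding h_def by (rule cInf_lower[OF _ H_bdd])
        then have "ennreal (16 * pi * \<delta>) \<le> ennreal (?\<sigma> * harmonic_measure ?z (E L))"
          using \<sigma> by (intro ennreal_leI) (simp add: \<delta>_def)
        also have "\<dots> \<le> ennreal (16 * pi) * (\<integral>\<^sup>+v. circle_density L u v * indicator (B L) v \<partial>?S)"
          unfolding hm[OF L z(2)] by (rule circle_density_ge_poisson[OF n u L B[OF L]])
        finally have "ennreal (16 * pi) * ennreal \<delta> \<le> ennreal (16 * pi) * (\<integral>\<^sup>+v. circle_density L u v * indicator (B L) v \<partial>?S)"
          using \<delta> by (simp add: ennreal_mult)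
        then show ?thesis by (subst (asm) ennreal_mult_le_mult_iff) auto
      qed
      from LS[OF L Q B[OF L] this] show ?thesis
        unfolding total[OF Q, symmetric] part[OF Q L, symmetric]
        using C part_nonneg by (simp add: ennreal_mult[symmetric])
    qed
    then show ?sampling using C by blast
  next
    assume ?sampling
    then obtain C where C: "0 < C" and samp: "\<And>L Q. 1 \<le> L \<Longrightarrow> Q \<in> polynomials_upto L \<Longrightarrow>
        (LINT u:sphere 0 1|sphere_measure. cmod (Q u) powr p) \<le> C * (LINT u:E L|sphere_measure. cmod (Q u) powr p)"
      by blast
    obtain c where c: "0 < c" and mass: "\<And>L (u :: real ^ 'n). \<lbrakk>1 \<le> L; norm u = 1\<rbrakk> \<Longrightarrow>
        ennreal (c / real L ^ (CARD('n) - 1)) \<le> (\<integral>\<^sup>+v. ennreal (peak_polynomial L u v powr p) \<partial>?S)"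
      using peak_polynomial_mass[OF n assms(3)] by blast
    define M where "M = (1 + 4 * (real CARD('n))\<^sup>2) ^ CARD('n)"
    have M: "0 < M" unfolding M_def by (intro zero_less_power add_pos_nonneg) auto
    have "c / (C * M * ?\<sigma>) \<le> harmonic_measure z (E L)"
      if L: "1 \<le> L" and z: "norm z < 1" "1 - norm z = 1 / real L" for L z
    proof -
      define \<rho> where "\<rho> = 1 - 1 / real L"
      \<comment> \<open>At z = 0, that is L = 1, the radius \<rho> is 0 and any unit vector will
        do.\<close>
      have "\<exists>u. norm u = 1 \<and> z = \<rho> *\<^sub>R u"
      proof (cases "z = 0")
        case True
        then show ?thesis using z by (intro exI[of _ "axis undefined 1"]) (simp add: \<rho>_def norm_axis_1)
      next
        case False
        moreover have "\<rho> = norm z" using z unfolding \<rho>_def by linarith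
        ultimately show ?thesis by (intro exI[of _ "sgn z"]) (simp add: norm_sgn sgn_div_norm)
      qed
      then obtain u where u: "norm u = 1" "z = \<rho> *\<^sub>R u" by blast
      let ?q = "peak_polynomial L u"
      let ?Q = "\<lambda>v. complex_of_real (?q v)"
      let ?Ln = "real L ^ (CARD('n) - 1)"
      have L0: "0 < ?Ln" using L by simp
      note Q = peak_polynomial_upto[of L u]
      have abs: "cmod (?Q v) powr p = ?q v powr p" if "norm v = 1" for v
        using peak_polynomial_bounds[OF u(1) that] by simp
      have "ennreal (c / ?Ln) \<le> (\<integral>\<^sup>+v. ennreal (?q v powr p) \<partial>?S)" by (rule mass[OF L u(1)])
      also have "\<dots> = (\<integral>\<^sup>+v. ennreal (cmod (?Q v) powr p) \<partial>?S)"
        by (intro nn_integral_cong) (simp add: abs del: norm_of_real)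
      also have "\<dots> \<le> ennreal (C * (LINT u:E L|sphere_measure. cmod (?Q u) powr p))"
        unfolding total[OF Q, symmetric] by (intro ennreal_leI samp L Q)
      also have "\<dots> = ennreal C * (\<integral>\<^sup>+v. indicator (B L) v * ennreal (cmod (?Q v) powr p) \<partial>?S)"
        unfolding part[OF Q L, symmetric] by (intro ennreal_mult less_imp_le[OF C] part_nonneg)
      also have "\<dots> \<le> ennreal C * (\<integral>\<^sup>+v. ennreal (M / ?Ln) * (indicator (B L) v * ennreal (poisson_kernel z v)) \<partial>?S)"
      proof (intro mult_left_mono nn_integral_mono)
        fix v assume "v \<in> space ?S"
        then have v: "norm v = 1" by simp
        note bounds = peak_polynomial_bounds[OF u(1) v, of L]
        \<comment> \<open>The peak polynomial takes values in [0, 1] and p \<ge> 1, so its p-th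
          power is dominated by the Poisson kernel too.\<close>
        have "?q v powr p \<le> ?q v powr 1"
          using bounds assms(3) by (intro powr_mono') auto
        also have "\<dots> \<le> M / ?Ln * poisson_kernel z v"
          using bounds peak_polynomial_le_poisson[OF u(1) v L] by (simp add: M_def u(2) \<rho>_def)
        finally have "ennreal (cmod (?Q v) powr p) \<le> ennreal (M / ?Ln) * ennreal (poisson_kernel z v)"
          using M L0 poisson_kernel_nonneg[OF z(1)] unfolding abs[OF v]
          by (subst ennreal_mult[symmetric]) (auto intro: ennreal_leI)
        then show "indicator (B L) v * ennreal (cmod (?Q v) powr p) \<le>
            ennreal (M / ?Ln) * (indicator (B L) v * ennreal (poisson_kernel z v))"
          by (simp split: split_indicator)
      qed simp
      also have "\<dots> = ennreal C * (ennreal (M / ?Ln) * ennreal (?\<sigma> * harmonic_measure z (E L)))"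
        using B[OF L] unfolding hm[OF L z(1)] by (subst nn_integral_cmult) auto
      also have "\<dots> = ennreal (C * (M / ?Ln * (?\<sigma> * harmonic_measure z (E L))))"
      proof -
        have "0 \<le> M / ?Ln" using M L0 by (intro divide_nonneg_pos) auto
        moreover have "0 \<le> ?\<sigma> * harmonic_measure z (E L)"
          using \<sigma> harmonic_measure_nonneg[OF z(1)] by (intro mult_nonneg_nonneg) auto
        ultimately show ?thesis
          by (simp only: ennreal_mult[symmetric] mult_nonneg_nonneg less_imp_le[OF C])
      qed
      finally have "c / ?Ln \<le> C * (M / ?Ln * (?\<sigma> * harmonic_measure z (E L)))"
        using C M L0 \<sigma> harmonic_measure_nonneg[OF z(1)] by (subst (asm) ennreal_le_iff) auto
      also have "\<dots> = harmonic_measure z (E L) * (C * M * ?\<sigma>) / ?Ln" by simp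
      finally have "c \<le> harmonic_measure z (E L) * (C * M * ?\<sigma>)"
        using L0 by (simp only: divide_le_cancel)
      then show ?thesis using C M \<sigma> by (simp only: pos_divide_le_eq mult_pos_pos)
    qed
    then have "c / (C * M * ?\<sigma>) \<le> Inf ?H"
      by (intro cInf_greatest[OF H_nonempty]) auto
    moreover have "0 < c / (C * M * ?\<sigma>)" using c C M \<sigma> by simp
    ultimately show "Inf ?H > 0" by linarith
  qed
qed

end
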